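(* Let $m\in\{1,\dots,d\}$ and let $\mathbf{S}(n)=\sum_{i=1}^n\mathbf{Y}_i$, $\mathbf{S}(0)=0$, be a random walk in $\mathbb{R}^d$ with i.i.d. steps such that $\mathbb{E}[\mathbf{Y}_1]=0$ and $\mathbb{E}[\|\mathbf{Y}_1\|^{mp}]<\infty$ for some $p>2$. Suppose that $\mathbb{P}(\mathbf{Y}_1\in h)=0$ for every affine hyperplane $h\subset\mathbb{R}^d$. Let $\{\mathbf{X}(t)\}_{t\ge0}$ be the Brownian motion in $\mathbb{R}^d$ arising as the limit $\mathbf{S}(n)/\sqrt n\xrightarrow{\mathcal{D}}\mathbf{X}(1)$. Then $$\operatorname{Var}\bigl(V_m(\mathrm{conv}\,\mathbf{X}[0,1])\bigr)<\infty$$ and $$\lim_{n\to\infty}\frac{\operatorname{Var}\bigl(V_m(\mathrm{conv}\{\mathbf{S}(0),\ldots,\mathbf{S}(n)\})\bigr)}{n^m}=\operatorname{Var}\bigl(V_m(\mathrm{conv}\,\mathbf{X}[0,1])\bigr).$$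
   Context: $\mathbf{X}$ is a continuous centered Brownian motion with covariance of $\mathbf{X}(1)$ equal to $\mathbb{E}[\mathbf{Y}_1\mathbf{Y}_1^t]$. $\mathrm{conv}$ is the convex hull and $\mathbf{X}[0,1]=\mathrm{cl}\{\mathbf{X}(t):t\in[0,1]\}$. Intrinsic volumes $V_0(A),\dots,V_d(A)$ of a convex body $A\subset\mathbb{R}^d$ are defined by the Steiner formula $\mathrm{Vol}_d(A+\rho B^d)=\sum_{m=0}^d\rho^{d-m}\kappa_{d-m}V_m(A)$, $\rho\ge0$, where $B^d$ is the closed unit ball and $\kappa_d=\mathrm{Vol}_d(B^d)$. *)

theory Defs
  imports "HOL-Probability.Probability"
begin

text \<open>
  The intrinsic volumes of a convex body in \<open>\<real>\<^sup>d\<close>, \<open>d = CARD('n)\<close>, are the coefficients in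
  the Steiner formula; \<open>unit_ball_vol k\<close> is the volume of the unit ball of \<open>\<real>\<^sup>k\<close>. The formula
  determines only the coefficients with index at most \<open>d\<close>; the others are set to zero so that the
  description is unique (lemma \<open>steiner_coefficients_unique\<close>).
\<close>

definition steiner_coefficients :: "(real^'n) set \<Rightarrow> (nat \<Rightarrow> real) \<Rightarrow> bool" where
  "steiner_coefficients A V \<longleftrightarrow>
     (\<forall>\<rho>\<ge>0. measure lebesgue {x + \<rho> *\<^sub>R b | x b. x \<in> A \<and> b \<in> cball 0 1} =
        (\<Sum>m\<le>CARD('n). \<rho> ^ (CARD('n) - m) * unit_ball_vol (real (CARD('n) - m)) * V m)) \<and>
     (\<forall>m>CARD('n). V m = 0)"

definition intrinsic_volume :: "nat \<Rightarrow> (real^'n) set \<Rightarrow> real" where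
  "intrinsic_volume m A = (THE V. steiner_coefficients A V) m"

lemma steiner_coefficients_unique:
  fixes A :: "(real^'n) set"
  assumes V: "steiner_coefficients A V" and W: "steiner_coefficients A W"
  shows "V = W"
proof
  fix m
  let ?d = "CARD('n)"
  define c where "c i = unit_ball_vol (real i) * (V (?d - i) - W (?d - i))" for i :: nat
  have flip: "(\<Sum>m\<le>?d. g m) = (\<Sum>i\<le>?d. g (?d - i))" for g :: "nat \<Rightarrow> real"
    by (rule sum.reindex_bij_witness[where i = "\<lambda>i. ?d - i" and j = "\<lambda>i. ?d - i"]) auto
  have zero: "(\<Sum>i\<le>?d. c i * \<rho> ^ i) = 0" if "\<rho> \<ge> 0" for \<rho> :: real
  proof -
    let ?f = "\<lambda>U m. \<rho> ^ (?d - m) * unit_ball_vol (real (?d - m)) * U m :: real"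
    have "(\<Sum>m\<le>?d. ?f V m) = (\<Sum>m\<le>?d. ?f W m)"
      using V that W unfolding steiner_coefficients_def by (metis (lifting))
    then have "(\<Sum>m\<le>?d. ?f V m - ?f W m) = 0"
      by (simp only: sum_subtractf right_minus_eq)
    then have "(\<Sum>i\<le>?d. ?f V (?d - i) - ?f W (?d - i)) = 0"
      using flip[of "\<lambda>m. ?f V m - ?f W m"] by linarith
    moreover have "(\<Sum>i\<le>?d. ?f V (?d - i) - ?f W (?d - i)) = (\<Sum>i\<le>?d. c i * \<rho> ^ i)"
      by (intro sum.cong refl) (simp add: c_def algebra_simps)
    ultimately show ?thesis by simp
  qed
  have "c i = 0" if "i \<le> ?d" for i
  proof (rule ccontr)
    assume "c i \<noteq> 0"
    then have "finite {\<rho>. (\<Sum>i\<le>?d. c i * \<rho> ^ i) = 0}"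
      using that by (intro polyfun_roots_finite)
    then have "finite {0::real..}"
      by (rule rev_finite_subset) (use zero in auto)
    then show False
      using infinite_Ici by blast
  qed
  then show "V m = W m"
  proof (cases "m \<le> ?d")
    case True
    then have "c (?d - m) = 0"
      using \<open>\<And>i. i \<le> ?d \<Longrightarrow> c i = 0\<close> by simp
    moreover have "unit_ball_vol (real (?d - m)) \<noteq> 0"
      by (metis less_irrefl of_nat_0_le_iff unit_ball_vol_pos)
    ultimately show ?thesis
      using True by (simp add: c_def)
  next
    case False
    then show ?thesis
      using V W by (simp add: steiner_coefficients_def)
  qed
qed

lemma intrinsic_volume_eq:
  "steiner_coefficients A V \<Longrightarrow> intrinsic_volume m A = V m"
  unfolding intrinsic_volume_def
  by (metis steiner_coefficients_unique the_equality)

text \<open>The matrix \<open>E[Z Z\<^sup>t]\<close>.\<close>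

definition second_moment_matrix :: "'a measure \<Rightarrow> ('a \<Rightarrow> real^'n) \<Rightarrow> real^'n^'n" where
  "second_moment_matrix M Z = (\<chi> i j. \<integral>\<omega>. Z \<omega> $ i * Z \<omega> $ j \<partial>M)"

text \<open>
  \<open>Z\<close> has law \<open>N(0, \<Sigma>)\<close>: each linear functional \<open>u \<bullet> Z\<close> has the (possibly degenerate) normal law
  \<open>N(0, u\<^sup>t \<Sigma> u)\<close>, written as the law of a multiple of a standard normal variable because
  \<open>normal_density\<close> does not cover the variance zero.
\<close>

definition centered_gaussian :: "'a measure \<Rightarrow> real^'n^'n \<Rightarrow> ('a \<Rightarrow> real^'n) \<Rightarrow> bool" where
  "centered_gaussian M \<Sigma> Z \<longleftrightarrow>
     Z \<in> borel_measurable M \<and>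
     (\<forall>u. distr M borel (\<lambda>\<omega>. u \<bullet> Z \<omega>) =
          distr std_normal_distribution borel (\<lambda>x. sqrt (u \<bullet> (\<Sigma> *v u)) * x))"

text \<open>
  Continuous centered Brownian motion \<open>(X t)\<close>, \<open>t \<ge> 0\<close>, started at the origin, such that \<open>X 1\<close> has
  covariance matrix \<open>\<Sigma>\<close>. The values of \<open>X\<close> at negative times are irrelevant.
\<close>

definition brownian_motion :: "'a measure \<Rightarrow> real^'n^'n \<Rightarrow> (real \<Rightarrow> 'a \<Rightarrow> real^'n) \<Rightarrow> bool" where
  "brownian_motion M \<Sigma> X \<longleftrightarrow>
     prob_space M \<and>
     (\<forall>t\<ge>0. X t \<in> borel_measurable M) \<and>
     (AE \<omega> in M. X 0 \<omega> = 0) \<and>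
     (\<forall>\<omega>\<in>space M. continuous_on {0..} (\<lambda>t. X t \<omega>)) \<and>
     (\<forall>s t. 0 \<le> s \<and> s < t \<longrightarrow>
        centered_gaussian M ((t - s) *\<^sub>R \<Sigma>) (\<lambda>\<omega>. X t \<omega> - X s \<omega>)) \<and>
     (\<forall>(k::nat) \<tau>. 0 \<le> \<tau> 0 \<and> mono \<tau> \<longrightarrow>
        prob_space.indep_vars M (\<lambda>_. borel) (\<lambda>i \<omega>. X (\<tau> (Suc i)) \<omega> - X (\<tau> i) \<omega>) {..<k})"

definition random_walk :: "(nat \<Rightarrow> 'a \<Rightarrow> real^'n) \<Rightarrow> nat \<Rightarrow> 'a \<Rightarrow> real^'n" where
  "random_walk Y n \<omega> = (\<Sum>i=1..n. Y i \<omega>)"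

definition walk_hull :: "(nat \<Rightarrow> 'a \<Rightarrow> real^'n) \<Rightarrow> nat \<Rightarrow> 'a \<Rightarrow> (real^'n) set" where
  "walk_hull Y n \<omega> = convex hull ((\<lambda>k. random_walk Y k \<omega>) ` {0..n})"

definition path_hull :: "(real \<Rightarrow> 'a \<Rightarrow> real^'n) \<Rightarrow> 'a \<Rightarrow> (real^'n) set" where
  "path_hull X \<omega> = convex hull (closure ((\<lambda>t. X t \<omega>) ` {0..1}))"

text \<open>
  The Bochner integral of a non-integrable function is 0 by convention, so \<open>prob_space.variance\<close>
  is the actual variance only for a random variable satisfying this predicate, which expresses
  \<open>Var f < \<infinity>\<close>.
\<close>

definition finite_variance :: "'a measure \<Rightarrow> ('a \<Rightarrow> real) \<Rightarrow> bool" where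
  "finite_variance M f \<longleftrightarrow>
     integrable M f \<and> integrable M (\<lambda>\<omega>. (f \<omega> - integral\<^sup>L M f)\<^sup>2)"

end

theory Submission
  imports Defs "HOL-Computational_Algebra.Polynomial" "HOL-Real_Asymp.Real_Asymp"
begin

text \<open>
  A compact convex set \<open>K\<close> satisfies the Steiner formula because \<open>Vol (K + t [0, v])\<close> is affine in
  \<open>t \<ge> 0\<close>, so that \<open>Vol (K + \<rho> Z)\<close> is a polynomial in \<open>\<rho>\<close> for every zonotope \<open>Z\<close>, and the ball is a
  limit of zonotopes. Hence \<open>V\<^sub>m\<close> is a linear combination of parallel volumes; it is homogeneous of
  degree \<open>m\<close>, bounded by a multiple of \<open>R\<^sup>m\<close> on sets inside the ball of radius \<open>R\<close>, and uniformly
  continuous in the Hausdorff distance on bounded families.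

  With \<open>q = m p > 2\<close>, a Rosenthal-type recursion followed by dyadic chaining gives
  \<open>E max\<^bsub>k \<le> n\<^esub> \<bar>S(k)\<bar>\<^sup>q \<le> C n\<^bsup>q/2\<^esup>\<close>. Together with the central limit theorem for the increments over
  finitely many blocks this yields convergence of \<open>E \<Phi>({S(k) / \<surd>n})\<close> to \<open>E \<Phi>(X[0,1])\<close> for bounded,
  Hausdorff uniformly continuous \<open>\<Phi>\<close>. The moment bound makes the squares of \<open>V\<^sub>m\<close> uniformly
  integrable because \<open>2 m < q\<close>, so first and second moments converge.
\<close>

subsection \<open>Volumes of Minkowski sums with segments and zonotopes\<close>

text \<open>Intrinsic volumes are available only through the Steiner formula, so all their
  properties are read off parallel volumes. Interpolation at the radii 1, ..., d + 1 gives
  continuity, but by itself only growth of order R^d; homogeneity improves this to R^m, and it is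
  this exponent that has to match the moment hypothesis.

  The limit theorem is proved for functionals of sets, not for processes in a space of continuous
  functions. Over \<open>K\<close> blocks, both expectations are integrals of one function of
  independent increments. Convergence in law must therefore hold uniformly over all test functions
  with a common bound and modulus of continuity, and Gaussian smoothing provides exactly this
  uniformity. Moments of the Brownian maximum are not computed: they are inherited from the walk
  through bounded truncations.\<close>

lemma additive_nonneg_imp_linear:
  fixes f :: "real \<Rightarrow> real"
  assumes add: "\<And>s t. s \<ge> 0 \<Longrightarrow> t \<ge> 0 \<Longrightarrow> f (s + t) = f s + f t"
    and nonneg: "\<And>t. t \<ge> 0 \<Longrightarrow> f t \<ge> 0" and t: "t \<ge> 0"
  shows "f t = t * f 1"
proof -
  have f0: "f 0 = 0"
    using add[of 0 0] by simp
  have mult: "f (real n * s) = real n * f s" if "s \<ge> 0" for n s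
  proof (induction n)
    case (Suc n)
    have "f (real n * s + s) = f (real n * s) + f s"
      using that by (intro add) auto
    with Suc show ?case by (simp add: algebra_simps)
  qed (simp add: f0)
  have mono: "f s \<le> f t" if "0 \<le> s" "s \<le> t" for s t
    using add[of s "t - s"] nonneg[of "t - s"] that by simp
  \<comment> \<open>Enclosing \<open>n * t\<close> between consecutive integers leaves an error of
    at most \<open>f 1\<close> for every \<open>n\<close>, which forces
    \<open>\<bar>f t - t * f 1\<bar>\<close> to vanish.\<close>
  have bound: "real n * \<bar>f t - t * f 1\<bar> \<le> f 1" for n
  proof -
    define k where "k = nat \<lfloor>real n * t\<rfloor>"
    have k: "real k \<le> real n * t" "real n * t \<le> real (Suc k)"
      using mult_nonneg_nonneg[of "real n" t] t unfolding k_def by linarith+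
    have "real k * f 1 \<le> real n * f t"
      using mono[of "real k" "real n * t"] mult[of 1 k] mult[of t n] k t by simp
    moreover have "real n * f t \<le> real (Suc k) * f 1"
      using mono[of "real n * t" "real (Suc k)"] mult[of 1 "Suc k"] mult[of t n] k t by (simp add: mult_nonneg_nonneg)
    moreover have "real k * f 1 \<le> real n * t * f 1" "real n * t * f 1 \<le> real (Suc k) * f 1"
      using k nonneg[of 1] by (intro mult_right_mono; simp)+
    ultimately have "\<bar>real n * f t - real n * t * f 1\<bar> \<le> f 1"
      by (simp add: algebra_simps abs_le_iff)
    also have "real n * f t - real n * t * f 1 = real n * (f t - t * f 1)"
      by (simp add: algebra_simps)
    finally show ?thesis
      by (simp add: abs_mult)
  qed
  show ?thesis
  proof (rule ccontr)
    assume "f t \<noteq> t * f 1"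
    then have "\<bar>f t - t * f 1\<bar> > 0" by simp
    then obtain n where "f 1 < real n * \<bar>f t - t * f 1\<bar>"
      using reals_Archimedean3 by blast
    with bound[of n] show False by simp
  qed
qed

lemma compact_set_plus:
  fixes A B :: "'a::real_normed_vector set"
  assumes "compact A" "compact B"
  shows "compact (A + B)"
proof -
  have "A + B = {x + y | x y. x \<in> A \<and> y \<in> B}"
    by (auto simp: set_plus_def)
  then show ?thesis using compact_sums[OF assms] by simp
qed

lemma measure_set_plus_singleton:
  fixes A :: "'a::euclidean_space set"
  shows "measure lebesgue (A + {a}) = measure lebesgue A"
proof -
  have "A + {a} = (+) a ` A"
    by (auto simp: set_plus_def algebra_simps)
  then show ?thesis by (simp add: measure_translation)
qed

text \<open>A one-sided segment: its length parameter adds up under Minkowski sums, which is what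
  additivity in \<open>t\<close> rests on. The symmetric segments of a zonotope are translates of
  such segments.\<close>

definition sweep :: "'a::real_vector \<Rightarrow> real \<Rightarrow> 'a set" where
  "sweep v t = (\<lambda>s. s *\<^sub>R v) ` {0..t}"

lemma compact_sweep: "compact (sweep v t)" for v :: "'a::real_normed_vector"
  unfolding sweep_def by (intro compact_continuous_image continuous_intros) auto

lemma convex_sweep: "convex (sweep v t)"
  unfolding sweep_def
  by (intro convex_linear_image linear_scaleR_left) auto

text \<open>
  On each line parallel to \<open>v\<close> the set \<open>K\<close> is an interval, so that enlarging \<open>K + sweep v s\<close> to
  \<open>K + sweep v (s + t)\<close> adds a translate of what enlarging \<open>K\<close> to \<open>K + sweep v t\<close> adds.
\<close>

lemma sweep_diff_eq:
  fixes K :: "'a::real_vector set"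
  assumes K: "convex K" and "s \<ge> 0" "t \<ge> 0"
  shows "(K + sweep v (s + t)) - (K + sweep v s) = (+) (s *\<^sub>R v) ` ((K + sweep v t) - K)"
proof (intro set_eqI iffI)
  fix x assume "x \<in> (K + sweep v (s + t)) - (K + sweep v s)"
  then obtain k r where x: "x = k + r *\<^sub>R v" "k \<in> K" "0 \<le> r" "r \<le> s + t" and n: "x \<notin> K + sweep v s"
    by (auto simp: set_plus_def sweep_def)
  have "r > s"
    using n x by (force simp: set_plus_def sweep_def not_less)
  then have "x - s *\<^sub>R v \<in> K + sweep v t"
    unfolding x scaleR_add_left[symmetric] add_diff_eq[symmetric] scaleR_diff_left[symmetric]
    using x by (intro set_plus_intro) (auto simp: sweep_def)
  moreover have "x - s *\<^sub>R v \<notin> K"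
  proof
    assume "x - s *\<^sub>R v \<in> K"
    then have "(x - s *\<^sub>R v) + s *\<^sub>R v \<in> K + sweep v s"
      using \<open>s \<ge> 0\<close> by (intro set_plus_intro) (auto simp: sweep_def)
    with n show False by simp
  qed
  ultimately show "x \<in> (+) (s *\<^sub>R v) ` ((K + sweep v t) - K)"
    by (intro image_eqI[of _ _ "x - s *\<^sub>R v"]) auto
next
  fix x assume "x \<in> (+) (s *\<^sub>R v) ` ((K + sweep v t) - K)"
  then obtain k r where x: "x = s *\<^sub>R v + (k + r *\<^sub>R v)" "k \<in> K" "0 \<le> r" "r \<le> t" and n: "k + r *\<^sub>R v \<notin> K"
    by (auto simp: set_plus_def sweep_def)
  have "x = k + (s + r) *\<^sub>R v"
    using x by (simp add: algebra_simps)
  then have "x \<in> K + sweep v (s + t)"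
    unfolding \<open>x = k + (s + r) *\<^sub>R v\<close>
    using x(2-4) \<open>s \<ge> 0\<close> by (intro set_plus_intro) (auto simp: sweep_def)
  moreover have "x \<notin> K + sweep v s"
  proof
    assume "x \<in> K + sweep v s"
    then obtain k' r' where x': "x = k' + r' *\<^sub>R v" "k' \<in> K" "0 \<le> r'" "r' \<le> s"
      by (auto simp: set_plus_def sweep_def)
    \<comment> \<open>The two representations of \<open>x\<close> give
      \<open>k' = k + l *\<^sub>R v\<close> with \<open>r \<le> l\<close>. Hence
      \<open>k + r *\<^sub>R v\<close> lies between two points of \<open>K\<close>, against its
      choice outside \<open>K\<close>.\<close>
    define l where "l = r + (s - r')"
    have k': "k' = k + l *\<^sub>R v"
      using x x' unfolding l_def by (simp add: algebra_simps)
    have "l \<ge> r" using x' by (simp add: l_def)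
    have "l > 0"
      using n x \<open>l \<ge> r\<close> by (cases "r = 0") auto
    have "k + r *\<^sub>R v = (1 - r / l) *\<^sub>R k + (r / l) *\<^sub>R k'"
      using \<open>l > 0\<close> unfolding k' by (simp add: algebra_simps)
    also have "\<dots> \<in> K"
      using \<open>l > 0\<close> \<open>l \<ge> r\<close> x x' by (intro convexD[OF K]) auto
    finally show False using n by simp
  qed
  ultimately show "x \<in> (K + sweep v (s + t)) - (K + sweep v s)" by simp
qed

lemma sweep_mono: "s \<le> t \<Longrightarrow> sweep v s \<subseteq> sweep v t"
  by (auto simp: sweep_def)

lemma set_plus_sweep_0: "K + sweep v 0 = K" for K :: "'a::real_vector set"
  by (auto simp: set_plus_def sweep_def)

text \<open>The gain in volume is additive in \<open>t\<close> by \<open>sweep_diff_eq\<close> and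
  translation invariance, and it is nonnegative, so it is linear.\<close>

lemma measure_plus_sweep:
  fixes K :: "'a::euclidean_space set"
  assumes K: "compact K" "convex K" and t: "t \<ge> 0"
  shows "measure lebesgue (K + sweep v t) =
    measure lebesgue K + t * (measure lebesgue (K + sweep v 1) - measure lebesgue K)"
proof -
  define f where "f t = measure lebesgue (K + sweep v t) - measure lebesgue K" for t
  have lm: "K + sweep v t \<in> lmeasurable" for t
    using K by (intro lmeasurable_compact compact_set_plus compact_sweep)
  have lK: "K \<in> lmeasurable"
    using K by (intro lmeasurable_compact)
  have sub: "K + sweep v s \<subseteq> K + sweep v t" if "s \<le> t" for s t
    by (intro set_plus_mono2 sweep_mono that order_refl)
  have sub0: "K \<subseteq> K + sweep v t" if "0 \<le> t" for t
    using sub[OF that] by (simp add: set_plus_sweep_0)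
  have "f (s + t) = f s + f t" if "s \<ge> 0" "t \<ge> 0" for s t
  proof -
    have "measure lebesgue (K + sweep v (s + t)) - measure lebesgue (K + sweep v s) =
        measure lebesgue ((K + sweep v (s + t)) - (K + sweep v s))"
      using that by (intro measurable_measure_Diff[symmetric] lm sub) (auto simp: lm fmeasurableD)
    also have "\<dots> = measure lebesgue ((K + sweep v t) - K)"
      unfolding sweep_diff_eq[OF K(2) that] by (rule measure_translation)
    also have "\<dots> = f t"
      unfolding f_def using that by (intro measurable_measure_Diff lm sub0) (auto simp: lK fmeasurableD)
    finally show ?thesis by (simp add: f_def)
  qed
  moreover have "f t \<ge> 0" if "t \<ge> 0" for t
    unfolding f_def using that by (simp add: measure_mono_fmeasurable sub0 lm lK fmeasurableD)
  ultimately have "f t = t * f 1"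
    using t by (intro additive_nonneg_imp_linear) auto
  then show ?thesis by (simp add: f_def)
qed

text \<open>Symmetric segments are used because the support function then is the plain sum of the
  \<open>\<bar>v \<bullet> x\<bar>\<close>.\<close>

primrec zonotope :: "'a::real_vector list \<Rightarrow> 'a set" where
  "zonotope [] = {0}"
| "zonotope (v # vs) = (\<lambda>s. s *\<^sub>R v) ` {-1..1} + zonotope vs"

lemma compact_zonotope: "compact (zonotope vs)" for vs :: "'a::real_normed_vector list"
  by (induction vs) (auto intro!: compact_set_plus compact_continuous_image continuous_intros)

lemma convex_zonotope: "convex (zonotope vs)"
  by (induction vs) (auto intro!: convex_set_plus convex_linear_image linear_scaleR_left)

lemma scaleR_set_plus: "(*\<^sub>R) c ` (A + B) = (*\<^sub>R) c ` A + (*\<^sub>R) c ` B" for A B :: "'a::real_vector set"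
  by (force simp: set_plus_def scaleR_add_right image_iff)

text \<open>Adding one more segment to \<open>L = K + \<rho> Z\<close> changes the volume by an
  affine function of the length \<open>\<rho>\<close> whose slope again depends on
  \<open>\<rho>\<close>. The slope is a difference of volumes of the same kind, for two different
  convex bodies, so the induction must leave the body general.\<close>

lemma measure_plus_zonotope_poly:
  fixes K :: "'a::euclidean_space set"
  assumes "compact K" "convex K"
  shows "\<exists>p. \<forall>\<rho>\<ge>0. measure lebesgue (K + (*\<^sub>R) \<rho> ` zonotope vs) = poly p \<rho>"
  using assms
proof (induction vs arbitrary: K)
  case Nil
  then show ?case
    by (intro exI[of _ "[:measure lebesgue K:]"]) (auto simp: measure_set_plus_singleton)
next
  case (Cons v vs)
  \<comment> \<open>The slope is the volume of \<open>L\<close> enlarged by a full segment minus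
    that of \<open>L\<close>; the enlarged set is \<open>K' + \<rho> Z\<close>, to which the
    induction hypothesis applies.\<close>
  define K' where "K' = K + sweep (2 *\<^sub>R v) 1"
  have K': "compact K'" "convex K'"
    unfolding K'_def using Cons.prems
    by (intro compact_set_plus compact_sweep convex_set_plus convex_sweep; simp)+
  obtain p where p: "\<And>\<rho>. \<rho> \<ge> 0 \<Longrightarrow> measure lebesgue (K + (*\<^sub>R) \<rho> ` zonotope vs) = poly p \<rho>"
    using Cons.IH[OF Cons.prems] by blast
  obtain q where q: "\<And>\<rho>. \<rho> \<ge> 0 \<Longrightarrow> measure lebesgue (K' + (*\<^sub>R) \<rho> ` zonotope vs) = poly q \<rho>"
    using Cons.IH[OF K'] by blast
  have "measure lebesgue (K + (*\<^sub>R) \<rho> ` zonotope (v # vs)) = poly (p + [:0, 1:] * (q - p)) \<rho>"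
    if \<rho>: "\<rho> \<ge> 0" for \<rho>
  proof -
    define L where "L = K + (*\<^sub>R) \<rho> ` zonotope vs"
    have L: "compact L" "convex L"
      unfolding L_def using Cons.prems
      by (intro compact_set_plus convex_set_plus compact_scaling convex_scaling compact_zonotope convex_zonotope; simp)+
    \<comment> \<open>The scaled symmetric segment is a translate of a one-sided one in direction
      \<open>2 *\<^sub>R v\<close>, so \<open>measure_plus_sweep\<close> covers it.\<close>
    have seg: "(*\<^sub>R) \<rho> ` (\<lambda>s. s *\<^sub>R v) ` {-1..1} = sweep (2 *\<^sub>R v) \<rho> + {- \<rho> *\<^sub>R v}"
    proof (intro set_eqI iffI)
      fix x assume "x \<in> (*\<^sub>R) \<rho> ` (\<lambda>s. s *\<^sub>R v) ` {-1..1}"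
      then obtain s where s: "-1 \<le> s" "s \<le> 1" "x = (\<rho> * s) *\<^sub>R v" by auto
      have eq: "x = (\<rho> * (s + 1) / 2) *\<^sub>R 2 *\<^sub>R v + - \<rho> *\<^sub>R v"
        unfolding s scaleR_scaleR scaleR_add_left[symmetric] by (simp add: field_simps)
      have "\<rho> * (s + 1) / 2 \<in> {0..\<rho>}"
        using s \<rho> mult_left_mono[of "s + 1" 2 \<rho>] by auto
      then show "x \<in> sweep (2 *\<^sub>R v) \<rho> + {- \<rho> *\<^sub>R v}"
        unfolding sweep_def eq by (intro set_plus_intro imageI) auto
    next
      fix x assume "x \<in> sweep (2 *\<^sub>R v) \<rho> + {- \<rho> *\<^sub>R v}"
      then obtain r where r: "0 \<le> r" "r \<le> \<rho>" "x = r *\<^sub>R 2 *\<^sub>R v + - \<rho> *\<^sub>R v"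
        by (auto simp: sweep_def set_plus_def)
      show "x \<in> (*\<^sub>R) \<rho> ` (\<lambda>s. s *\<^sub>R v) ` {-1..1}"
      proof (cases "\<rho> = 0")
        case True
        with r show ?thesis by (auto simp: image_iff intro!: bexI[of _ 0])
      next
        case False
        then have "x = \<rho> *\<^sub>R ((2 * r / \<rho> - 1) *\<^sub>R v)"
          using r by (simp add: algebra_simps)
        moreover have "2 * r / \<rho> - 1 \<in> {-1..1}"
          using r False \<rho> by (auto simp: field_simps)
        ultimately show ?thesis by blast
      qed
    qed
    have "K + (*\<^sub>R) \<rho> ` zonotope (v # vs) = (L + sweep (2 *\<^sub>R v) \<rho>) + {- \<rho> *\<^sub>R v}"
      unfolding zonotope.simps scaleR_set_plus seg L_def by (simp add: ac_simps)
    then have "measure lebesgue (K + (*\<^sub>R) \<rho> ` zonotope (v # vs)) = measure lebesgue (L + sweep (2 *\<^sub>R v) \<rho>)"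
      by (simp add: measure_set_plus_singleton del: zonotope.simps)
    also have "\<dots> = measure lebesgue L + \<rho> * (measure lebesgue (L + sweep (2 *\<^sub>R v) 1) - measure lebesgue L)"
      by (rule measure_plus_sweep[OF L \<rho>])
    also have "L + sweep (2 *\<^sub>R v) 1 = K' + (*\<^sub>R) \<rho> ` zonotope vs"
      unfolding L_def K'_def by (simp add: ac_simps)
    finally show ?thesis
      using p[OF \<rho>] q[OF \<rho>] by (simp add: L_def algebra_simps)
  qed
  then show ?case by blast
qed

text \<open>The quotient of \<open>p\<close> and \<open>x ^ degree p\<close> tends to the leading
  coefficient, which a slower growth would force to be 0. The construction for zonotopes only
  controls the degree by the number of segments; this brings it down to the dimension.\<close>

lemma poly_degree_bound:
  fixes p :: "real poly"
  assumes "\<And>x. x \<ge> 0 \<Longrightarrow> \<bar>poly p x\<bar> \<le> C * (1 + x) ^ d"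
  shows "degree p \<le> d"
proof (rule ccontr)
  assume "\<not> degree p \<le> d"
  then have d: "d < degree p" by simp
  have "((\<lambda>x. poly p x / x ^ degree p) \<longlongrightarrow> lead_coeff p) at_top"
    using poly_divide_tendsto_aux[of p] at_top_le_at_infinity tendsto_mono by blast
  moreover have "((\<lambda>x. poly p x / x ^ degree p) \<longlongrightarrow> 0) at_top"
  proof (rule Lim_null_comparison)
    have "\<bar>C\<bar> \<ge> 0" by simp
    show "eventually (\<lambda>x. norm (poly p x / x ^ degree p) \<le> \<bar>C\<bar> * 2 ^ d * inverse x) at_top"
      using eventually_ge_at_top[of 1]
    proof eventually_elim
      case (elim x)
      have p: "x ^ degree p = x ^ (degree p - 1) * x"
        using d by (cases "degree p") auto
      have "\<bar>poly p x\<bar> \<le> \<bar>C\<bar> * (1 + x) ^ d"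
        using assms[of x] elim by (smt (verit) mult_right_mono zero_le_power)
      also have "\<dots> \<le> \<bar>C\<bar> * (2 * x) ^ d"
        using elim by (intro mult_left_mono power_mono) auto
      also have "\<dots> \<le> \<bar>C\<bar> * 2 ^ d * x ^ (degree p - 1)"
        using elim d power_increasing[of d "degree p - 1" x]
        by (simp add: power_mult_distrib mult.assoc mult_left_mono)
      finally have "\<bar>poly p x\<bar> / x ^ degree p \<le> \<bar>C\<bar> * 2 ^ d * x ^ (degree p - 1) / x ^ degree p"
        using elim by (intro divide_right_mono) auto
      also have "\<dots> = \<bar>C\<bar> * 2 ^ d * inverse x"
        unfolding p using elim by (simp add: field_simps)
      finally show ?case
        using elim by (simp add: abs_mult)
    qed
    show "((\<lambda>x. \<bar>C\<bar> * 2 ^ d * inverse x) \<longlongrightarrow> 0) at_top"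
      by (intro tendsto_mult_right_zero tendsto_inverse_0_at_top filterlim_ident)
  qed
  ultimately have "lead_coeff p = 0"
    using tendsto_unique trivial_limit_at_top_linorder by blast
  then show False using d by (simp add: leading_coeff_0_iff)
qed

text \<open>Together with \<open>zonotope_inner_attained\<close> this identifies the support
  function of the zonotope as the sum of the \<open>\<bar>v \<bullet> x\<bar>\<close>; the maximum
  is attained by taking the sign of \<open>v \<bullet> x\<close> as coefficient of each
  \<open>v\<close>.\<close>

lemma zonotope_inner_le:
  "z \<in> zonotope vs \<Longrightarrow> z \<bullet> x \<le> (\<Sum>v\<leftarrow>vs. \<bar>v \<bullet> x\<bar>)" for x :: "'a::real_inner"
proof (induction vs arbitrary: z)
  case (Cons v vs)
  then obtain s y where z: "z = s *\<^sub>R v + y" "-1 \<le> s" "s \<le> 1" "y \<in> zonotope vs"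
    by (auto simp: set_plus_def)
  have "s * (v \<bullet> x) \<le> \<bar>s\<bar> * \<bar>v \<bullet> x\<bar>"
    by (metis abs_ge_self abs_mult)
  also have "\<dots> \<le> 1 * \<bar>v \<bullet> x\<bar>"
    using z by (intro mult_right_mono) auto
  finally show ?case
    using Cons.IH[OF z(4)] z(1) by (simp add: inner_add_left)
qed simp

lemma zonotope_inner_attained:
  "\<exists>z\<in>zonotope vs. z \<bullet> x = (\<Sum>v\<leftarrow>vs. \<bar>v \<bullet> x\<bar>)" for x :: "'a::real_inner"
proof (induction vs)
  case (Cons v vs)
  then obtain y where y: "y \<in> zonotope vs" "y \<bullet> x = (\<Sum>v\<leftarrow>vs. \<bar>v \<bullet> x\<bar>)" by blast
  have "sgn (v \<bullet> x) *\<^sub>R v + y \<in> zonotope (v # vs)"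
    unfolding zonotope.simps using y by (intro set_plus_intro imageI) (auto simp: sgn_if)
  moreover have "(sgn (v \<bullet> x) *\<^sub>R v + y) \<bullet> x = \<bar>v \<bullet> x\<bar> + (\<Sum>v\<leftarrow>vs. \<bar>v \<bullet> x\<bar>)"
    using y by (simp add: inner_add_left abs_sgn mult.commute)
  ultimately show ?case by (intro bexI) auto
qed simp

text \<open>Inclusions of compact convex sets are inequalities of support functions. The outer one
  follows by testing a point against itself, the inner one by separating a missing point from the
  zonotope.\<close>

lemma zonotope_between_balls:
  fixes vs :: "'a::euclidean_space list"
  assumes lower: "\<And>x. (1 - \<epsilon>) * norm x \<le> (\<Sum>v\<leftarrow>vs. \<bar>v \<bullet> x\<bar>)"
    and upper: "\<And>x. (\<Sum>v\<leftarrow>vs. \<bar>v \<bullet> x\<bar>) \<le> (1 + \<epsilon>) * norm x"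
  shows "cball 0 (1 - \<epsilon>) \<subseteq> zonotope vs" "zonotope vs \<subseteq> cball 0 (1 + \<epsilon>)"
proof -
  show "zonotope vs \<subseteq> cball 0 (1 + \<epsilon>)"
  proof
    fix z assume "z \<in> zonotope vs"
    then have "z \<bullet> z \<le> (1 + \<epsilon>) * norm z"
      using zonotope_inner_le[of z vs z] upper[of z] by linarith
    then have "norm z * norm z \<le> (1 + \<epsilon>) * norm z"
      by (simp add: power2_norm_eq_inner flip: power2_eq_square)
    \<comment> \<open>Serves the point \<open>z = 0\<close>, where the previous inequality cannot be
      divided by the norm.\<close>
    moreover have "0 \<le> 1 + \<epsilon>"
    proof -
      obtain b :: 'a where "norm b = 1" using norm_some_Basis by blast
      moreover have "0 \<le> (\<Sum>v\<leftarrow>vs. \<bar>v \<bullet> b\<bar>)" by (rule sum_list_nonneg) auto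
      ultimately show ?thesis using upper[of b] by simp
    qed
    ultimately show "z \<in> cball 0 (1 + \<epsilon>)"
      by (cases "z = 0") auto
  qed
  show "cball 0 (1 - \<epsilon>) \<subseteq> zonotope vs"
  proof (rule ccontr)
    assume "\<not> ?thesis"
    then obtain y where "y \<in> cball 0 (1 - \<epsilon>)" "y \<notin> zonotope vs" by blast
    then have y: "norm y \<le> 1 - \<epsilon>" "y \<notin> zonotope vs" by auto
    then obtain a b where ab: "a \<bullet> y < b" "\<And>x. x \<in> zonotope vs \<Longrightarrow> b < a \<bullet> x"
      using separating_hyperplane_closed_point[OF convex_zonotope compact_imp_closed[OF compact_zonotope] y(2)]
      by blast
    obtain z where z: "z \<in> zonotope vs" "z \<bullet> (- a) = (\<Sum>v\<leftarrow>vs. \<bar>v \<bullet> (- a)\<bar>)"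
      using zonotope_inner_attained by blast
    have "(1 - \<epsilon>) * norm a \<le> z \<bullet> (- a)"
      using lower[of "- a"] z by simp
    also have "\<dots> < (- a) \<bullet> y"
      using ab(1) ab(2)[OF z(1)] by (simp add: inner_commute)
    also have "\<dots> \<le> norm a * norm y"
      using norm_cauchy_schwarz[of "- a" y] by simp
    also have "\<dots> \<le> (1 - \<epsilon>) * norm a"
      using mult_left_mono[OF y(1), of "norm a"] by (simp add: mult.commute)
    finally show False by simp
  qed
qed


subsection \<open>Approximation of the ball by zonotopes\<close>

text \<open>The standard Gaussian law serves twice: its rotation invariance makes the expectation of
  \<open>\<bar>G \<bullet> x\<bar>\<close> a multiple of the norm, and later it represents the
  smoothing kernel as a Fourier integral.\<close>

definition gaussian_coords :: "('a::euclidean_space \<Rightarrow> real) measure" where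
  "gaussian_coords = (\<Pi>\<^sub>M b\<in>Basis. std_normal_distribution)"

definition gaussian_vector :: "('a::euclidean_space \<Rightarrow> real) \<Rightarrow> 'a" where
  "gaussian_vector g = (\<Sum>b\<in>Basis. g b *\<^sub>R b)"

lemma prob_space_std_normal: "prob_space std_normal_distribution"
  by (rule prob_space_normal_density) simp

lemma prob_space_gaussian_coords: "prob_space gaussian_coords"
  unfolding gaussian_coords_def by (intro prob_space_PiM prob_space_std_normal)

lemma measurable_gaussian_coords [measurable]:
  "b \<in> Basis \<Longrightarrow> (\<lambda>g. g b) \<in> borel_measurable gaussian_coords"
  unfolding gaussian_coords_def
  by (rule measurable_compose[OF measurable_component_singleton]) auto

lemma measurable_gaussian_vector [measurable]: "gaussian_vector \<in> borel_measurable gaussian_coords"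
  unfolding gaussian_vector_def by measurable

lemma gaussian_vector_inner: "gaussian_vector g \<bullet> z = (\<Sum>b\<in>Basis. g b * (z \<bullet> b))"
  by (simp add: gaussian_vector_def inner_sum_left) (simp add: inner_commute)

lemma gaussian_vector_cf:
  fixes z :: "'a::euclidean_space"
  shows "(CLINT g|gaussian_coords. iexp (gaussian_vector g \<bullet> z)) = exp (- (norm z)\<^sup>2 / 2)"
proof -
  interpret product_sigma_finite "\<lambda>_::'a. std_normal_distribution"
    by (intro product_sigma_finite.intro prob_space_imp_sigma_finite prob_space_std_normal)
  have "(CLINT g|gaussian_coords. iexp (gaussian_vector g \<bullet> z)) =
      (CLINT g|gaussian_coords. (\<Prod>b\<in>Basis. iexp ((z \<bullet> b) * g b)))"
    by (simp add: gaussian_vector_inner sum_distrib_left exp_sum mult.commute mult.left_commute)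
  also have "\<dots> = (\<Prod>b\<in>Basis. (CLINT t|std_normal_distribution. iexp ((z \<bullet> b) * t)))"
    unfolding gaussian_coords_def
  proof (rule product_integral_prod)
    interpret prob_space std_normal_distribution by (rule prob_space_std_normal)
    show "integrable std_normal_distribution (\<lambda>t. iexp ((z \<bullet> b) * t))" for b
      by (rule integrable_const_bound[of _ 1]) auto
  qed simp
  also have "\<dots> = (\<Prod>b\<in>Basis. char std_normal_distribution (z \<bullet> b))"
    by (simp add: char_def)
  also have "\<dots> = (\<Prod>b\<in>Basis. complex_of_real (exp (- (z \<bullet> b)\<^sup>2 / 2)))"
    by (simp add: char_std_normal_distribution)
  also have "\<dots> = complex_of_real (exp (\<Sum>b\<in>Basis. - (z \<bullet> b)\<^sup>2 / 2))"
    by (simp add: exp_sum)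
  also have "(\<Sum>b\<in>Basis. - (z \<bullet> b)\<^sup>2 / 2) = - (norm z)\<^sup>2 / 2"
    by (simp add: power2_norm_eq_inner euclidean_inner[of z z] sum_negf flip: power2_eq_square sum_divide_distrib)
  finally show ?thesis by (simp add: exp_of_real)
qed

text \<open>The characteristic function of the Gaussian vector depends on the norm of
  \<open>z\<close> only; this is rotation invariance in the form required here.\<close>

lemma distr_gaussian_vector_inner:
  fixes z :: "'a::euclidean_space"
  shows "distr gaussian_coords borel (\<lambda>g. gaussian_vector g \<bullet> z) =
    distr std_normal_distribution borel (\<lambda>x. norm z * x)"
proof (rule Levy_uniqueness)
  interpret G: prob_space gaussian_coords by (rule prob_space_gaussian_coords)
  interpret S: prob_space std_normal_distribution by (rule prob_space_std_normal)
  show "real_distribution (distr gaussian_coords borel (\<lambda>g. gaussian_vector g \<bullet> z))"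
    by (intro G.real_distribution_distr) simp
  show "real_distribution (distr std_normal_distribution borel (\<lambda>x. norm z * x))"
    by (intro S.real_distribution_distr) simp
  show "char (distr gaussian_coords borel (\<lambda>g. gaussian_vector g \<bullet> z)) =
      char (distr std_normal_distribution borel (\<lambda>x. norm z * x))"
  proof
    fix t
    have "char (distr gaussian_coords borel (\<lambda>g. gaussian_vector g \<bullet> z)) t =
        (CLINT g|gaussian_coords. iexp (gaussian_vector g \<bullet> (t *\<^sub>R z)))"
      unfolding char_def by (subst integral_distr) auto
    also have "\<dots> = exp (- (t * norm z)\<^sup>2 / 2)"
      by (simp only: gaussian_vector_cf norm_scaleR) (simp add: power_mult_distrib)
    also have "\<dots> = char std_normal_distribution (t * norm z)"
      by (simp add: char_std_normal_distribution)
    also have "\<dots> = char (distr std_normal_distribution borel (\<lambda>x. norm z * x)) t"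
      unfolding char_def by (subst integral_distr) (auto simp: algebra_simps)
    finally show "char (distr gaussian_coords borel (\<lambda>g. gaussian_vector g \<bullet> z)) t = \<dots>" .
  qed
qed

lemma integrable_std_normal_abs: "integrable std_normal_distribution (\<lambda>x. \<bar>x\<bar>)"
  using integrable_std_normal_moment_abs[of 1]
  by (subst integrable_density) (auto simp: mult.commute)

lemma integral_abs_gaussian_vector_inner:
  fixes z :: "'a::euclidean_space"
  shows "integrable gaussian_coords (\<lambda>g. \<bar>gaussian_vector g \<bullet> z\<bar>)" (is ?int)
    and "(\<integral>g. \<bar>gaussian_vector g \<bullet> z\<bar> \<partial>gaussian_coords) = norm z * (\<integral>x. \<bar>x\<bar> \<partial>std_normal_distribution)" (is ?eq)
proof -
  have "integrable (distr std_normal_distribution borel (\<lambda>x. norm z * x)) (\<lambda>x. \<bar>x\<bar>)"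
    by (subst integrable_distr_eq) (auto simp: abs_mult integrable_std_normal_abs)
  then show ?int
    unfolding distr_gaussian_vector_inner[symmetric] by (subst (asm) integrable_distr_eq) auto
  have "(\<integral>g. \<bar>gaussian_vector g \<bullet> z\<bar> \<partial>gaussian_coords) =
      (\<integral>x. \<bar>x\<bar> \<partial>distr gaussian_coords borel (\<lambda>g. gaussian_vector g \<bullet> z))"
    by (subst integral_distr) auto
  also have "\<dots> = norm z * (\<integral>x. \<bar>x\<bar> \<partial>std_normal_distribution)"
    unfolding distr_gaussian_vector_inner by (subst integral_distr) (auto simp: abs_mult)
  finally show ?eq .
qed

lemma integral_std_normal_abs_pos: "(\<integral>x. \<bar>x\<bar> \<partial>std_normal_distribution) > 0"
proof -
  have "(\<integral>x. \<bar>x\<bar> \<partial>std_normal_distribution) = (\<integral>x. std_normal_density x * \<bar>x\<bar> \<partial>lborel)"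
    by (subst integral_density) auto
  also have "\<dots> = sqrt (2 / pi)"
    using std_normal_moment_abs_odd[of 0] by (simp add: has_bochner_integral_iff)
  finally show ?thesis by simp
qed

text \<open>Converts the mean of \<open>\<bar>s \<bullet> x\<bar>\<close> for a simple
  \<open>s\<close> into a finite weighted sum, that is, the support function of a zonotope with one
  segment per value of \<open>s\<close>.\<close>

lemma (in finite_measure) integral_comp_simple_function:
  fixes g :: "'b::real_normed_vector \<Rightarrow> real"
  assumes s: "simple_function M s"
  shows "(\<integral>\<omega>. g (s \<omega>) \<partial>M) = (\<Sum>y\<in>s ` space M. measure M (s -` {y} \<inter> space M) * g y)"
proof -
  have fin: "finite (s ` space M)" and meas: "\<And>y. y \<in> s ` space M \<Longrightarrow> s -` {y} \<inter> space M \<in> sets M"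
    using s by (auto simp: simple_function_def)
  have "(\<integral>\<omega>. g (s \<omega>) \<partial>M) = (\<integral>\<omega>. (\<Sum>y\<in>s ` space M. indicator (s -` {y} \<inter> space M) \<omega> * g y) \<partial>M)"
  proof (rule Bochner_Integration.integral_cong)
    fix \<omega> assume \<omega>: "\<omega> \<in> space M"
    have "(\<Sum>y\<in>s ` space M. indicator (s -` {y} \<inter> space M) \<omega> * g y) = (\<Sum>y\<in>s ` space M. if y = s \<omega> then g y else 0)"
      using \<omega> by (intro sum.cong) (auto simp: indicator_def)
    also have "\<dots> = g (s \<omega>)" using fin \<omega> by simp
    finally show "g (s \<omega>) = (\<Sum>y\<in>s ` space M. indicator (s -` {y} \<inter> space M) \<omega> * g y)" by simp
  qed simp
  also have "\<dots> = (\<Sum>y\<in>s ` space M. measure M (s -` {y} \<inter> space M) * g y)"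
    using meas by (subst Bochner_Integration.integral_sum) (auto intro!: integrable_real_indicator integrable_mult_left simp: less_top[symmetric])
  finally show ?thesis .
qed

text \<open>
  For a standard Gaussian vector \<open>G\<close> the function \<open>E \<bar>G \<bullet> x\<bar>\<close> is a multiple of \<open>norm x\<close>, that is,
  the support function of a ball; replacing \<open>G\<close> by an approximating simple function gives the
  support function of a zonotope.
\<close>

lemma zonotope_approximates_ball:
  assumes "\<epsilon> > 0"
  obtains vs :: "'a::euclidean_space list" where "cball 0 (1 - \<epsilon>) \<subseteq> zonotope vs" "zonotope vs \<subseteq> cball 0 (1 + \<epsilon>)"
proof -
  let ?\<Gamma> = "gaussian_coords :: ('a \<Rightarrow> real) measure" and ?G = "gaussian_vector :: _ \<Rightarrow> 'a"
  interpret prob_space ?\<Gamma> by (rule prob_space_gaussian_coords)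
  define c where "c = (\<integral>x. \<bar>x\<bar> \<partial>std_normal_distribution)"
  have c: "c > 0" unfolding c_def by (rule integral_std_normal_abs_pos)
  have intG: "integrable ?\<Gamma> (\<lambda>g. norm (?G g))"
  proof (rule Bochner_Integration.integrable_bound)
    show "integrable ?\<Gamma> (\<lambda>g. \<Sum>b\<in>Basis. \<bar>?G g \<bullet> b\<bar>)"
      by (intro Bochner_Integration.integrable_sum integral_abs_gaussian_vector_inner)
    show "AE g in ?\<Gamma>. norm (norm (?G g)) \<le> norm (\<Sum>b\<in>Basis. \<bar>?G g \<bullet> b\<bar>)"
      by (intro AE_I2) (auto simp: norm_le_l1 abs_of_nonneg sum_nonneg)
  qed measurable
  obtain F where F: "\<And>i. simple_function ?\<Gamma> (F i)" "\<And>g. g \<in> space ?\<Gamma> \<Longrightarrow> (\<lambda>i. F i g) \<longlonglongrightarrow> ?G g"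
      "\<And>i g. g \<in> space ?\<Gamma> \<Longrightarrow> dist (F i g) 0 \<le> 2 * dist (?G g) 0"
    using borel_measurable_implies_sequence_metric[OF measurable_gaussian_vector, of 0] by metis
  have Fm [measurable]: "F i \<in> borel_measurable ?\<Gamma>" for i
    using F(1) by (rule borel_measurable_simple_function)
  have "(\<lambda>i. \<integral>g. norm (F i g - ?G g) \<partial>?\<Gamma>) \<longlonglongrightarrow> (\<integral>g. 0 \<partial>?\<Gamma>)"
  proof (rule integral_dominated_convergence)
    show "integrable ?\<Gamma> (\<lambda>g. 3 * norm (?G g))" using intG by simp
    show "AE g in ?\<Gamma>. (\<lambda>i. norm (F i g - ?G g)) \<longlonglongrightarrow> 0"
      using F(2) by (intro AE_I2 tendsto_norm_zero LIM_zero) auto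
    show "AE g in ?\<Gamma>. norm (norm (F i g - ?G g)) \<le> 3 * norm (?G g)" for i
    proof (rule AE_I2)
      fix g assume "g \<in> space ?\<Gamma>"
      then have "norm (F i g) \<le> 2 * norm (?G g)" using F(3)[of g i] by simp
      then show "norm (norm (F i g - ?G g)) \<le> 3 * norm (?G g)"
        using norm_triangle_ineq4[of "F i g" "?G g"] by simp
    qed
  qed auto
  moreover have "\<epsilon> * c > 0" using assms c by simp
  \<comment> \<open>An \<open>L\<^sup>1\<close> error of \<open>\<epsilon> * c\<close> becomes the
    error \<open>\<epsilon>\<close> once the support function is divided by \<open>c\<close>, the
    mean of a standard normal absolute value.\<close>
  ultimately obtain i where i: "(\<integral>g. norm (F i g - ?G g) \<partial>?\<Gamma>) < \<epsilon> * c"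
    by (metis (mono_tags, lifting) Bochner_Integration.integral_zero order_refl order_tendstoD(2) eventually_sequentially)
  define s where "s = F i"
  have s: "simple_function ?\<Gamma> s" and [measurable]: "s \<in> borel_measurable ?\<Gamma>"
    unfolding s_def using F(1) by auto
  have ints: "integrable ?\<Gamma> (\<lambda>g. norm (s g - ?G g))" and ints': "integrable ?\<Gamma> (\<lambda>g. norm (s g))"
  proof -
    show "integrable ?\<Gamma> (\<lambda>g. norm (s g))"
      by (rule Bochner_Integration.integrable_bound[of _ "\<lambda>g. 2 * norm (?G g)"])
        (use intG F(3) in \<open>auto simp: s_def\<close>)
    then show "integrable ?\<Gamma> (\<lambda>g. norm (s g - ?G g))"
      by (rule Bochner_Integration.integrable_bound[OF Bochner_Integration.integrable_add[OF _ intG]])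
        (auto simp: norm_triangle_ineq4)
  qed
  obtain ys where ys: "set ys = s ` space ?\<Gamma>" "distinct ys"
    using s finite_distinct_list by (force simp: simple_function_def)
  \<comment> \<open>Each value is weighted by its probability; dividing by \<open>c\<close>
    normalises the limiting ball to radius 1.\<close>
  define w where "w y = (measure ?\<Gamma> (s -` {y} \<inter> space ?\<Gamma>) / c) *\<^sub>R y" for y
  let ?vs = "map w ys"
  have "\<bar>(\<Sum>v\<leftarrow>?vs. \<bar>v \<bullet> x\<bar>) - norm x\<bar> \<le> \<epsilon> * norm x" for x
  proof -
    have intsx: "integrable ?\<Gamma> (\<lambda>g. \<bar>s g \<bullet> x\<bar>)"
      by (rule Bochner_Integration.integrable_bound[of _ "\<lambda>g. norm (s g) * norm x"])
        (use ints' in \<open>auto simp: Cauchy_Schwarz_ineq2\<close>)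
    have "(\<Sum>v\<leftarrow>?vs. \<bar>v \<bullet> x\<bar>) = (\<Sum>y\<in>s ` space ?\<Gamma>. \<bar>w y \<bullet> x\<bar>)"
      unfolding ys(1)[symmetric] using ys(2) by (simp add: sum_list_distinct_conv_sum_set o_def)
    also have "\<dots> = (\<integral>g. \<bar>s g \<bullet> x\<bar> \<partial>?\<Gamma>) / c"
      using c by (simp add: integral_comp_simple_function[OF s, of "\<lambda>y. \<bar>y \<bullet> x\<bar>"] w_def abs_mult sum_divide_distrib)
    finally have "c * ((\<Sum>v\<leftarrow>?vs. \<bar>v \<bullet> x\<bar>) - norm x) = (\<integral>g. \<bar>s g \<bullet> x\<bar> \<partial>?\<Gamma>) - (\<integral>g. \<bar>?G g \<bullet> x\<bar> \<partial>?\<Gamma>)"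
      using c by (simp add: integral_abs_gaussian_vector_inner(2) field_simps c_def)
    then have "c * \<bar>(\<Sum>v\<leftarrow>?vs. \<bar>v \<bullet> x\<bar>) - norm x\<bar> = \<bar>(\<integral>g. \<bar>s g \<bullet> x\<bar> \<partial>?\<Gamma>) - (\<integral>g. \<bar>?G g \<bullet> x\<bar> \<partial>?\<Gamma>)\<bar>"
      using c by (metis abs_mult abs_of_pos)
    also have "\<dots> = \<bar>\<integral>g. \<bar>s g \<bullet> x\<bar> - \<bar>?G g \<bullet> x\<bar> \<partial>?\<Gamma>\<bar>"
      by (subst Bochner_Integration.integral_diff[OF intsx integral_abs_gaussian_vector_inner(1)]) simp
    also have "\<dots> \<le> (\<integral>g. \<bar>\<bar>s g \<bullet> x\<bar> - \<bar>?G g \<bullet> x\<bar>\<bar> \<partial>?\<Gamma>)"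
      by (rule integral_abs_bound)
    also have "\<dots> \<le> (\<integral>g. norm (s g - ?G g) * norm x \<partial>?\<Gamma>)"
    proof (intro integral_mono)
      show "\<bar>\<bar>s g \<bullet> x\<bar> - \<bar>?G g \<bullet> x\<bar>\<bar> \<le> norm (s g - ?G g) * norm x" for g
        using Cauchy_Schwarz_ineq2[of "s g - ?G g" x] by (simp add: inner_diff_left)
    qed (use intsx ints integral_abs_gaussian_vector_inner(1)[of x] in auto)
    also have "\<dots> \<le> \<epsilon> * c * norm x"
      using i by (simp add: s_def mult_right_mono)
    finally show ?thesis using c by (simp add: algebra_simps)
  qed
  then have "(1 - \<epsilon>) * norm x \<le> (\<Sum>v\<leftarrow>?vs. \<bar>v \<bullet> x\<bar>) \<and> (\<Sum>v\<leftarrow>?vs. \<bar>v \<bullet> x\<bar>) \<le> (1 + \<epsilon>) * norm x" for x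
    by (auto simp: abs_le_iff algebra_simps)
  then show thesis
    using that[of ?vs] zonotope_between_balls[of \<epsilon> ?vs] by metis
qed

subsection \<open>The Steiner formula and intrinsic volumes\<close>

text \<open>Reading off coefficients is a fixed linear operation on finitely many values. This lets
  coefficients of converging polynomials converge and turns intrinsic volumes into combinations of
  parallel volumes. The nodes are all at least 1, as required by
  \<open>measure_parallel_hausdorff_close\<close>.\<close>

lemma exists_lagrange_coefficients:
  "\<exists>\<alpha> :: nat \<Rightarrow> nat \<Rightarrow> real. \<forall>p. degree p \<le> d \<longrightarrow>
    (\<forall>i. coeff p i = (\<Sum>j\<le>d. \<alpha> i j * poly p (real (Suc j))))"
proof -
  define x where "x j = real (Suc j)" for j
  define L where "L j = smult (1 / (\<Prod>k\<in>{..d}-{j}. x j - x k)) (\<Prod>k\<in>{..d}-{j}. [:- x k, 1:])" for j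
  have L_eval: "poly (L j) (x i) = (if i = j then 1 else 0)" if "i \<le> d" "j \<le> d" for i j
  proof (cases "i = j")
    case True
    have "(\<Prod>k\<in>{..d}-{j}. x j - x k) \<noteq> 0" by (auto simp: x_def)
    with True show ?thesis by (simp add: L_def poly_prod)
  next
    case False
    then have "(\<Prod>k\<in>{..d}-{j}. x i - x k) = 0" using that by (auto simp: prod_zero_iff)
    with False show ?thesis by (simp add: L_def poly_prod)
  qed
  have L_degree: "degree (L j) \<le> d" if "j \<le> d" for j
  proof -
    have "degree (\<Prod>k\<in>{..d}-{j}. [:- x k, 1:]) \<le> (\<Sum>k\<in>{..d}-{j}. degree [:- x k, 1:])"
      by (rule order_trans[OF degree_prod_sum_le]) auto
    also have "\<dots> = d" using that by simp
    finally show ?thesis unfolding L_def using degree_smult_le order_trans by blast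
  qed
  have "coeff p i = (\<Sum>j\<le>d. coeff (L j) i * poly p (x j))" if p: "degree p \<le> d" for p i
  proof -
    define q where "q = p - (\<Sum>j\<le>d. smult (poly p (x j)) (L j))"
    have "degree q \<le> d"
      unfolding q_def using p L_degree
      by (intro degree_diff_le degree_sum_le) (auto intro: order_trans[OF degree_smult_le])
    have "poly q (x i) = 0" if "i \<le> d" for i
    proof -
      have "(\<Sum>j\<le>d. poly p (x j) * poly (L j) (x i)) = (\<Sum>j\<le>d. if j = i then poly p (x j) else 0)"
        using that by (intro sum.cong) (auto simp: L_eval)
      then show ?thesis using that by (simp add: q_def poly_sum)
    qed
    then have "x ` {..d} \<subseteq> {y. poly q y = 0}" by auto
    moreover have "card (x ` {..d}) = Suc d"
      by (subst card_image) (auto simp: inj_on_def x_def)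
    ultimately have "q = 0"
      using card_mono[OF poly_roots_finite[of q], of "x ` {..d}"] card_poly_roots_bound[of q] \<open>degree q \<le> d\<close>
      by fastforce
    then have "p = (\<Sum>j\<le>d. smult (poly p (x j)) (L j))" by (simp add: q_def)
    then have "coeff p i = coeff (\<Sum>j\<le>d. smult (poly p (x j)) (L j)) i" by simp
    then show ?thesis by (simp add: coeff_sum mult.commute)
  qed
  then have "\<forall>p. degree p \<le> d \<longrightarrow> (\<forall>i. coeff p i = (\<Sum>j\<le>d. (\<lambda>i j. coeff (L j) i) i j * poly p (real (Suc j))))"
    unfolding x_def by simp
  then show ?thesis by (intro exI)
qed

section \<open>Scaling and dilation of parallel bodies; the Steiner polynomial\<close>

lemma measure_scaleR_image:
  fixes S :: "'a::euclidean_space set"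
  shows "measure lebesgue ((*\<^sub>R) c ` S) = \<bar>c\<bar> ^ DIM('a) * measure lebesgue S"
  using emeasure_lebesgue_affine[of c 0 S]
  by (simp add: measure_def enn2real_mult)

lemma scaleR_cball_0:
  fixes c r :: real
  assumes "c > 0"
  shows "(*\<^sub>R) c ` cball (0::'a::real_normed_vector) r = cball 0 (c * r)"
proof (intro set_eqI iffI)
  fix x :: 'a assume "x \<in> cball 0 (c * r)"
  then have "norm (inverse c *\<^sub>R x) \<le> r" using assms by (simp add: field_simps)
  moreover have "x = c *\<^sub>R (inverse c *\<^sub>R x)" using assms by simp
  ultimately show "x \<in> (*\<^sub>R) c ` cball 0 r" by (metis imageI mem_cball_0)
qed (use assms in auto)

text \<open>Convexity and \<open>0 \<in> K\<close> give \<open>K \<subseteq> s K\<close>, and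
  \<open>s K\<close> plus the ball of radius \<open>s * \<rho>\<close> is the dilated parallel
  body.\<close>

lemma set_plus_cball_dilate:
  fixes K :: "'a::real_normed_vector set"
  assumes K: "convex K" "0 \<in> K" and s: "s \<ge> 1"
  shows "K + cball 0 (s * \<rho>) \<subseteq> (*\<^sub>R) s ` (K + cball 0 \<rho>)"
proof -
  have "K \<subseteq> (*\<^sub>R) s ` K"
  proof
    fix x assume "x \<in> K"
    then have "(1 - 1 / s) *\<^sub>R 0 + (1 / s) *\<^sub>R x \<in> K"
      using K s by (intro convexD) auto
    then show "x \<in> (*\<^sub>R) s ` K"
      using s by (intro image_eqI[of _ _ "(1 / s) *\<^sub>R x"]) auto
  qed
  then have "K + cball 0 (s * \<rho>) \<subseteq> (*\<^sub>R) s ` K + cball 0 (s * \<rho>)"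
    by (intro set_plus_mono2) auto
  then show ?thesis
    using s by (simp add: scaleR_set_plus scaleR_cball_0)
qed

lemma lmeasurable_set_plus: "compact A \<Longrightarrow> compact B \<Longrightarrow> A + B \<in> lmeasurable"
  for A B :: "'a::euclidean_space set"
  by (intro lmeasurable_compact compact_set_plus)

lemma measure_set_plus_mono:
  fixes A B C D :: "'a::euclidean_space set"
  assumes "compact A" "compact B" "compact C" "compact D" "A + B \<subseteq> C + D"
  shows "measure lebesgue (A + B) \<le> measure lebesgue (C + D)"
  using assms by (intro measure_mono_fmeasurable) (auto intro!: lmeasurable_set_plus fmeasurableD)

text \<open>Makes relative errors in the radius cost only a factor in the volume. A translation
  moves some point of \<open>K\<close> to the origin, so that the previous inclusion
  applies.\<close>

lemma measure_set_plus_cball_dilate: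
  fixes K :: "'a::euclidean_space set"
  assumes K: "compact K" "convex K" "K \<noteq> {}" and s: "s \<ge> 1"
  shows "measure lebesgue (K + cball 0 (s * \<rho>)) \<le> s ^ DIM('a) * measure lebesgue (K + cball 0 \<rho>)"
proof -
  obtain a where a: "a \<in> K" using K by blast
  define L where "L = K + {- a}"
  have L: "compact L" "convex L" "0 \<in> L"
    unfolding L_def using K set_plus_intro[OF a, of "- a" "{- a}"]
    by (auto intro!: compact_set_plus convex_set_plus)
  have shift: "measure lebesgue (L + cball 0 r) = measure lebesgue (K + cball 0 r)" for r
  proof -
    have "L + cball 0 r = (K + cball 0 r) + {- a}" by (simp add: L_def ac_simps)
    then show ?thesis by (simp add: measure_set_plus_singleton)
  qed
  have "measure lebesgue (L + cball 0 (s * \<rho>)) \<le> measure lebesgue ((*\<^sub>R) s ` (L + cball 0 \<rho>))"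
    using L s by (intro measure_mono_fmeasurable set_plus_cball_dilate fmeasurableD lmeasurable_set_plus)
      (auto intro!: lmeasurable_compact compact_scaling compact_set_plus)
  also have "\<dots> = s ^ DIM('a) * measure lebesgue (L + cball 0 \<rho>)"
    using s by (simp add: measure_scaleR_image)
  finally show ?thesis by (simp add: shift)
qed

text \<open>Zonotopes between balls of radii \<open>1 - \<epsilon>\<close> and
  \<open>1 + \<epsilon>\<close> give polynomials within factors \<open>(1 - \<epsilon>) ^ d\<close>
  and \<open>(1 + \<epsilon>) ^ d\<close> of the parallel volume. Their degrees are bounded by the
  dimension, so pointwise convergence carries over to the coefficients and the limit is a polynomial
  as well.\<close>

lemma steiner_polynomial:
  fixes K :: "'a::euclidean_space set"
  assumes K: "compact K" "convex K" "K \<noteq> {}"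
  obtains p where "degree p \<le> DIM('a)" "\<And>\<rho>. \<rho> \<ge> 0 \<Longrightarrow> measure lebesgue (K + cball 0 \<rho>) = poly p \<rho>"
proof -
  let ?d = "DIM('a)"
  define g where "g \<rho> = measure lebesgue (K + cball 0 \<rho>)" for \<rho>
  \<comment> \<open>The sequence starts at 1/2, so that \<open>1 - \<epsilon> k\<close> stays
    positive and can be inverted.\<close>
  define \<epsilon> where "\<epsilon> k = inverse (real (Suc (Suc k)))" for k
  have \<epsilon>: "0 < \<epsilon> k" "\<epsilon> k < 1" for k by (auto simp: \<epsilon>_def field_simps)
  have \<epsilon>_lim: "\<epsilon> \<longlonglongrightarrow> 0"
    unfolding \<epsilon>_def by (intro LIMSEQ_Suc LIMSEQ_inverse_real_of_nat)
  have "\<exists>p. degree p \<le> ?d \<and> (\<forall>\<rho>\<ge>0. poly p \<rho> \<le> (1 + \<epsilon> k) ^ ?d * g \<rho> \<and> (1 - \<epsilon> k) ^ ?d * g \<rho> \<le> poly p \<rho>)" for k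
  proof -
    obtain vs :: "'a list" where Z: "cball 0 (1 - \<epsilon> k) \<subseteq> zonotope vs" "zonotope vs \<subseteq> cball 0 (1 + \<epsilon> k)"
      using zonotope_approximates_ball[OF \<epsilon>(1)] by blast
    obtain p where p: "\<And>\<rho>. \<rho> \<ge> 0 \<Longrightarrow> measure lebesgue (K + (*\<^sub>R) \<rho> ` zonotope vs) = poly p \<rho>"
      using measure_plus_zonotope_poly[OF K(1,2)] by blast
    have upper: "(*\<^sub>R) \<rho> ` zonotope vs \<subseteq> cball 0 ((1 + \<epsilon> k) * \<rho>)"
      and lower: "cball 0 ((1 - \<epsilon> k) * \<rho>) \<subseteq> (*\<^sub>R) \<rho> ` zonotope vs" if "\<rho> \<ge> 0" for \<rho>
    proof -
      show "(*\<^sub>R) \<rho> ` zonotope vs \<subseteq> cball 0 ((1 + \<epsilon> k) * \<rho>)"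
        using Z(2) that by (auto simp: mult.commute mult_left_mono)
      show "cball 0 ((1 - \<epsilon> k) * \<rho>) \<subseteq> (*\<^sub>R) \<rho> ` zonotope vs"
      proof (cases "\<rho> = 0")
        case True
        have "0 \<in> zonotope vs" using Z(1) \<epsilon>[of k] by auto
        with True show ?thesis by (auto simp: image_iff)
      next
        case False
        with that have "\<rho> > 0" by simp
        then show ?thesis
          using image_mono[OF Z(1), of "(*\<^sub>R) \<rho>"] by (simp only: scaleR_cball_0 mult.commute)
      qed
    qed
    have cz: "compact ((*\<^sub>R) \<rho> ` zonotope vs)" for \<rho>
      by (intro compact_scaling compact_zonotope)
    have b: "poly p \<rho> \<le> (1 + \<epsilon> k) ^ ?d * g \<rho>" "(1 - \<epsilon> k) ^ ?d * g \<rho> \<le> poly p \<rho>" if "\<rho> \<ge> 0" for \<rho>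
    proof -
      have "poly p \<rho> \<le> measure lebesgue (K + cball 0 ((1 + \<epsilon> k) * \<rho>))"
        unfolding p[OF that, symmetric]
        by (intro measure_set_plus_mono set_plus_mono2 upper that K cz) auto
      also have "\<dots> \<le> (1 + \<epsilon> k) ^ ?d * g \<rho>"
        unfolding g_def using \<epsilon>[of k] by (intro measure_set_plus_cball_dilate K) auto
      finally show "poly p \<rho> \<le> (1 + \<epsilon> k) ^ ?d * g \<rho>" .
      \<comment> \<open>The lower bound is the dilation estimate read backwards: the full radius is
        the shrunken radius dilated by \<open>inverse (1 - \<epsilon> k)\<close>.\<close>
      have "g \<rho> = measure lebesgue (K + cball 0 (inverse (1 - \<epsilon> k) * ((1 - \<epsilon> k) * \<rho>)))"
        unfolding g_def mult.assoc[symmetric] using \<epsilon>[of k] by (subst left_inverse) auto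
      also have "\<dots> \<le> inverse (1 - \<epsilon> k) ^ ?d * measure lebesgue (K + cball 0 ((1 - \<epsilon> k) * \<rho>))"
        using \<epsilon>[of k] by (intro measure_set_plus_cball_dilate K) (auto simp: one_le_inverse)
      finally have "(1 - \<epsilon> k) ^ ?d * g \<rho> \<le> measure lebesgue (K + cball 0 ((1 - \<epsilon> k) * \<rho>))"
        using \<epsilon>[of k] by (simp add: field_simps)
      also have "\<dots> \<le> poly p \<rho>"
        unfolding p[OF that, symmetric]
        by (intro measure_set_plus_mono set_plus_mono2 lower that K cz) auto
      finally show "(1 - \<epsilon> k) ^ ?d * g \<rho> \<le> poly p \<rho>" .
    qed
    obtain R where R: "R > 0" "K \<subseteq> cball 0 R"
      using bounded_subset_ballD[OF compact_imp_bounded[OF K(1)], of 0] ball_subset_cball by blast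
    \<comment> \<open>The set lies in a ball whose radius grows linearly in \<open>\<rho>\<close>,
      so its volume grows at most like the d-th power.\<close>
    have "degree p \<le> ?d"
    proof (rule poly_degree_bound)
      fix \<rho> :: real assume \<rho>: "\<rho> \<ge> 0"
      have "K + (*\<^sub>R) \<rho> ` zonotope vs \<subseteq> cball 0 ((R + 2) * (1 + \<rho>))"
      proof
        fix x assume "x \<in> K + (*\<^sub>R) \<rho> ` zonotope vs"
        then obtain y z where x: "x = y + z" "y \<in> K" "z \<in> (*\<^sub>R) \<rho> ` zonotope vs"
          by (auto simp: set_plus_def)
        have "norm y \<le> R" "norm z \<le> (1 + \<epsilon> k) * \<rho>"
          using x R upper[OF \<rho>] by auto
        moreover have "(1 + \<epsilon> k) * \<rho> \<le> 2 * \<rho>" using \<epsilon>[of k] \<rho> by (intro mult_right_mono) auto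
        ultimately have "norm x \<le> R + 2 * \<rho>" using norm_triangle_ineq[of y z] unfolding x(1) by linarith
        also have "\<dots> \<le> (R + 2) * (1 + \<rho>)" using R \<rho> by (simp add: algebra_simps)
        finally show "x \<in> cball 0 ((R + 2) * (1 + \<rho>))" by simp
      qed
      then have "measure lebesgue (K + (*\<^sub>R) \<rho> ` zonotope vs) \<le> measure lebesgue (cball (0::'a) ((R + 2) * (1 + \<rho>)))"
        by (intro measure_mono_fmeasurable fmeasurableD lmeasurable_set_plus K cz) auto
      also have "\<dots> = unit_ball_vol ?d * (R + 2) ^ ?d * (1 + \<rho>) ^ ?d"
        using R \<rho> by (simp add: content_cball power_mult_distrib)
      finally show "\<bar>poly p \<rho>\<bar> \<le> unit_ball_vol ?d * (R + 2) ^ ?d * (1 + \<rho>) ^ ?d"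
        using p[OF \<rho>] measure_nonneg[of lebesgue "K + (*\<^sub>R) \<rho> ` zonotope vs"] by linarith
    qed
    with b show ?thesis by blast
  qed
  then obtain P where P: "\<And>k. degree (P k) \<le> ?d"
      "\<And>k \<rho>. \<rho> \<ge> 0 \<Longrightarrow> poly (P k) \<rho> \<le> (1 + \<epsilon> k) ^ ?d * g \<rho>"
      "\<And>k \<rho>. \<rho> \<ge> 0 \<Longrightarrow> (1 - \<epsilon> k) ^ ?d * g \<rho> \<le> poly (P k) \<rho>"
    by metis
  have lim: "(\<lambda>k. poly (P k) \<rho>) \<longlonglongrightarrow> g \<rho>" if "\<rho> \<ge> 0" for \<rho>
  proof (rule tendsto_sandwich[where f = "\<lambda>k. (1 - \<epsilon> k) ^ ?d * g \<rho>" and h = "\<lambda>k. (1 + \<epsilon> k) ^ ?d * g \<rho>"])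
    have "(\<lambda>k. (1 + \<epsilon> k) ^ ?d * g \<rho>) \<longlonglongrightarrow> (1 + 0) ^ ?d * g \<rho>"
      by (intro tendsto_intros \<epsilon>_lim)
    then show "(\<lambda>k. (1 + \<epsilon> k) ^ ?d * g \<rho>) \<longlonglongrightarrow> g \<rho>" by simp
    have "(\<lambda>k. (1 - \<epsilon> k) ^ ?d * g \<rho>) \<longlonglongrightarrow> (1 - 0) ^ ?d * g \<rho>"
      by (intro tendsto_intros \<epsilon>_lim)
    then show "(\<lambda>k. (1 - \<epsilon> k) ^ ?d * g \<rho>) \<longlonglongrightarrow> g \<rho>" by simp
  qed (use P that in auto)
  obtain \<alpha> :: "nat \<Rightarrow> nat \<Rightarrow> real" where \<alpha>:
      "\<And>p i. degree p \<le> ?d \<Longrightarrow> coeff p i = (\<Sum>j\<le>?d. \<alpha> i j * poly p (real (Suc j)))"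
    using exists_lagrange_coefficients[of ?d] by metis
  \<comment> \<open>The limit coefficients: the same interpolation formula applied to the limit
    function \<open>g\<close>, before it is known to be a polynomial.\<close>
  define c where "c i = (\<Sum>j\<le>?d. \<alpha> i j * g (real (Suc j)))" for i
  have "(\<lambda>k. coeff (P k) i) \<longlonglongrightarrow> c i" for i
    unfolding c_def \<alpha>[OF P(1)] by (intro tendsto_intros lim) auto
  then have "(\<lambda>k. \<Sum>i\<le>?d. coeff (P k) i * \<rho> ^ i) \<longlonglongrightarrow> (\<Sum>i\<le>?d. c i * \<rho> ^ i)" for \<rho>
    by (intro tendsto_intros)
  moreover have "poly (P k) \<rho> = (\<Sum>i\<le>?d. coeff (P k) i * \<rho> ^ i)" for k \<rho>
    unfolding poly_altdef using P(1)[of k]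
    by (intro sum.mono_neutral_left) (auto simp: coeff_eq_0)
  ultimately have "g \<rho> = (\<Sum>i\<le>?d. c i * \<rho> ^ i)" if "\<rho> \<ge> 0" for \<rho>
    using LIMSEQ_unique[OF lim[OF that]] by simp
  moreover have "degree (\<Sum>i\<le>?d. monom (c i) i) \<le> ?d"
    by (intro degree_sum_le) (auto intro: order_trans[OF degree_monom_le])
  ultimately show thesis
    using that[of "\<Sum>i\<le>?d. monom (c i) i"] by (simp add: g_def poly_sum poly_monom)
qed

lemma scaled_unit_ball_sum:
  fixes A :: "'a::real_normed_vector set"
  assumes "\<rho> \<ge> 0"
  shows "{x + \<rho> *\<^sub>R b | x b. x \<in> A \<and> b \<in> cball 0 1} = A + cball 0 \<rho>"
proof -
  have "(*\<^sub>R) \<rho> ` cball (0::'a) 1 = cball 0 \<rho>"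
  proof (cases "\<rho> = 0")
    case True
    have "(*\<^sub>R) 0 ` cball (0::'a) 1 = (\<lambda>_. 0) ` cball (0::'a) 1" by (intro image_cong) simp_all
    then have "(*\<^sub>R) 0 ` cball (0::'a) 1 = {0}" by (simp add: image_constant_conv)
    with True show ?thesis by simp
  next
    case False
    with assms show ?thesis using scaleR_cball_0[of \<rho> 1, where 'a='a] by simp
  qed
  moreover have "{x + \<rho> *\<^sub>R b | x b. x \<in> A \<and> b \<in> cball 0 1} = A + (*\<^sub>R) \<rho> ` cball 0 1"
    unfolding set_plus_def by blast
  ultimately show ?thesis by simp
qed

lemma exists_steiner_coefficients:
  fixes A :: "(real^'n) set"
  assumes "compact A" "convex A" "A \<noteq> {}"
  shows "\<exists>V. steiner_coefficients A V"
proof -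
  let ?d = "CARD('n)"
  obtain p where p: "degree p \<le> ?d" "\<And>\<rho>. \<rho> \<ge> 0 \<Longrightarrow> measure lebesgue (A + cball 0 \<rho>) = poly p \<rho>"
    using steiner_polynomial[OF assms] by auto
  define V where "V m = (if m \<le> ?d then coeff p (?d - m) / unit_ball_vol (real (?d - m)) else 0)" for m
  have pos: "unit_ball_vol (real k) \<noteq> 0" for k
    by (metis less_irrefl of_nat_0_le_iff unit_ball_vol_pos)
  have "measure lebesgue {x + \<rho> *\<^sub>R b | x b. x \<in> A \<and> b \<in> cball 0 1} =
      (\<Sum>m\<le>?d. \<rho> ^ (?d - m) * unit_ball_vol (real (?d - m)) * V m)" if "\<rho> \<ge> 0" for \<rho>
  proof -
    have "(\<Sum>m\<le>?d. \<rho> ^ (?d - m) * unit_ball_vol (real (?d - m)) * V m) = (\<Sum>m\<le>?d. coeff p (?d - m) * \<rho> ^ (?d - m))"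
      by (intro sum.cong) (simp_all add: V_def pos del: of_nat_diff)
    also have "\<dots> = (\<Sum>i\<le>?d. coeff p i * \<rho> ^ i)"
      by (rule sum.reindex_bij_witness[where i = "\<lambda>i. ?d - i" and j = "\<lambda>i. ?d - i"]) auto
    also have "\<dots> = poly p \<rho>"
      unfolding poly_altdef using p(1) by (intro sum.mono_neutral_right) (auto simp: coeff_eq_0)
    finally show ?thesis unfolding scaled_unit_ball_sum[OF that] p(2)[OF that] ..
  qed
  then have "steiner_coefficients A V"
    by (simp add: steiner_coefficients_def V_def)
  show ?thesis by (rule exI[of _ V]) fact
qed

lemma steiner_intrinsic_volume:
  fixes A :: "(real^'n) set"
  assumes A: "compact A" "convex A" "A \<noteq> {}"
  shows "steiner_coefficients A (\<lambda>m. intrinsic_volume m A)"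
proof -
  obtain V where V: "steiner_coefficients A V" using exists_steiner_coefficients[OF A] by blast
  have "V = (\<lambda>m. intrinsic_volume m A)"
    using intrinsic_volume_eq[OF V] by auto
  with V show ?thesis by simp
qed

text \<open>Scaling by \<open>c\<close> turns the parallel body of radius \<open>\<rho> / c\<close>
  into the one of radius \<open>\<rho>\<close>; by uniqueness of the Steiner coefficients it
  suffices to exhibit the scaled ones.\<close>

lemma intrinsic_volume_scaleR:
  fixes A :: "(real^'n) set"
  assumes A: "compact A" "convex A" "A \<noteq> {}" and c: "c > 0"
  shows "intrinsic_volume m ((*\<^sub>R) c ` A) = c ^ m * intrinsic_volume m A"
proof (rule intrinsic_volume_eq)
  let ?d = "CARD('n)"
  note S = steiner_intrinsic_volume[OF A]
  have "measure lebesgue {x + \<rho> *\<^sub>R b | x b. x \<in> (*\<^sub>R) c ` A \<and> b \<in> cball 0 1} =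
      (\<Sum>m\<le>?d. \<rho> ^ (?d - m) * unit_ball_vol (real (?d - m)) * (c ^ m * intrinsic_volume m A))" if \<rho>: "\<rho> \<ge> 0" for \<rho>
  proof -
    have \<rho>': "\<rho> / c \<ge> 0" using \<rho> c by simp
    have "(*\<^sub>R) c ` A + cball 0 \<rho> = (*\<^sub>R) c ` (A + cball 0 (\<rho> / c))"
      using c by (simp add: scaleR_set_plus scaleR_cball_0)
    then have "measure lebesgue {x + \<rho> *\<^sub>R b | x b. x \<in> (*\<^sub>R) c ` A \<and> b \<in> cball 0 1} =
        c ^ ?d * measure lebesgue (A + cball 0 (\<rho> / c))"
      unfolding scaled_unit_ball_sum[OF \<rho>] using c by (simp add: measure_scaleR_image)
    also have "measure lebesgue (A + cball 0 (\<rho> / c)) =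
        (\<Sum>m\<le>?d. (\<rho> / c) ^ (?d - m) * unit_ball_vol (real (?d - m)) * intrinsic_volume m A)"
      using S \<rho>' unfolding steiner_coefficients_def scaled_unit_ball_sum[OF \<rho>', symmetric] by blast
    also have "c ^ ?d * \<dots> = (\<Sum>m\<le>?d. \<rho> ^ (?d - m) * unit_ball_vol (real (?d - m)) * (c ^ m * intrinsic_volume m A))"
      unfolding sum_distrib_left
    proof (intro sum.cong refl)
      fix m assume "m \<in> {..?d}"
      then have "c ^ ?d = c ^ (?d - m) * c ^ m" by (simp flip: power_add)
      then show "c ^ ?d * ((\<rho> / c) ^ (?d - m) * unit_ball_vol (real (?d - m)) * intrinsic_volume m A) =
          \<rho> ^ (?d - m) * unit_ball_vol (real (?d - m)) * (c ^ m * intrinsic_volume m A)"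
        using c by (simp add: power_divide)
    qed
    finally show ?thesis .
  qed
  then show "steiner_coefficients ((*\<^sub>R) c ` A) (\<lambda>m. c ^ m * intrinsic_volume m A)"
    using S by (simp add: steiner_coefficients_def)
qed

text \<open>Interpolation applied to the Steiner polynomial. What matters is that the weights
  \<open>\<beta>\<close> do not depend on the set, so that bounds and continuity pass from volumes
  to intrinsic volumes.\<close>

lemma intrinsic_volume_linear_combination:
  assumes m: "m \<le> CARD('n)"
  obtains \<beta> where "\<And>A :: (real^'n) set. compact A \<Longrightarrow> convex A \<Longrightarrow> A \<noteq> {} \<Longrightarrow>
    intrinsic_volume m A = (\<Sum>j\<le>CARD('n). \<beta> j * measure lebesgue (A + cball 0 (real (Suc j))))"
proof -
  let ?d = "CARD('n)"
  obtain \<alpha> :: "nat \<Rightarrow> nat \<Rightarrow> real" where \<alpha>: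
      "\<And>p i. degree p \<le> ?d \<Longrightarrow> coeff p i = (\<Sum>j\<le>?d. \<alpha> i j * poly p (real (Suc j)))"
    using exists_lagrange_coefficients[of ?d] by metis
  let ?\<kappa> = "\<lambda>k::nat. unit_ball_vol (real k)"
  have pos: "?\<kappa> k \<noteq> 0" for k
    by (metis less_irrefl of_nat_0_le_iff unit_ball_vol_pos)
  have "intrinsic_volume m A = (\<Sum>j\<le>?d. (\<alpha> (?d - m) j / ?\<kappa> (?d - m)) * measure lebesgue (A + cball 0 (real (Suc j))))"
    if A: "compact A" "convex A" "A \<noteq> {}" for A :: "(real^'n) set"
  proof -
    let ?V = "\<lambda>m. intrinsic_volume m A"
    define p where "p = (\<Sum>m\<le>?d. monom (?\<kappa> (?d - m) * ?V m) (?d - m))"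
    have "degree p \<le> ?d"
      unfolding p_def by (intro degree_sum_le) (auto intro: order_trans[OF degree_monom_le])
    moreover have "coeff p (?d - m) = ?\<kappa> (?d - m) * ?V m"
    proof -
      have "coeff p (?d - m) = (\<Sum>i\<le>?d. if i = m then ?\<kappa> (?d - i) * ?V i else 0)"
        unfolding p_def coeff_sum using m by (intro sum.cong) (auto simp: coeff_monom)
      then show ?thesis using m by simp
    qed
    moreover have "poly p (real (Suc j)) = measure lebesgue (A + cball 0 (real (Suc j)))" for j
    proof -
      have \<rho>: "real (Suc j) \<ge> 0" by simp
      have "measure lebesgue (A + cball 0 (real (Suc j))) = (\<Sum>m\<le>?d. real (Suc j) ^ (?d - m) * ?\<kappa> (?d - m) * ?V m)"
        using steiner_intrinsic_volume[OF A] \<rho>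
        unfolding steiner_coefficients_def scaled_unit_ball_sum[OF \<rho>, symmetric] by blast
      then show ?thesis by (simp add: p_def poly_sum poly_monom mult.commute mult.left_commute)
    qed
    ultimately have "?\<kappa> (?d - m) * ?V m = (\<Sum>j\<le>?d. \<alpha> (?d - m) j * measure lebesgue (A + cball 0 (real (Suc j))))"
      using \<alpha>[of p "?d - m"] by simp
    then have "?V m = (\<Sum>j\<le>?d. \<alpha> (?d - m) j * measure lebesgue (A + cball 0 (real (Suc j)))) / ?\<kappa> (?d - m)"
      using pos[of "?d - m"] by (simp add: field_simps)
    then show ?thesis by (simp only: sum_divide_distrib times_divide_eq_left)
  qed
  then show thesis by (rule that)
qed

lemma measure_plus_cball_le:
  fixes A :: "'a::euclidean_space set"
  assumes A: "compact A" "A \<subseteq> cball 0 R" and "R \<ge> 0" "\<rho> \<ge> 0"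
  shows "measure lebesgue (A + cball 0 \<rho>) \<le> unit_ball_vol DIM('a) * (R + \<rho>) ^ DIM('a)"
proof -
  have "A + cball 0 \<rho> \<subseteq> cball 0 (R + \<rho>)"
  proof
    fix x assume "x \<in> A + cball 0 \<rho>"
    then obtain y z where x: "x = y + z" "y \<in> A" "norm z \<le> \<rho>" by (auto simp: set_plus_def)
    then have "norm y \<le> R" using A by auto
    with x show "x \<in> cball 0 (R + \<rho>)" using norm_triangle_ineq[of y z] by simp
  qed
  then have "measure lebesgue (A + cball 0 \<rho>) \<le> measure lebesgue (cball (0::'a) (R + \<rho>))"
    using A by (intro measure_mono_fmeasurable fmeasurableD lmeasurable_set_plus) auto
  then show ?thesis using assms by (simp add: content_cball)
qed

text \<open>The linear combination of parallel volumes is only used inside the unit ball, because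
  for large \<open>R\<close> it would give the order \<open>R ^ d\<close>. Homogeneity then yields
  the correct power \<open>R ^ m\<close>.\<close>

lemma intrinsic_volume_bound:
  assumes m: "m \<le> CARD('n)"
  obtains C where "C \<ge> 0" "\<And>A R. compact A \<Longrightarrow> convex A \<Longrightarrow> A \<noteq> {} \<Longrightarrow> (A :: (real^'n) set) \<subseteq> cball 0 R \<Longrightarrow> R > 0 \<Longrightarrow>
    \<bar>intrinsic_volume m A\<bar> \<le> C * R ^ m"
proof -
  let ?d = "CARD('n)"
  obtain \<beta> where \<beta>: "\<And>A :: (real^'n) set. compact A \<Longrightarrow> convex A \<Longrightarrow> A \<noteq> {} \<Longrightarrow>
      intrinsic_volume m A = (\<Sum>j\<le>?d. \<beta> j * measure lebesgue (A + cball 0 (real (Suc j))))"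
    using intrinsic_volume_linear_combination[OF m] by blast
  define C where "C = (\<Sum>j\<le>?d. \<bar>\<beta> j\<bar> * (unit_ball_vol ?d * (1 + real (Suc j)) ^ ?d))"
  have unit: "\<bar>intrinsic_volume m A\<bar> \<le> C" if A: "compact A" "convex A" "A \<noteq> {}" "A \<subseteq> cball 0 1" for A :: "(real^'n) set"
  proof -
    have "\<bar>intrinsic_volume m A\<bar> \<le> (\<Sum>j\<le>?d. \<bar>\<beta> j * measure lebesgue (A + cball 0 (real (Suc j)))\<bar>)"
      unfolding \<beta>[OF A(1-3)] by (rule sum_abs)
    also have "\<dots> \<le> C"
      unfolding C_def
    proof (intro sum_mono)
      fix j
      have "measure lebesgue (A + cball 0 (real (Suc j))) \<le> unit_ball_vol ?d * (1 + real (Suc j)) ^ ?d"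
        using measure_plus_cball_le[OF A(1,4), of "real (Suc j)"] by simp
      then show "\<bar>\<beta> j * measure lebesgue (A + cball 0 (real (Suc j)))\<bar> \<le> \<bar>\<beta> j\<bar> * (unit_ball_vol ?d * (1 + real (Suc j)) ^ ?d)"
        by (simp only: abs_mult abs_of_nonneg measure_nonneg mult_left_mono abs_ge_zero)
    qed
    finally show ?thesis .
  qed
  have "\<bar>intrinsic_volume m A\<bar> \<le> C * R ^ m"
    if A: "compact A" "convex A" "A \<noteq> {}" "A \<subseteq> cball 0 R" and R: "R > 0" for A :: "(real^'n) set" and R
  proof -
    define B where "B = (*\<^sub>R) (inverse R) ` A"
    have B: "compact B" "convex B" "B \<noteq> {}" "B \<subseteq> cball 0 1"
      unfolding B_def using A R by (auto intro!: compact_scaling convex_scaling simp: field_simps)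
    have "A = (*\<^sub>R) R ` B" unfolding B_def using R by (simp add: image_image)
    then have "\<bar>intrinsic_volume m A\<bar> = R ^ m * \<bar>intrinsic_volume m B\<bar>"
      using intrinsic_volume_scaleR[OF B(1-3) R] R by (simp add: abs_mult)
    also have "\<dots> \<le> R ^ m * C" using unit[OF B] R by (intro mult_left_mono) auto
    finally show ?thesis by (simp add: mult.commute)
  qed
  moreover have "C \<ge> 0"
    unfolding C_def by (intro sum_nonneg mult_nonneg_nonneg) auto
  ultimately show thesis using that by blast
qed

section \<open>Hausdorff closeness and continuity of intrinsic volumes of hulls\<close>

definition hausdorff_close :: "real \<Rightarrow> 'a::metric_space set \<Rightarrow> 'a set \<Rightarrow> bool" where
  "hausdorff_close \<delta> A B \<longleftrightarrow> (\<forall>a\<in>A. \<exists>b\<in>B. dist a b \<le> \<delta>) \<and> (\<forall>b\<in>B. \<exists>a\<in>A. dist a b \<le> \<delta>)"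

lemma hausdorff_close_sym: "hausdorff_close \<delta> A B \<Longrightarrow> hausdorff_close \<delta> B A"
  by (auto simp: hausdorff_close_def dist_commute)

lemma hausdorff_close_subset_plus:
  fixes A B :: "'a::real_normed_vector set"
  assumes "hausdorff_close \<delta> A B"
  shows "convex hull A \<subseteq> convex hull B + cball 0 \<delta>"
proof (rule hull_minimal)
  show "A \<subseteq> convex hull B + cball 0 \<delta>"
  proof
    fix a assume "a \<in> A"
    then obtain b where b: "b \<in> B" "dist a b \<le> \<delta>" using assms by (auto simp: hausdorff_close_def)
    have "b + (a - b) \<in> convex hull B + cball 0 \<delta>"
      using b by (intro set_plus_intro) (auto simp: hull_inc dist_norm norm_minus_commute)
    then show "a \<in> convex hull B + cball 0 \<delta>" by simp
  qed
qed (intro convex_set_plus convex_convex_hull convex_cball)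

lemma cball_plus_cball:
  fixes a b :: real
  assumes "a \<ge> 0" "b \<ge> 0"
  shows "cball 0 a + cball 0 b \<subseteq> cball (0::'a::real_normed_vector) (a + b)"
  by (auto simp: set_plus_def intro: order_trans[OF norm_triangle_ineq add_mono])

text \<open>Closeness enlarges the radius from \<open>\<rho>\<close> to at most
  \<open>\<rho> + \<delta>\<close>. As \<open>\<rho> \<ge> 1\<close>, this is below
  \<open>(1 + \<delta>) * \<rho>\<close>, a dilation, which costs the factor
  \<open>(1 + \<delta>) ^ d\<close>. The estimate is one-sided and is used in both
  directions.\<close>

lemma measure_parallel_hausdorff_close:
  fixes A B :: "'a::euclidean_space set"
  assumes A: "compact A" "A \<noteq> {}" and B: "compact B" "B \<noteq> {}" "B \<subseteq> cball 0 R"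
    and "R \<ge> 0" "\<delta> \<ge> 0" "\<rho> \<ge> 1" and close: "hausdorff_close \<delta> A B"
  shows "measure lebesgue (convex hull A + cball 0 \<rho>) - measure lebesgue (convex hull B + cball 0 \<rho>)
    \<le> ((1 + \<delta>) ^ DIM('a) - 1) * (unit_ball_vol DIM('a) * (R + \<rho>) ^ DIM('a))"
proof -
  let ?A = "convex hull A" and ?B = "convex hull B"
  have c: "compact ?A" "compact ?B" using A B by (auto intro: compact_convex_hull)
  have "?A + cball 0 \<rho> \<subseteq> (?B + cball 0 \<delta>) + cball 0 \<rho>"
    by (intro set_plus_mono2 hausdorff_close_subset_plus close) auto
  also have "\<dots> \<subseteq> ?B + cball 0 ((1 + \<delta>) * \<rho>)"
  proof -
    have "cball 0 \<delta> + cball 0 \<rho> \<subseteq> cball (0::'a) (\<delta> + \<rho>)"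
      using assms by (intro cball_plus_cball) auto
    also have "\<dots> \<subseteq> cball 0 ((1 + \<delta>) * \<rho>)"
      using assms mult_left_mono[of 1 \<rho> \<delta>] by (intro subset_cball) (simp add: algebra_simps)
    finally show ?thesis by (simp add: add.assoc set_plus_mono2)
  qed
  finally have "measure lebesgue (?A + cball 0 \<rho>) \<le> measure lebesgue (?B + cball 0 ((1 + \<delta>) * \<rho>))"
    using c by (intro measure_set_plus_mono) auto
  also have "\<dots> \<le> (1 + \<delta>) ^ DIM('a) * measure lebesgue (?B + cball 0 \<rho>)"
    using assms c by (intro measure_set_plus_cball_dilate) auto
  finally have "measure lebesgue (?A + cball 0 \<rho>) - measure lebesgue (?B + cball 0 \<rho>)
      \<le> ((1 + \<delta>) ^ DIM('a) - 1) * measure lebesgue (?B + cball 0 \<rho>)"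
    by (simp add: algebra_simps)
  also have "\<dots> \<le> ((1 + \<delta>) ^ DIM('a) - 1) * (unit_ball_vol DIM('a) * (R + \<rho>) ^ DIM('a))"
    using assms c by (intro mult_left_mono measure_plus_cball_le hull_minimal) (auto simp: one_le_power)
  finally show ?thesis .
qed

lemma intrinsic_volume_hull_uniformly_continuous:
  assumes m: "m \<le> CARD('n)" and R: "R \<ge> 0" and \<epsilon>: "\<epsilon> > 0"
  obtains \<delta> where "\<delta> > 0" "\<And>A B :: (real^'n) set. compact A \<Longrightarrow> A \<noteq> {} \<Longrightarrow> A \<subseteq> cball 0 R \<Longrightarrow>
    compact B \<Longrightarrow> B \<noteq> {} \<Longrightarrow> B \<subseteq> cball 0 R \<Longrightarrow> hausdorff_close \<delta> A B \<Longrightarrow>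
    \<bar>intrinsic_volume m (convex hull A) - intrinsic_volume m (convex hull B)\<bar> \<le> \<epsilon>"
proof -
  let ?d = "CARD('n)"
  obtain \<beta> where \<beta>: "\<And>A :: (real^'n) set. compact A \<Longrightarrow> convex A \<Longrightarrow> A \<noteq> {} \<Longrightarrow>
      intrinsic_volume m A = (\<Sum>j\<le>?d. \<beta> j * measure lebesgue (A + cball 0 (real (Suc j))))"
    using intrinsic_volume_linear_combination[OF m] by blast
  define C where "C = (\<Sum>j\<le>?d. \<bar>\<beta> j\<bar> * (unit_ball_vol ?d * (R + real (Suc j)) ^ ?d))"
  have "((\<lambda>\<delta>. ((1 + \<delta>) ^ ?d - 1) * C) \<longlongrightarrow> ((1 + 0) ^ ?d - 1) * C) (at_right 0)"
    by (intro tendsto_intros)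
  then have "eventually (\<lambda>\<delta>. ((1 + \<delta>) ^ ?d - 1) * C < \<epsilon>) (at_right 0)"
    using \<epsilon> by (intro order_tendstoD(2)) auto
  then obtain b where b: "b > 0" "\<And>\<delta>. 0 < \<delta> \<Longrightarrow> \<delta> < b \<Longrightarrow> ((1 + \<delta>) ^ ?d - 1) * C < \<epsilon>"
    unfolding eventually_at_right_field by auto
  define \<delta> where "\<delta> = b / 2"
  have \<delta>: "\<delta> > 0" "((1 + \<delta>) ^ ?d - 1) * C \<le> \<epsilon>"
    using b by (auto simp: \<delta>_def intro!: less_imp_le)
  have "\<bar>intrinsic_volume m (convex hull A) - intrinsic_volume m (convex hull B)\<bar> \<le> \<epsilon>"
    if A: "compact A" "A \<noteq> {}" "A \<subseteq> cball 0 R" and B: "compact B" "B \<noteq> {}" "B \<subseteq> cball 0 R"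
      and close: "hausdorff_close \<delta> A B" for A B :: "(real^'n) set"
  proof -
    define F where "F A j = measure lebesgue (convex hull A + cball 0 (real (Suc j)))" for A :: "(real^'n) set" and j
    have "\<bar>F A j - F B j\<bar> \<le> ((1 + \<delta>) ^ ?d - 1) * (unit_ball_vol ?d * (R + real (Suc j)) ^ ?d)" for j
      using measure_parallel_hausdorff_close[OF A(1,2) B R _ _ close, of "real (Suc j)"]
        measure_parallel_hausdorff_close[OF B(1,2) A R _ _ hausdorff_close_sym[OF close], of "real (Suc j)"] \<delta>
      by (simp add: F_def abs_le_iff)
    then have j: "\<bar>\<beta> j\<bar> * \<bar>F A j - F B j\<bar> \<le> \<bar>\<beta> j\<bar> * (((1 + \<delta>) ^ ?d - 1) * (unit_ball_vol ?d * (R + real (Suc j)) ^ ?d))" for j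
      by (intro mult_left_mono) auto
    have V: "intrinsic_volume m (convex hull A) = (\<Sum>j\<le>?d. \<beta> j * F A j)"
      if "compact A" "A \<noteq> {}" for A :: "(real^'n) set"
      unfolding F_def using that by (intro \<beta>) (auto intro: compact_convex_hull)
    have "\<bar>intrinsic_volume m (convex hull A) - intrinsic_volume m (convex hull B)\<bar> = \<bar>\<Sum>j\<le>?d. \<beta> j * (F A j - F B j)\<bar>"
      using A B by (simp add: V sum_subtractf right_diff_distrib)
    also have "\<dots> \<le> (\<Sum>j\<le>?d. \<bar>\<beta> j\<bar> * \<bar>F A j - F B j\<bar>)"
      by (rule order_trans[OF sum_abs]) (simp add: abs_mult)
    also have "\<dots> \<le> ((1 + \<delta>) ^ ?d - 1) * C"
      unfolding C_def sum_distrib_left using j by (intro sum_mono) (simp add: mult.left_commute)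
    finally show ?thesis using \<delta> by simp
  qed
  with \<delta> show thesis using that by blast
qed

subsection \<open>Moments of the maximum of a random walk\<close>

text \<open>The mean value inequality is used twice, for the derivative and then for the function
  minus its linear part. Since \<open>1 + s \<le> 2\<close> on the interval, \<open>2 powr q\<close>
  dominates every power that occurs.\<close>

lemma powr_taylor_at_1:
  fixes q t :: real
  assumes q: "q \<ge> 2" and t: "\<bar>t\<bar> \<le> 1/2"
  shows "(1 + t) powr q \<le> 1 + q * t + q\<^sup>2 * 2 powr q * t\<^sup>2"
proof -
  define S where "S = {-\<bar>t\<bar>..\<bar>t\<bar>}"
  have S: "convex S" "0 \<in> S" "t \<in> S" by (auto simp: S_def)
  have pos: "1 + s > 0" "1 + s \<le> 2" if "s \<in> S" for s using that t by (auto simp: S_def)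
  have le: "(1 + s) powr r \<le> 2 powr q" if "s \<in> S" "0 \<le> r" "r \<le> q" for s r
  proof -
    have "(1 + s) powr r \<le> 2 powr r"
      using pos[OF that(1)] that by (intro powr_mono2) auto
    also have "\<dots> \<le> 2 powr q" using that by (intro powr_mono) auto
    finally show ?thesis .
  qed
  have 1: "\<bar>(1 + s) powr (q - 1) - 1\<bar> \<le> q * 2 powr q * \<bar>t\<bar>" if s: "s \<in> S" for s
  proof -
    have "norm ((1 + s) powr (q - 1) - (1 + 0) powr (q - 1)) \<le> q * 2 powr q * norm (s - 0)"
    proof (rule field_differentiable_bound[OF S(1) _ _ s S(2)])
      fix z assume z: "z \<in> S"
      show "((\<lambda>z. (1 + z) powr (q - 1)) has_field_derivative (q - 1) * (1 + z) powr (q - 2)) (at z within S)"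
        using pos[OF z] by (auto intro!: derivative_eq_intros)
      have "(q - 1) * (1 + z) powr (q - 2) \<le> q * 2 powr q"
        using q le[OF z, of "q - 2"] by (intro mult_mono) auto
      then show "norm ((q - 1) * (1 + z) powr (q - 2)) \<le> q * 2 powr q"
        using q by simp
    qed
    also have "\<dots> \<le> q * 2 powr q * \<bar>t\<bar>" using s q by (intro mult_left_mono) (auto simp: S_def)
    finally show ?thesis by simp
  qed
  have "norm (((1 + t) powr q - q * t) - ((1 + 0) powr q - q * 0)) \<le> q * (q * 2 powr q * \<bar>t\<bar>) * norm (t - 0)"
  proof (rule field_differentiable_bound[OF S(1) _ _ S(3) S(2)])
    fix z assume z: "z \<in> S"
    show "((\<lambda>z. (1 + z) powr q - q * z) has_field_derivative q * ((1 + z) powr (q - 1) - 1)) (at z within S)"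
      using pos[OF z] by (auto intro!: derivative_eq_intros simp: algebra_simps)
    show "norm (q * ((1 + z) powr (q - 1) - 1)) \<le> q * (q * 2 powr q * \<bar>t\<bar>)"
      using 1[OF z] q by (simp add: abs_mult mult_left_mono)
  qed
  also have "\<dots> = q\<^sup>2 * 2 powr q * \<bar>t\<bar>\<^sup>2"
    by (simp only: power2_eq_square real_norm_def diff_zero mult_ac)
  finally have "\<bar>(1 + t) powr q - q * t - 1\<bar> \<le> q\<^sup>2 * 2 powr q * t\<^sup>2" by simp
  then show ?thesis by linarith
qed

text \<open>By homogeneity it suffices to take \<open>x = 1\<close> and \<open>t = y / x\<close>.
  The first order term, with the derivative of \<open>\<bar>x\<bar> powr q\<close>, is kept exactly
  because it will have mean zero; the remainder separates into a product and a pure power of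
  \<open>y\<close>.\<close>

lemma abs_powr_taylor:
  fixes q :: real
  assumes q: "q \<ge> 2"
  obtains C where "C \<ge> 0" "\<And>x y :: real. \<bar>x + y\<bar> powr q \<le> \<bar>x\<bar> powr q + q * (sgn x * \<bar>x\<bar> powr (q - 1)) * y
    + C * (\<bar>x\<bar> powr (q - 2) * y\<^sup>2 + \<bar>y\<bar> powr q)"
proof -
  \<comment> \<open>The summand \<open>q\<^sup>2 * 2 powr q\<close> is the Taylor remainder for
    small \<open>t\<close>. For \<open>\<bar>t\<bar> > 1/2\<close>, \<open>3 powr q\<close> comes
    from \<open>\<bar>1 + t\<bar> \<le> 3 * \<bar>t\<bar>\<close>, and \<open>2 * q\<close>
    compensates a negative linear term by the quadratic one.\<close>
  define C where "C = 3 powr q + q\<^sup>2 * 2 powr q + 2 * q"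
  have C: "C \<ge> 0" "C \<ge> 3 powr q" "C \<ge> q\<^sup>2 * 2 powr q" "C \<ge> 2 * q" "C \<ge> 1"
    unfolding C_def using q ge_one_powr_ge_zero[of 3 q]
    by (auto simp: add_nonneg_nonneg intro!: add_increasing2)
  have unit: "\<bar>1 + t\<bar> powr q \<le> 1 + q * t + C * (t\<^sup>2 + \<bar>t\<bar> powr q)" for t :: real
  proof (cases "\<bar>t\<bar> \<le> 1/2")
    case True
    then have "\<bar>1 + t\<bar> = 1 + t" by auto
    then have "\<bar>1 + t\<bar> powr q \<le> 1 + q * t + q\<^sup>2 * 2 powr q * t\<^sup>2"
      using powr_taylor_at_1[OF q True] by simp
    also have "q\<^sup>2 * 2 powr q * t\<^sup>2 \<le> C * t\<^sup>2" using C by (intro mult_right_mono) auto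
    also have "C * t\<^sup>2 \<le> C * (t\<^sup>2 + \<bar>t\<bar> powr q)" using C by (intro mult_left_mono) auto
    finally show ?thesis by simp
  next
    case False
    have "\<bar>1 + t\<bar> powr q \<le> (3 * \<bar>t\<bar>) powr q" using False q by (intro powr_mono2) auto
    also have "\<dots> = 3 powr q * \<bar>t\<bar> powr q" by (simp add: powr_mult)
    also have "\<dots> \<le> C * \<bar>t\<bar> powr q" using C by (intro mult_right_mono) auto
    finally have 1: "\<bar>1 + t\<bar> powr q \<le> C * \<bar>t\<bar> powr q" .
    have "- (q * t) \<le> q * \<bar>t\<bar>" using q by (metis abs_ge_minus_self mult_left_mono mult_minus_right order_trans zero_le_numeral)
    also have "\<dots> \<le> q * (2 * \<bar>t\<bar> * \<bar>t\<bar>)"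
      using False q mult_right_mono[of 1 "2 * \<bar>t\<bar>" "\<bar>t\<bar>"] by (intro mult_left_mono) auto
    also have "\<dots> = 2 * q * t\<^sup>2" by (simp add: power2_eq_square abs_mult_self_eq mult.assoc)
    also have "\<dots> \<le> C * t\<^sup>2" using C by (intro mult_right_mono) auto
    finally show ?thesis using 1 by (simp add: algebra_simps)
  qed
  have "\<bar>x + y\<bar> powr q \<le> \<bar>x\<bar> powr q + q * (sgn x * \<bar>x\<bar> powr (q - 1)) * y
    + C * (\<bar>x\<bar> powr (q - 2) * y\<^sup>2 + \<bar>y\<bar> powr q)" for x y :: real
  proof (cases "x = 0")
    case True
    then show ?thesis using C mult_right_mono[of 1 C "\<bar>y\<bar> powr q"] by simp
  next
    case False
    define t where "t = y / x"
    have y: "y = x * t" using False by (simp add: t_def)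
    have p1: "\<bar>x\<bar> powr q = \<bar>x\<bar> powr (q - 1) * \<bar>x\<bar>"
      using False powr_add[of "\<bar>x\<bar>" "q - 1" 1] by simp
    have p2: "\<bar>x\<bar> powr q = \<bar>x\<bar> powr (q - 2) * x\<^sup>2"
      using False powr_add[of "\<bar>x\<bar>" "q - 2" 2] by (simp add: powr_numeral)
    have "\<bar>x + y\<bar> = \<bar>x\<bar> * \<bar>1 + t\<bar>" unfolding y abs_mult[symmetric] by (simp add: algebra_simps)
    then have "\<bar>x + y\<bar> powr q = \<bar>x\<bar> powr q * \<bar>1 + t\<bar> powr q" by (simp add: powr_mult)
    also have "\<dots> \<le> \<bar>x\<bar> powr q * (1 + q * t + C * (t\<^sup>2 + \<bar>t\<bar> powr q))"
      using unit by (intro mult_left_mono) auto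
    also have "\<dots> = \<bar>x\<bar> powr q + q * (\<bar>x\<bar> powr q * t) + C * (\<bar>x\<bar> powr q * t\<^sup>2 + \<bar>x\<bar> powr q * \<bar>t\<bar> powr q)"
      by (simp add: algebra_simps)
    also have "\<bar>x\<bar> powr q * t = sgn x * \<bar>x\<bar> powr (q - 1) * y"
      unfolding p1 y by (simp add: sgn_if abs_if)
    also have "\<bar>x\<bar> powr q * t\<^sup>2 = \<bar>x\<bar> powr (q - 2) * y\<^sup>2"
      unfolding p2 y by (simp add: power_mult_distrib)
    also have "\<bar>x\<bar> powr q * \<bar>t\<bar> powr q = \<bar>y\<bar> powr q"
      unfolding y by (simp add: abs_mult powr_mult)
    finally show ?thesis by (simp add: mult.assoc)
  qed
  with C show thesis using that by blast
qed

lemma powr_le_1_plus: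
  fixes x a b :: real
  assumes "0 \<le> x" "0 \<le> a" "a \<le> b"
  shows "x powr a \<le> 1 + x powr b"
proof (cases "x \<le> 1")
  case True
  then have "x powr a \<le> 1" using assms by (intro powr_le1) auto
  then show ?thesis by (simp add: add_increasing2)
next
  case False
  then have "x powr a \<le> x powr b" using assms by (intro powr_mono) auto
  then show ?thesis by simp
qed

text \<open>If \<open>\<epsilon> * t\<^sup>2 \<ge> 1\<close> the first term on the right dominates,
  otherwise \<open>t\<close> is bounded and the constant does. It closes the moment recursion, in
  which the lower power \<open>q - 2\<close> appears.\<close>

lemma powr_interpolate:
  fixes t \<epsilon> q :: real
  assumes "t \<ge> 0" "\<epsilon> > 0" "q \<ge> 2"
  shows "t powr (q - 2) \<le> \<epsilon> * t powr q + \<epsilon> powr (- ((q - 2) / 2))"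
proof (cases "\<epsilon> * t\<^sup>2 \<ge> 1")
  case True
  then have "t > 0" using assms by (cases "t = 0") auto
  have "t powr (q - 2) * 1 \<le> t powr (q - 2) * (\<epsilon> * t\<^sup>2)"
    using True by (intro mult_left_mono) auto
  also have "\<dots> = \<epsilon> * t powr q"
    using \<open>t > 0\<close> powr_add[of t "q - 2" 2] by (simp add: powr_numeral)
  finally show ?thesis by (simp add: add_increasing2)
next
  case False
  then have "t\<^sup>2 \<le> inverse \<epsilon>" using assms by (simp add: field_simps)
  then have "(t\<^sup>2) powr ((q - 2) / 2) \<le> inverse \<epsilon> powr ((q - 2) / 2)"
    using assms by (intro powr_mono2) auto
  also have "(t\<^sup>2) powr ((q - 2) / 2) = t powr (q - 2)"
  proof (cases "t = 0")
    case False
    then have "t\<^sup>2 = t powr 2" using assms by (simp add: powr_numeral)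
    moreover have "2 * ((q - 2) / 2) = q - 2" by simp
    ultimately show ?thesis by (simp only: powr_powr)
  qed simp
  also have "inverse \<epsilon> powr ((q - 2) / 2) = \<epsilon> powr (- ((q - 2) / 2))"
    using assms by (simp add: powr_minus inverse_powr)
  finally show ?thesis using assms by (simp add: add_increasing)
qed

context prob_space
begin

lemma integrable_abs_powr_le:
  fixes f :: "'a \<Rightarrow> real"
  assumes "integrable M (\<lambda>\<omega>. \<bar>f \<omega>\<bar> powr q)" "f \<in> borel_measurable M" "0 \<le> r" "r \<le> q"
  shows "integrable M (\<lambda>\<omega>. \<bar>f \<omega>\<bar> powr r)"
proof (rule Bochner_Integration.integrable_bound)
  show "integrable M (\<lambda>\<omega>. 1 + \<bar>f \<omega>\<bar> powr q)" using assms by simp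
  show "AE \<omega> in M. norm (\<bar>f \<omega>\<bar> powr r) \<le> norm (1 + \<bar>f \<omega>\<bar> powr q)"
    using powr_le_1_plus[OF _ assms(3,4)] by (intro AE_I2) (simp add: add_nonneg_nonneg)
qed (use assms in measurable)

text \<open>In the Taylor bound the linear term integrates to 0, since \<open>V\<close> is centred
  and independent of \<open>U\<close>; the quadratic term factors by independence, and the second
  moment of \<open>V\<close> is estimated by its \<open>q\<close>-th moment.\<close>

lemma abs_sum_powr_step:
  fixes U V :: "'a \<Rightarrow> real"
  assumes q: "q > 2" and C: "C \<ge> 0" "\<And>x y :: real. \<bar>x + y\<bar> powr q \<le> \<bar>x\<bar> powr q + q * (sgn x * \<bar>x\<bar> powr (q - 1)) * y
      + C * (\<bar>x\<bar> powr (q - 2) * y\<^sup>2 + \<bar>y\<bar> powr q)"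
    and indep: "indep_var borel V borel U"
    and U: "integrable M (\<lambda>\<omega>. \<bar>U \<omega>\<bar> powr q)"
    and V: "integrable M (\<lambda>\<omega>. \<bar>V \<omega>\<bar> powr q)" "expectation V = 0"
  shows "integrable M (\<lambda>\<omega>. \<bar>U \<omega> + V \<omega>\<bar> powr q)"
    and "expectation (\<lambda>\<omega>. \<bar>U \<omega> + V \<omega>\<bar> powr q) \<le> expectation (\<lambda>\<omega>. \<bar>U \<omega>\<bar> powr q)
      + C * (expectation (\<lambda>\<omega>. \<bar>U \<omega>\<bar> powr (q - 2)) * (1 + expectation (\<lambda>\<omega>. \<bar>V \<omega>\<bar> powr q)) + expectation (\<lambda>\<omega>. \<bar>V \<omega>\<bar> powr q))"
proof -
  have [measurable]: "U \<in> borel_measurable M" "V \<in> borel_measurable M"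
    using indep by (auto dest: indep_var_rv1 indep_var_rv2)
  have Uq2: "integrable M (\<lambda>\<omega>. \<bar>U \<omega>\<bar> powr (q - 2))" and Uq1: "integrable M (\<lambda>\<omega>. \<bar>U \<omega>\<bar> powr (q - 1))"
    using q by (auto intro!: integrable_abs_powr_le[OF U])
  have V1: "integrable M V"
  proof -
    have "integrable M (\<lambda>\<omega>. \<bar>V \<omega>\<bar> powr 1)"
      using q by (intro integrable_abs_powr_le[OF V(1)]) auto
    then show ?thesis by (simp add: integrable_abs_iff)
  qed
  have sq: "x\<^sup>2 \<le> 1 + \<bar>x\<bar> powr q" for x :: real
    using powr_le_1_plus[of "\<bar>x\<bar>" 2 q] q by (cases "x = 0") (auto simp: powr_numeral)
  have V2: "integrable M (\<lambda>\<omega>. (V \<omega>)\<^sup>2)"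
    by (rule Bochner_Integration.integrable_bound[of _ "\<lambda>\<omega>. 1 + \<bar>V \<omega>\<bar> powr q"])
      (use V(1) sq in \<open>auto simp: add_nonneg_nonneg\<close>)
  have V2_le: "expectation (\<lambda>\<omega>. (V \<omega>)\<^sup>2) \<le> 1 + expectation (\<lambda>\<omega>. \<bar>V \<omega>\<bar> powr q)"
  proof -
    have "expectation (\<lambda>\<omega>. (V \<omega>)\<^sup>2) \<le> expectation (\<lambda>\<omega>. 1 + \<bar>V \<omega>\<bar> powr q)"
      using V V2 sq by (intro integral_mono) auto
    then show ?thesis using V by (simp add: prob_space)
  qed
  let ?S = "\<lambda>x::real. sgn x * \<bar>x\<bar> powr (q - 1)"
  have S: "integrable M (\<lambda>\<omega>. ?S (U \<omega>))"
    by (rule Bochner_Integration.integrable_bound[OF Uq1]) (auto simp: abs_mult sgn_if)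
  have i1: "indep_var borel V borel (\<lambda>\<omega>. ?S (U \<omega>))"
    using indep_var_compose[OF indep, of "\<lambda>x. x" borel ?S borel] by (simp add: o_def)
  have i2: "indep_var borel (\<lambda>\<omega>. (V \<omega>)\<^sup>2) borel (\<lambda>\<omega>. \<bar>U \<omega>\<bar> powr (q - 2))"
    using indep_var_compose[OF indep, of "\<lambda>x. x\<^sup>2" borel "\<lambda>x. \<bar>x\<bar> powr (q - 2)" borel] by (simp add: o_def)
  have I1: "integrable M (\<lambda>\<omega>. V \<omega> * ?S (U \<omega>))" "expectation (\<lambda>\<omega>. V \<omega> * ?S (U \<omega>)) = 0"
    using indep_var_integrable[OF i1 V1 S] indep_var_lebesgue_integral[OF i1 V1 S] V by auto
  have I2: "integrable M (\<lambda>\<omega>. (V \<omega>)\<^sup>2 * \<bar>U \<omega>\<bar> powr (q - 2))"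
      "expectation (\<lambda>\<omega>. (V \<omega>)\<^sup>2 * \<bar>U \<omega>\<bar> powr (q - 2)) = expectation (\<lambda>\<omega>. (V \<omega>)\<^sup>2) * expectation (\<lambda>\<omega>. \<bar>U \<omega>\<bar> powr (q - 2))"
    using indep_var_integrable[OF i2 V2 Uq2] indep_var_lebesgue_integral[OF i2 V2 Uq2] by auto
  let ?F = "\<lambda>\<omega>. \<bar>U \<omega>\<bar> powr q + q * (V \<omega> * ?S (U \<omega>)) + C * ((V \<omega>)\<^sup>2 * \<bar>U \<omega>\<bar> powr (q - 2) + \<bar>V \<omega>\<bar> powr q)"
  have F: "integrable M ?F"
    using U V I1 I2 by (intro Bochner_Integration.integrable_add integrable_mult_right) auto
  have le: "\<bar>U \<omega> + V \<omega>\<bar> powr q \<le> ?F \<omega>" for \<omega>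
    using C(2)[of "U \<omega>" "V \<omega>"] by (simp add: mult.commute mult.left_commute)
  show int: "integrable M (\<lambda>\<omega>. \<bar>U \<omega> + V \<omega>\<bar> powr q)"
    by (rule Bochner_Integration.integrable_bound[OF F]) (use le in \<open>auto intro!: AE_I2 order_trans[OF _ abs_ge_self]\<close>)
  have "expectation (\<lambda>\<omega>. \<bar>U \<omega> + V \<omega>\<bar> powr q) \<le> expectation ?F"
    using int F le by (rule integral_mono)
  also have "\<dots> = expectation (\<lambda>\<omega>. \<bar>U \<omega>\<bar> powr q) + C * (expectation (\<lambda>\<omega>. (V \<omega>)\<^sup>2) * expectation (\<lambda>\<omega>. \<bar>U \<omega>\<bar> powr (q - 2)) + expectation (\<lambda>\<omega>. \<bar>V \<omega>\<bar> powr q))"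
    using U V I1 I2 by simp
  also have "\<dots> \<le> expectation (\<lambda>\<omega>. \<bar>U \<omega>\<bar> powr q)
      + C * (expectation (\<lambda>\<omega>. \<bar>U \<omega>\<bar> powr (q - 2)) * (1 + expectation (\<lambda>\<omega>. \<bar>V \<omega>\<bar> powr q)) + expectation (\<lambda>\<omega>. \<bar>V \<omega>\<bar> powr q))"
    using C V2_le by (intro add_left_mono mult_left_mono add_right_mono) (auto simp: mult.commute intro!: mult_right_mono)
  finally show "expectation (\<lambda>\<omega>. \<bar>U \<omega> + V \<omega>\<bar> powr q) \<le> \<dots>" .
qed

text \<open>Adding one summand changes the moment by a multiple of the moment of order
  \<open>q - 2\<close>, which should be of order \<open>n powr ((q - 2) / 2)\<close>; summing such
  increments gives \<open>n powr (q / 2)\<close>. The bound is uniform in the starting index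
  \<open>a\<close>, since it will be applied to blocks.\<close>

lemma sum_moment_bound:
  fixes Y :: "nat \<Rightarrow> 'a \<Rightarrow> real"
  assumes q: "q > 2" and indep: "indep_vars (\<lambda>_. borel) Y {1..}"
    and Y: "\<And>i. i \<ge> 1 \<Longrightarrow> integrable M (\<lambda>\<omega>. \<bar>Y i \<omega>\<bar> powr q)" "\<And>i. i \<ge> 1 \<Longrightarrow> expectation (\<lambda>\<omega>. \<bar>Y i \<omega>\<bar> powr q) \<le> \<beta>"
      "\<And>i. i \<ge> 1 \<Longrightarrow> expectation (Y i) = 0"
  obtains D where "D \<ge> 0" "\<And>a n. integrable M (\<lambda>\<omega>. \<bar>\<Sum>i\<in>{a<..a+n}. Y i \<omega>\<bar> powr q)"
    "\<And>a n. expectation (\<lambda>\<omega>. \<bar>\<Sum>i\<in>{a<..a+n}. Y i \<omega>\<bar> powr q) \<le> D * real n powr (q / 2)"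
proof -
  obtain C where C: "C \<ge> 0" "\<And>x y :: real. \<bar>x + y\<bar> powr q \<le> \<bar>x\<bar> powr q + q * (sgn x * \<bar>x\<bar> powr (q - 1)) * y
      + C * (\<bar>x\<bar> powr (q - 2) * y\<^sup>2 + \<bar>y\<bar> powr q)"
    using abs_powr_taylor[of q] q by auto
  have \<beta>: "\<beta> \<ge> 0"
    using order_trans[OF Bochner_Integration.integral_nonneg Y(2)[of 1]] by simp
  \<comment> \<open>Chosen so that interpolation feeds back at most half of \<open>u / n\<close>
    into the recursion.\<close>
  define \<theta> where "\<theta> = 1 / (2 * (C * (1 + \<beta>) + 1))"
  have \<theta>: "\<theta> > 0" "C * (1 + \<beta>) * \<theta> \<le> 1 / 2"
    using C \<beta> by (auto simp: \<theta>_def field_simps add_nonneg_pos intro!: divide_pos_pos mult_nonneg_nonneg) (auto simp: add_pos_nonneg add_nonneg_pos)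
  define C' where "C' = C * (1 + \<beta>) * \<theta> powr (- ((q - 2) / 2)) + C * \<beta>"
  have C': "C' \<ge> 0" using C \<beta> by (auto simp: C'_def)
  \<comment> \<open>\<open>2 * C'\<close> closes the induction step for \<open>n > 0\<close>; the
    summand \<open>\<beta>\<close> covers the step from the empty sum to one summand.\<close>
  define D where "D = 2 * C' + \<beta>"
  have D: "D \<ge> 0" "D \<ge> 2 * C'" "D \<ge> \<beta>" using C' \<beta> by (auto simp: D_def)
  have "integrable M (\<lambda>\<omega>. \<bar>\<Sum>i\<in>{a<..a+n}. Y i \<omega>\<bar> powr q) \<and>
      expectation (\<lambda>\<omega>. \<bar>\<Sum>i\<in>{a<..a+n}. Y i \<omega>\<bar> powr q) \<le> D * real n powr (q / 2)" for a n
  proof (induction n)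
    case (Suc n)
    define U where "U \<omega> = (\<Sum>i\<in>{a<..a+n}. Y i \<omega>)" for \<omega>
    define V where "V = Y (Suc (a + n))"
    define u where "u = expectation (\<lambda>\<omega>. \<bar>U \<omega>\<bar> powr q)"
    have sets: "{a<..a + Suc n} = insert (Suc (a + n)) {a<..a+n}" by auto
    have sum: "(\<Sum>i\<in>{a<..a + Suc n}. Y i \<omega>) = U \<omega> + V \<omega>" for \<omega>
      unfolding sets by (simp add: U_def V_def)
    have "indep_vars (\<lambda>_. borel) Y (insert (Suc (a + n)) {a<..a+n})"
      by (rule indep_vars_subset[OF indep]) auto
    then have iv: "indep_var borel V borel U"
      unfolding U_def V_def by (intro indep_vars_sum) auto
    have U: "integrable M (\<lambda>\<omega>. \<bar>U \<omega>\<bar> powr q)" "u \<le> D * real n powr (q / 2)"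
      using Suc.IH by (auto simp: U_def u_def)
    have V: "integrable M (\<lambda>\<omega>. \<bar>V \<omega>\<bar> powr q)" "expectation V = 0" "expectation (\<lambda>\<omega>. \<bar>V \<omega>\<bar> powr q) \<le> \<beta>"
      using Y by (auto simp: V_def)
    note step = abs_sum_powr_step[OF q C iv U(1) V(1,2)]
    have "expectation (\<lambda>\<omega>. \<bar>U \<omega> + V \<omega>\<bar> powr q) \<le> D * real (Suc n) powr (q / 2)"
    proof (cases "n = 0")
      case True
      then have "U = (\<lambda>_. 0)" by (simp add: U_def fun_eq_iff)
      then show ?thesis using V D True by simp
    next
      case False
      then have n: "real n \<ge> 1" by simp
      have [measurable]: "U \<in> borel_measurable M" using iv by (rule indep_var_rv2)
      have n_powr: "real n powr ((q - 2) / 2) * real n = real n powr (q / 2)"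
        using n powr_add[of "real n" "(q - 2) / 2" 1] by (simp add: field_simps)
      have n_powr1: "1 \<le> real n powr ((q - 2) / 2)" using n q by (intro ge_one_powr_ge_zero) auto
      have Uq2: "integrable M (\<lambda>\<omega>. \<bar>U \<omega>\<bar> powr (q - 2))"
        using q by (intro integrable_abs_powr_le[OF U(1)]) auto
      \<comment> \<open>The interpolation parameter is of order \<open>1 / n\<close>: then the
        moment of order \<open>q\<close> re-enters only as \<open>u / n\<close>, and the constant
        term has the order \<open>n powr ((q - 2) / 2)\<close>.\<close>
      have "expectation (\<lambda>\<omega>. \<bar>U \<omega>\<bar> powr (q - 2)) \<le> expectation (\<lambda>\<omega>. \<theta> / n * \<bar>U \<omega>\<bar> powr q + (\<theta> / n) powr (- ((q - 2) / 2)))"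
        using Uq2 U \<theta> n q by (intro integral_mono powr_interpolate) auto
      also have "\<dots> = \<theta> / n * u + (\<theta> / n) powr (- ((q - 2) / 2))"
        using U by (simp add: u_def prob_space)
      also have "(\<theta> / n) powr (- ((q - 2) / 2)) = \<theta> powr (- ((q - 2) / 2)) * real n powr ((q - 2) / 2)"
        using \<theta> n by (simp add: powr_divide powr_minus field_simps)
      finally have W: "expectation (\<lambda>\<omega>. \<bar>U \<omega>\<bar> powr (q - 2)) \<le> \<theta> / n * u + \<theta> powr (- ((q - 2) / 2)) * real n powr ((q - 2) / 2)" .
      have u0: "u \<ge> 0" unfolding u_def by (rule Bochner_Integration.integral_nonneg) simp
      have "expectation (\<lambda>\<omega>. \<bar>U \<omega> + V \<omega>\<bar> powr q) \<le> u + C * (expectation (\<lambda>\<omega>. \<bar>U \<omega>\<bar> powr (q - 2)) * (1 + \<beta>) + \<beta>)"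
        by (rule order_trans[OF step(2)[folded u_def]])
          (use C V(3) in \<open>auto intro!: add_left_mono mult_left_mono add_mono Bochner_Integration.integral_nonneg\<close>)
      also have "\<dots> \<le> u + C * ((\<theta> / n * u + \<theta> powr (- ((q - 2) / 2)) * real n powr ((q - 2) / 2)) * (1 + \<beta>) + \<beta> * real n powr ((q - 2) / 2))"
        using W C \<beta> n_powr1 mult_left_mono[OF n_powr1 \<beta>] by (intro add_left_mono mult_left_mono add_mono mult_right_mono) auto
      also have "\<dots> = u + (C * (1 + \<beta>) * \<theta>) * (u / n) + C' * real n powr ((q - 2) / 2)"
        by (simp add: C'_def algebra_simps add_divide_distrib)
      also have "\<dots> \<le> u + 1 / 2 * (u / n) + D / 2 * real n powr ((q - 2) / 2)"
        using \<theta> u0 n D by (intro add_mono mult_right_mono) auto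
      also have "\<dots> \<le> D * real n powr (q / 2) + 1 / 2 * (D * real n powr (q / 2) / n) + D / 2 * real n powr ((q - 2) / 2)"
        using U n D by (intro add_mono mult_left_mono divide_right_mono) auto
      \<comment> \<open>The two halves of \<open>D\<close> from the recursion add up to exactly one
        further unit, turning \<open>n\<close> into \<open>n + 1\<close>.\<close>
      also have "\<dots> = D * real n powr ((q - 2) / 2) * (real n + 1)"
        unfolding n_powr[symmetric] using n by (simp add: field_simps)
      also have "\<dots> \<le> D * (real n + 1) powr ((q - 2) / 2) * (real n + 1)"
        using D n q by (intro mult_right_mono mult_left_mono powr_mono2) auto
      also have "\<dots> = D * real (Suc n) powr (q / 2)"
        using n powr_add[of "real n + 1" "(q - 2) / 2" 1] by (simp add: field_simps)
      finally show ?thesis .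
    qed
    then show ?case using step(1) unfolding sum by blast
  qed simp
  with D show thesis using that by blast
qed

text \<open>The scalar bound is applied to each coordinate; the norm is at most the dimension times
  the largest coordinate, so only a constant is lost.\<close>

lemma vector_sum_moment_bound:
  fixes Y :: "nat \<Rightarrow> 'a \<Rightarrow> 'b::euclidean_space"
  assumes q: "q > 2" and indep: "indep_vars (\<lambda>_. borel) Y {1..}"
    and Y: "\<And>i. i \<ge> 1 \<Longrightarrow> integrable M (\<lambda>\<omega>. norm (Y i \<omega>) powr q)" "\<And>i. i \<ge> 1 \<Longrightarrow> expectation (\<lambda>\<omega>. norm (Y i \<omega>) powr q) \<le> \<beta>"
      "\<And>i. i \<ge> 1 \<Longrightarrow> expectation (Y i) = 0"
  obtains D where "D \<ge> 0" "\<And>a n. integrable M (\<lambda>\<omega>. norm (\<Sum>i\<in>{a<..a+n}. Y i \<omega>) powr q)"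
    "\<And>a n. expectation (\<lambda>\<omega>. norm (\<Sum>i\<in>{a<..a+n}. Y i \<omega>) powr q) \<le> D * real n powr (q / 2)"
proof -
  have Ym: "Y i \<in> borel_measurable M" if "i \<ge> 1" for i
    using indep that by (auto simp: indep_vars_def)
  have Yint: "integrable M (Y i)" if "i \<ge> 1" for i
  proof -
    have "integrable M (\<lambda>\<omega>. \<bar>norm (Y i \<omega>)\<bar> powr 1)"
    proof (rule integrable_abs_powr_le)
      show "integrable M (\<lambda>\<omega>. \<bar>norm (Y i \<omega>)\<bar> powr q)" using Y(1)[OF that] by simp
      show "(\<lambda>\<omega>. norm (Y i \<omega>)) \<in> borel_measurable M" using Ym[OF that] by simp
    qed (use q in simp_all)
    then have "integrable M (\<lambda>\<omega>. norm (Y i \<omega>))" by simp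
    then show ?thesis using Ym[OF that] by (simp add: integrable_norm_iff)
  qed
  have "\<exists>D\<ge>0. (\<forall>a n. integrable M (\<lambda>\<omega>. \<bar>\<Sum>i\<in>{a<..a+n}. Y i \<omega> \<bullet> b\<bar> powr q)) \<and>
      (\<forall>a n. expectation (\<lambda>\<omega>. \<bar>\<Sum>i\<in>{a<..a+n}. Y i \<omega> \<bullet> b\<bar> powr q) \<le> D * real n powr (q / 2))"
    if b: "b \<in> Basis" for b
  proof -
    have le: "\<bar>x \<bullet> b\<bar> powr q \<le> norm x powr q" for x :: 'b
      using b q by (intro powr_mono2) (auto simp: Basis_le_norm)
    have int: "integrable M (\<lambda>\<omega>. \<bar>Y i \<omega> \<bullet> b\<bar> powr q)" if "i \<ge> 1" for i
      by (rule Bochner_Integration.integrable_bound[OF Y(1)[OF that]]) (use le Ym[OF that] in auto)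
    have "indep_vars (\<lambda>_. borel) (\<lambda>i. (\<lambda>x. x \<bullet> b) \<circ> Y i) {1..}"
      using indep by (rule indep_vars_compose) simp
    then have "indep_vars (\<lambda>_. borel) (\<lambda>i \<omega>. Y i \<omega> \<bullet> b) {1..}" by (simp add: o_def)
    then show ?thesis
    proof (rule sum_moment_bound[OF q, of _ \<beta>])
      show "expectation (\<lambda>\<omega>. \<bar>Y i \<omega> \<bullet> b\<bar> powr q) \<le> \<beta>" if "i \<ge> 1" for i
        by (rule order_trans[OF integral_mono Y(2)[OF that]]) (use int Y(1) that le in auto)
      show "expectation (\<lambda>\<omega>. Y i \<omega> \<bullet> b) = 0" if "i \<ge> 1" for i
        using Yint[OF that] Y(3)[OF that] by simp
    qed (use int in auto)
  qed
  then obtain D where D: "\<And>b. b \<in> Basis \<Longrightarrow> D b \<ge> 0"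
      "\<And>b a n. b \<in> Basis \<Longrightarrow> integrable M (\<lambda>\<omega>. \<bar>\<Sum>i\<in>{a<..a+n}. Y i \<omega> \<bullet> b\<bar> powr q)"
      "\<And>b a n. b \<in> Basis \<Longrightarrow> expectation (\<lambda>\<omega>. \<bar>\<Sum>i\<in>{a<..a+n}. Y i \<omega> \<bullet> b\<bar> powr q) \<le> D b * real n powr (q / 2)"
    by metis
  let ?d = "real DIM('b)"
  have le: "norm x powr q \<le> ?d powr q * (\<Sum>b\<in>Basis. \<bar>x \<bullet> b\<bar> powr q)" for x :: 'b
  proof -
    obtain b where b: "b \<in> Basis" "\<And>b'. b' \<in> Basis \<Longrightarrow> \<bar>x \<bullet> b'\<bar> \<le> \<bar>x \<bullet> b\<bar>"
    proof -
      have "Max ((\<lambda>b. \<bar>x \<bullet> b\<bar>) ` Basis) \<in> (\<lambda>b. \<bar>x \<bullet> b\<bar>) ` Basis"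
        by (intro Max_in) auto
      then obtain b where b: "b \<in> Basis" "Max ((\<lambda>b. \<bar>x \<bullet> b\<bar>) ` Basis) = \<bar>x \<bullet> b\<bar>"
        by (rule imageE)
      have "\<bar>x \<bullet> b'\<bar> \<le> \<bar>x \<bullet> b\<bar>" if "b' \<in> Basis" for b'
        unfolding b(2)[symmetric] using that by (intro Max_ge) auto
      with b(1) show thesis by (rule that)
    qed
    have "norm x \<le> (\<Sum>b\<in>Basis. \<bar>x \<bullet> b\<bar>)" by (rule norm_le_l1)
    also have "\<dots> \<le> ?d * \<bar>x \<bullet> b\<bar>" using sum_bounded_above[of Basis "\<lambda>b. \<bar>x \<bullet> b\<bar>"] b by simp
    finally have "norm x powr q \<le> (?d * \<bar>x \<bullet> b\<bar>) powr q" using q by (intro powr_mono2) auto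
    also have "\<dots> = ?d powr q * \<bar>x \<bullet> b\<bar> powr q" by (simp add: powr_mult)
    also have "\<dots> \<le> ?d powr q * (\<Sum>b\<in>Basis. \<bar>x \<bullet> b\<bar> powr q)"
      using b by (intro mult_left_mono member_le_sum) auto
    finally show ?thesis .
  qed
  have m: "(\<lambda>\<omega>. \<Sum>i\<in>{a<..a+n}. Y i \<omega>) \<in> borel_measurable M" for a n
    by (intro borel_measurable_sum Ym) auto
  have int': "integrable M (\<lambda>\<omega>. ?d powr q * (\<Sum>b\<in>Basis. \<bar>(\<Sum>i\<in>{a<..a+n}. Y i \<omega>) \<bullet> b\<bar> powr q))" for a n
    using D(2) by (intro integrable_mult_right Bochner_Integration.integrable_sum) (simp add: inner_sum_left)
  have int: "integrable M (\<lambda>\<omega>. norm (\<Sum>i\<in>{a<..a+n}. Y i \<omega>) powr q)" for a n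
    by (rule Bochner_Integration.integrable_bound[OF int'[of a n]])
      (use le m in \<open>auto intro!: AE_I2 order_trans[OF _ abs_ge_self]\<close>)
  have "expectation (\<lambda>\<omega>. norm (\<Sum>i\<in>{a<..a+n}. Y i \<omega>) powr q) \<le> (?d powr q * (\<Sum>b\<in>Basis. D b)) * real n powr (q / 2)" for a n
  proof -
    have "expectation (\<lambda>\<omega>. norm (\<Sum>i\<in>{a<..a+n}. Y i \<omega>) powr q) \<le>
        expectation (\<lambda>\<omega>. ?d powr q * (\<Sum>b\<in>Basis. \<bar>(\<Sum>i\<in>{a<..a+n}. Y i \<omega>) \<bullet> b\<bar> powr q))"
      by (intro integral_mono int int' le)
    also have "\<dots> = ?d powr q * (\<Sum>b\<in>Basis. expectation (\<lambda>\<omega>. \<bar>\<Sum>i\<in>{a<..a+n}. Y i \<omega> \<bullet> b\<bar> powr q))"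
      using D(2) by (simp add: inner_sum_left)
    also have "\<dots> \<le> ?d powr q * (\<Sum>b\<in>Basis. D b * real n powr (q / 2))"
      using D(3) by (intro mult_left_mono sum_mono) auto
    finally show ?thesis by (simp add: sum_distrib_right mult.assoc)
  qed
  moreover have "?d powr q * (\<Sum>b\<in>Basis. D b) \<ge> 0"
    using D(1) by (intro mult_nonneg_nonneg sum_nonneg) auto
  ultimately show thesis using that int by blast
qed

end

section \<open>Maxima of partial sums\<close>

definition max_norm_sum :: "(nat \<Rightarrow> 'c \<Rightarrow> 'b::real_normed_vector) \<Rightarrow> nat \<Rightarrow> nat \<Rightarrow> 'c \<Rightarrow> real" where
  "max_norm_sum Y a n \<omega> = Max ((\<lambda>k. norm (\<Sum>i\<in>{a<..a+k}. Y i \<omega>)) ` {..n})"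

lemma max_norm_sum_ge: "k \<le> n \<Longrightarrow> norm (\<Sum>i\<in>{a<..a+k}. Y i \<omega>) \<le> max_norm_sum Y a n \<omega>"
  unfolding max_norm_sum_def by (intro Max_ge) auto

lemma max_norm_sum_le_iff: "max_norm_sum Y a n \<omega> \<le> c \<longleftrightarrow> (\<forall>k\<le>n. norm (\<Sum>i\<in>{a<..a+k}. Y i \<omega>) \<le> c)"
  unfolding max_norm_sum_def by (subst Max_le_iff) auto

lemma max_norm_sum_nonneg: "0 \<le> max_norm_sum Y a n \<omega>"
  using max_norm_sum_ge[where k = 0 and n = n and Y = Y and a = a and \<omega> = \<omega>] by simp

lemma max_norm_sum_mono: "m \<le> n \<Longrightarrow> max_norm_sum Y a m \<omega> \<le> max_norm_sum Y a n \<omega>"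
  by (auto simp: max_norm_sum_le_iff intro: max_norm_sum_ge)

text \<open>A partial sum reaching into the second half is the sum of the whole first half plus a
  partial sum of the second. The two maxima enter through their maximum, not their sum, which is
  essential for the doubling recursion.\<close>

lemma max_norm_sum_double:
  "max_norm_sum Y a (n + n) \<omega> \<le> norm (\<Sum>i\<in>{a<..a+n}. Y i \<omega>) + max (max_norm_sum Y a n \<omega>) (max_norm_sum Y (a + n) n \<omega>)"
  unfolding max_norm_sum_le_iff
proof (intro allI impI)
  fix k assume k: "k \<le> n + n"
  show "norm (\<Sum>i\<in>{a<..a+k}. Y i \<omega>) \<le> norm (\<Sum>i\<in>{a<..a+n}. Y i \<omega>) + max (max_norm_sum Y a n \<omega>) (max_norm_sum Y (a + n) n \<omega>)"
  proof (cases "k \<le> n")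
    case True
    then show ?thesis using max_norm_sum_ge[OF True, where Y = Y and a = a and \<omega> = \<omega>]
      by (intro add_increasing) auto
  next
    case False
    define l where "l = k - n"
    have l: "k = n + l" "l \<le> n" using k False by (auto simp: l_def)
    have "{a<..a+k} = {a<..a+n} \<union> {a+n<..(a+n)+l}" using l by auto
    then have "(\<Sum>i\<in>{a<..a+k}. Y i \<omega>) = (\<Sum>i\<in>{a<..a+n}. Y i \<omega>) + (\<Sum>i\<in>{a+n<..(a+n)+l}. Y i \<omega>)"
      by (simp add: sum.union_disjoint)
    then have "norm (\<Sum>i\<in>{a<..a+k}. Y i \<omega>) \<le> norm (\<Sum>i\<in>{a<..a+n}. Y i \<omega>) + norm (\<Sum>i\<in>{a+n<..(a+n)+l}. Y i \<omega>)"
      using norm_triangle_ineq by simp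
    then show ?thesis using max_norm_sum_ge[OF l(2), where Y = Y and a = "a + n" and \<omega> = \<omega>] by simp
  qed
qed

text \<open>The factor in front of \<open>c powr q\<close> can be brought as close to 1 as desired,
  at the price of a large factor for \<open>b\<close>. A convexity bound with factor
  \<open>2 powr (q - 1)\<close> would be too coarse for the doubling recursion.\<close>

lemma add_powr_le:
  fixes b c \<eta> q :: real
  assumes "b \<ge> 0" "c \<ge> 0" "\<eta> > 0" "q \<ge> 0"
  shows "(b + c) powr q \<le> (1 + \<eta>) powr q * c powr q + (1 + 1 / \<eta>) powr q * b powr q"
proof (cases "b \<le> \<eta> * c")
  case True
  then have "(b + c) powr q \<le> ((1 + \<eta>) * c) powr q"
    using assms by (intro powr_mono2) (auto simp: algebra_simps)
  then show ?thesis using assms by (simp add: powr_mult add_increasing2)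
next
  case False
  then have "c \<le> b / \<eta>" using assms by (simp add: field_simps)
  then have "(b + c) powr q \<le> ((1 + 1 / \<eta>) * b) powr q"
    using assms by (intro powr_mono2) (auto simp: algebra_simps)
  then show ?thesis using assms by (simp add: powr_mult add_increasing)
qed

context prob_space
begin

text \<open>
  Splitting the walk in the middle, \<open>E max\<^sup>q\<close> at most doubles up to a term of the order \<open>n powr (q / 2)\<close>
  when \<open>n\<close> is doubled, and \<open>2 < 2 powr (q / 2)\<close>.
\<close>

lemma max_norm_sum_moment_bound:
  fixes Y :: "nat \<Rightarrow> 'a \<Rightarrow> 'b::euclidean_space"
  assumes q: "q > 2" and indep: "indep_vars (\<lambda>_. borel) Y {1..}"
    and Y: "\<And>i. i \<ge> 1 \<Longrightarrow> integrable M (\<lambda>\<omega>. norm (Y i \<omega>) powr q)" "\<And>i. i \<ge> 1 \<Longrightarrow> expectation (\<lambda>\<omega>. norm (Y i \<omega>) powr q) \<le> \<beta>"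
      "\<And>i. i \<ge> 1 \<Longrightarrow> expectation (Y i) = 0"
  obtains D where "D \<ge> 0" "\<And>a n. max_norm_sum Y a n \<in> borel_measurable M"
    "\<And>a n. integrable M (\<lambda>\<omega>. max_norm_sum Y a n \<omega> powr q)"
    "\<And>a n. expectation (\<lambda>\<omega>. max_norm_sum Y a n \<omega> powr q) \<le> D * real n powr (q / 2)"
proof -
  obtain D1 where D1: "D1 \<ge> 0" "\<And>a n. integrable M (\<lambda>\<omega>. norm (\<Sum>i\<in>{a<..a+n}. Y i \<omega>) powr q)"
    "\<And>a n. expectation (\<lambda>\<omega>. norm (\<Sum>i\<in>{a<..a+n}. Y i \<omega>) powr q) \<le> D1 * real n powr (q / 2)"
    using vector_sum_moment_bound[OF q indep Y] by blast
  have Ym: "Y i \<in> borel_measurable M" if "i \<ge> 1" for i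
    using indep that by (auto simp: indep_vars_def)
  have meas: "max_norm_sum Y a n \<in> borel_measurable M" for a n
    unfolding max_norm_sum_def using Ym
    by (intro borel_measurable_Max borel_measurable_norm borel_measurable_sum) auto
  have int: "integrable M (\<lambda>\<omega>. max_norm_sum Y a n \<omega> powr q)" for a n
  proof (rule Bochner_Integration.integrable_bound)
    show "integrable M (\<lambda>\<omega>. \<Sum>k\<le>n. norm (\<Sum>i\<in>{a<..a+k}. Y i \<omega>) powr q)"
      by (intro Bochner_Integration.integrable_sum D1)
    have "max_norm_sum Y a n \<omega> powr q \<le> (\<Sum>k\<le>n. norm (\<Sum>i\<in>{a<..a+k}. Y i \<omega>) powr q)" for \<omega>
    proof -
      have "max_norm_sum Y a n \<omega> \<in> (\<lambda>k. norm (\<Sum>i\<in>{a<..a+k}. Y i \<omega>)) ` {..n}"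
        unfolding max_norm_sum_def by (intro Max_in) auto
      then obtain k where k: "k \<le> n" "max_norm_sum Y a n \<omega> = norm (\<Sum>i\<in>{a<..a+k}. Y i \<omega>)" by auto
      then show ?thesis
        using member_le_sum[of k "{..n}" "\<lambda>k. norm (\<Sum>i\<in>{a<..a+k}. Y i \<omega>) powr q"] by simp
    qed
    then show "AE \<omega> in M. norm (max_norm_sum Y a n \<omega> powr q) \<le> norm (\<Sum>k\<le>n. norm (\<Sum>i\<in>{a<..a+k}. Y i \<omega>) powr q)"
      by (auto intro!: AE_I2 order_trans[OF _ abs_ge_self])
  qed (use meas in measurable)
  have "((\<lambda>\<eta>. 2 * (1 + \<eta>) powr q) \<longlongrightarrow> 2 * (1 + 0) powr q) (at_right 0)"
    by (intro tendsto_intros) auto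
  moreover have "2 * (1 + 0) powr q < 2 powr (q / 2)"
    using q powr_less_mono[of 1 "q / 2" 2] by simp
  ultimately have "eventually (\<lambda>\<eta>. 2 * (1 + \<eta>) powr q < 2 powr (q / 2)) (at_right 0)"
    by (rule order_tendstoD(2))
  then obtain b where b: "b > 0" "\<And>\<eta>. 0 < \<eta> \<Longrightarrow> \<eta> < b \<Longrightarrow> 2 * (1 + \<eta>) powr q < 2 powr (q / 2)"
    unfolding eventually_at_right_field by auto
  define \<eta> where "\<eta> = b / 2"
  have \<eta>: "\<eta> > 0" using b by (simp add: \<eta>_def)
  \<comment> \<open>The gap left after doubling: bounding a maximum of two powers by their sum costs
    2, splitting off the middle sum costs \<open>(1 + \<eta>) powr q\<close>. \<open>D\<close> is so
    large that \<open>D * \<gamma>\<close> absorbs the contribution of the middle sum; its summand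
    \<open>D1\<close> serves blocks of length one.\<close>
  define \<gamma> where "\<gamma> = 2 powr (q / 2) - 2 * (1 + \<eta>) powr q"
  have \<gamma>: "\<gamma> > 0" using b by (simp add: \<eta>_def \<gamma>_def)
  define D where "D = (1 + 1 / \<eta>) powr q * D1 / \<gamma> + D1"
  have D: "D \<ge> 0" "D \<ge> D1" "(1 + 1 / \<eta>) powr q * D1 \<le> D * \<gamma>"
    using D1 \<gamma> by (auto simp: D_def field_simps)
  have dyadic: "expectation (\<lambda>\<omega>. max_norm_sum Y a (2 ^ k) \<omega> powr q) \<le> D * real (2 ^ k) powr (q / 2)" for a k
  proof (induction k arbitrary: a)
    case 0
    have "max_norm_sum Y a 1 \<omega> = norm (\<Sum>i\<in>{a<..a+1}. Y i \<omega>)" for \<omega>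
      using max_norm_sum_ge[where k = 1 and n = 1 and Y = Y and a = a and \<omega> = \<omega>]
      by (intro antisym) (auto simp: max_norm_sum_le_iff le_Suc_eq)
    then show ?case using D1(3)[of a 1] D by simp
  next
    case (Suc k)
    define n where "n = (2::nat) ^ k"
    let ?A = "\<lambda>\<omega>. max_norm_sum Y a n \<omega>" and ?B = "\<lambda>\<omega>. max_norm_sum Y (a + n) n \<omega>" and ?S = "\<lambda>\<omega>. norm (\<Sum>i\<in>{a<..a+n}. Y i \<omega>)"
    have "max_norm_sum Y a (n + n) \<omega> powr q \<le> (1 + \<eta>) powr q * (?A \<omega> powr q + ?B \<omega> powr q) + (1 + 1 / \<eta>) powr q * ?S \<omega> powr q" for \<omega>
    proof -
      have "max_norm_sum Y a (n + n) \<omega> powr q \<le> (?S \<omega> + max (?A \<omega>) (?B \<omega>)) powr q"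
        using q by (intro powr_mono2 max_norm_sum_double max_norm_sum_nonneg) auto
      also have "\<dots> \<le> (1 + \<eta>) powr q * max (?A \<omega>) (?B \<omega>) powr q + (1 + 1 / \<eta>) powr q * ?S \<omega> powr q"
        using \<eta> q max_norm_sum_nonneg[of Y a n \<omega>] by (intro add_powr_le) auto
      also have "max (?A \<omega>) (?B \<omega>) powr q \<le> ?A \<omega> powr q + ?B \<omega> powr q"
        by (auto simp: max_def)
      finally show ?thesis by (simp add: mult_left_mono)
    qed
    then have "expectation (\<lambda>\<omega>. max_norm_sum Y a (n + n) \<omega> powr q) \<le>
        expectation (\<lambda>\<omega>. (1 + \<eta>) powr q * (?A \<omega> powr q + ?B \<omega> powr q) + (1 + 1 / \<eta>) powr q * ?S \<omega> powr q)"
      by (intro integral_mono int Bochner_Integration.integrable_add integrable_mult_right D1)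
    also have "\<dots> = (1 + \<eta>) powr q * (expectation (\<lambda>\<omega>. ?A \<omega> powr q) + expectation (\<lambda>\<omega>. ?B \<omega> powr q)) + (1 + 1 / \<eta>) powr q * expectation (\<lambda>\<omega>. ?S \<omega> powr q)"
      using int D1 by simp
    also have "\<dots> \<le> (1 + \<eta>) powr q * (D * real n powr (q / 2) + D * real n powr (q / 2)) + (1 + 1 / \<eta>) powr q * (D1 * real n powr (q / 2))"
      using Suc.IH[of a, folded n_def] Suc.IH[of "a + n", folded n_def] D1(3)[of a n]
      by (intro add_mono mult_left_mono) auto
    also have "\<dots> = (D * (2 * (1 + \<eta>) powr q) + (1 + 1 / \<eta>) powr q * D1) * real n powr (q / 2)"
      by (simp add: algebra_simps)
    also have "\<dots> \<le> (D * (2 * (1 + \<eta>) powr q) + D * \<gamma>) * real n powr (q / 2)"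
      using D by (intro mult_right_mono) auto
    also have "\<dots> = D * (2 * real n) powr (q / 2)"
      unfolding \<gamma>_def by (simp add: powr_mult right_diff_distrib)
    also have "2 * real n = real (n + n)" by simp
    finally have "expectation (\<lambda>\<omega>. max_norm_sum Y a (n + n) \<omega> powr q) \<le> D * real (n + n) powr (q / 2)" .
    moreover have "n + n = 2 ^ Suc k" by (simp add: n_def)
    ultimately show ?case by metis
  qed
  have "expectation (\<lambda>\<omega>. max_norm_sum Y a n \<omega> powr q) \<le> (D * 2 powr (q / 2)) * real n powr (q / 2)" for a n
  proof (cases "n = 0")
    case True
    then have "max_norm_sum Y a n = (\<lambda>_. 0)" by (simp add: max_norm_sum_def fun_eq_iff)
    then show ?thesis using True by simp
  next
    case False
    \<comment> \<open>The least power of two above \<open>n\<close> is at most \<open>2 * n\<close>,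
      so passing to it costs only the factor \<open>2 powr (q / 2)\<close>.\<close>
    define k where "k = (LEAST k. n \<le> 2 ^ k)"
    have k: "n \<le> 2 ^ k" unfolding k_def by (rule LeastI[of _ n]) (simp add: less_imp_le)
    have k2: "2 ^ k \<le> 2 * n"
    proof (cases k)
      case 0
      then show ?thesis using False by simp
    next
      case (Suc j)
      then have "\<not> n \<le> 2 ^ j" using not_less_Least[of j "\<lambda>k. n \<le> 2 ^ k"] by (simp add: k_def)
      then show ?thesis using Suc by simp
    qed
    have "expectation (\<lambda>\<omega>. max_norm_sum Y a n \<omega> powr q) \<le> expectation (\<lambda>\<omega>. max_norm_sum Y a (2 ^ k) \<omega> powr q)"
      using q k by (intro integral_mono int powr_mono2 max_norm_sum_mono max_norm_sum_nonneg) auto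
    also have "\<dots> \<le> D * real (2 ^ k) powr (q / 2)" by (rule dyadic)
    also have "\<dots> \<le> D * (2 * real n) powr (q / 2)"
    proof (intro mult_left_mono powr_mono2)
      show "real (2 ^ k) \<le> 2 * real n"
        using k2 by (metis of_nat_le_iff of_nat_mult of_nat_numeral)
    qed (use D q in auto)
    finally show ?thesis by (simp add: powr_mult)
  qed
  then show thesis using that[of "D * 2 powr (q / 2)"] D meas int by auto
qed

end

subsection \<open>Uniform weak convergence from characteristic functions\<close>

text \<open>The density of the centred Gaussian law with covariance \<open>\<sigma>\<^sup>2\<close>
  times the identity, written as a product so that Lebesgue integrals factor over the
  coordinates.\<close>

definition gaussian_kernel :: "real \<Rightarrow> 'a::euclidean_space \<Rightarrow> real" where
  "gaussian_kernel \<sigma> z = (\<Prod>b\<in>Basis. normal_density 0 \<sigma> (z \<bullet> b))"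

lemma gaussian_kernel_nonneg [simp]: "gaussian_kernel \<sigma> z \<ge> 0"
  unfolding gaussian_kernel_def by (intro prod_nonneg) simp

lemma measurable_gaussian_kernel [measurable]: "gaussian_kernel \<sigma> \<in> borel_measurable borel"
  unfolding gaussian_kernel_def by measurable

lemma gaussian_kernel_eq:
  assumes "(\<sigma>::real) > 0"
  obtains c where "\<And>z :: 'a::euclidean_space. gaussian_kernel \<sigma> z = c * exp (- (norm ((1 / \<sigma>) *\<^sub>R z))\<^sup>2 / 2)"
proof -
  let ?c = "(\<Prod>b\<in>(Basis::'a set). 1 / sqrt (2 * pi * \<sigma>\<^sup>2))"
  have "gaussian_kernel \<sigma> z = ?c * exp (- (norm ((1 / \<sigma>) *\<^sub>R z))\<^sup>2 / 2)" for z :: 'a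
  proof -
    have "gaussian_kernel \<sigma> z = (\<Prod>b\<in>(Basis::'a set). 1 / sqrt (2 * pi * \<sigma>\<^sup>2)) * (\<Prod>b\<in>Basis. exp (- (z \<bullet> b)\<^sup>2 / (2 * \<sigma>\<^sup>2)))"
      unfolding gaussian_kernel_def normal_density_def prod.distrib[symmetric] by simp
    also have "(\<Prod>b\<in>Basis. exp (- (z \<bullet> b)\<^sup>2 / (2 * \<sigma>\<^sup>2))) = exp (\<Sum>b\<in>Basis. - (z \<bullet> b)\<^sup>2 / (2 * \<sigma>\<^sup>2))"
      by (simp add: exp_sum)
    also have "(\<Sum>b\<in>Basis. - (z \<bullet> b)\<^sup>2 / (2 * \<sigma>\<^sup>2)) = - (norm ((1 / \<sigma>) *\<^sub>R z))\<^sup>2 / 2"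
    proof -
      have "(\<Sum>b\<in>Basis. (z \<bullet> b)\<^sup>2) = (norm z)\<^sup>2"
        by (simp add: power2_norm_eq_inner euclidean_inner[of z z] flip: power2_eq_square)
      then show ?thesis by (simp add: sum_negf power_divide flip: sum_divide_distrib)
    qed
    finally show ?thesis .
  qed
  then show thesis by (rule that)
qed

text \<open>A Gaussian is its own Fourier transform up to scaling. The constant may stay abstract,
  being the same for all measures that are compared.\<close>

lemma gaussian_kernel_cf:
  assumes "(\<sigma>::real) > 0"
  obtains c where "\<And>z :: 'a::euclidean_space.
    complex_of_real (gaussian_kernel \<sigma> z) = c * (CLINT g|gaussian_coords. iexp (gaussian_vector g \<bullet> ((1 / \<sigma>) *\<^sub>R z)))"
proof -
  obtain c where c: "\<And>z :: 'a. gaussian_kernel \<sigma> z = c * exp (- (norm ((1 / \<sigma>) *\<^sub>R z))\<^sup>2 / 2)"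
    using gaussian_kernel_eq[OF assms] by blast
  show thesis
    by (rule that[of "complex_of_real c"]) (simp only: gaussian_vector_cf c of_real_mult)
qed

lemma nn_integral_gaussian_kernel:
  assumes "(\<sigma>::real) > 0"
  shows "(\<integral>\<^sup>+z. gaussian_kernel \<sigma> (z :: 'a::euclidean_space) \<partial>lborel) = 1"
proof -
  have 1: "(\<integral>\<^sup>+x. normal_density 0 \<sigma> x \<partial>lborel) = 1"
    using assms by (subst nn_integral_eq_integral) (auto simp: integral_normal_density)
  have "(\<integral>\<^sup>+z. gaussian_kernel \<sigma> (z :: 'a) \<partial>lborel) = (\<integral>\<^sup>+z. (\<Prod>b\<in>Basis. ennreal (normal_density 0 \<sigma> ((z::'a) \<bullet> b))) \<partial>lborel)"
    by (simp add: gaussian_kernel_def prod_ennreal)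
  also have "\<dots> = (\<Prod>b\<in>(Basis::'a set). (\<integral>\<^sup>+x. normal_density 0 \<sigma> x \<partial>lborel))"
    by (rule nn_integral_lborel_prod) auto
  finally show ?thesis by (simp add: 1)
qed

lemma nn_integral_gaussian_kernel_inner_sq:
  assumes \<sigma>: "(\<sigma>::real) > 0" and b: "b \<in> (Basis :: 'a::euclidean_space set)"
  shows "(\<integral>\<^sup>+z. ennreal ((z \<bullet> b)\<^sup>2 * gaussian_kernel \<sigma> (z :: 'a)) \<partial>lborel) = ennreal (\<sigma>\<^sup>2)"
proof -
  have 1: "(\<integral>\<^sup>+x. normal_density 0 \<sigma> x \<partial>lborel) = 1"
    using assms by (subst nn_integral_eq_integral) (auto simp: integral_normal_density)
  have 2: "(\<integral>\<^sup>+x. ennreal (x\<^sup>2 * normal_density 0 \<sigma> x) \<partial>lborel) = ennreal (\<sigma>\<^sup>2)"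
    using normal_moment_even[OF \<sigma>, of 0 1]
    by (subst nn_integral_eq_integral) (auto simp: has_bochner_integral_iff mult.commute fact_numeral power_divide)
  define f where "f b' x = ennreal ((if b' = b then x\<^sup>2 else 1) * normal_density 0 \<sigma> x)" for b' x
  have "(\<integral>\<^sup>+z. ennreal ((z \<bullet> b)\<^sup>2 * gaussian_kernel \<sigma> (z :: 'a)) \<partial>lborel) = (\<integral>\<^sup>+z. (\<Prod>b'\<in>Basis. f b' ((z::'a) \<bullet> b')) \<partial>lborel)"
  proof (intro nn_integral_cong)
    fix z :: 'a
    have "(\<Prod>b'\<in>Basis. f b' (z \<bullet> b')) = ennreal (\<Prod>b'\<in>Basis. (if b' = b then (z \<bullet> b')\<^sup>2 else 1) * normal_density 0 \<sigma> (z \<bullet> b'))"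
      unfolding f_def by (rule prod_ennreal) simp
    also have "(\<Prod>b'\<in>Basis. (if b' = b then (z \<bullet> b')\<^sup>2 else 1) * normal_density 0 \<sigma> (z \<bullet> b')) = (z \<bullet> b)\<^sup>2 * gaussian_kernel \<sigma> z"
      using b by (simp add: prod.distrib gaussian_kernel_def)
    finally show "ennreal ((z \<bullet> b)\<^sup>2 * gaussian_kernel \<sigma> z) = (\<Prod>b'\<in>Basis. f b' (z \<bullet> b'))" by simp
  qed
  also have "\<dots> = (\<Prod>b'\<in>Basis. (\<integral>\<^sup>+x. f b' x \<partial>lborel))"
    by (rule nn_integral_lborel_prod) (auto simp: f_def)
  also have "\<dots> = (\<Prod>b'\<in>Basis. if b' = b then ennreal (\<sigma>\<^sup>2) else 1)"
    by (intro prod.cong) (auto simp: f_def 1 2)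
  also have "\<dots> = ennreal (\<sigma>\<^sup>2)" using b by simp
  finally show ?thesis .
qed

lemma nn_integral_lborel_shift:
  fixes x :: "'a::euclidean_space"
  assumes [measurable]: "f \<in> borel_measurable borel"
  shows "(\<integral>\<^sup>+w. f (w - x) \<partial>lborel) = (\<integral>\<^sup>+z. f z \<partial>lborel)"
proof -
  have "(\<integral>\<^sup>+z. f z \<partial>lborel) = (\<integral>\<^sup>+z. f z \<partial>distr lborel borel ((+) (- x)))"
    by (simp add: lborel_distr_plus)
  also have "\<dots> = (\<integral>\<^sup>+w. f (- x + w) \<partial>lborel)"
    by (rule nn_integral_distr) auto
  finally show ?thesis by simp
qed

lemma gaussian_kernel_shift:
  fixes x :: "'a::euclidean_space"
  assumes "(\<sigma>::real) > 0"
  shows "integrable lborel (\<lambda>w. gaussian_kernel \<sigma> (w - x))" "(\<integral>w. gaussian_kernel \<sigma> (w - x) \<partial>lborel) = 1"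
proof -
  have nn: "(\<integral>\<^sup>+w. gaussian_kernel \<sigma> (w - x) \<partial>lborel) = 1"
    using nn_integral_lborel_shift[of "\<lambda>z. ennreal (gaussian_kernel \<sigma> z)" x] nn_integral_gaussian_kernel[OF assms] by simp
  then show "integrable lborel (\<lambda>w. gaussian_kernel \<sigma> (w - x))"
    by (intro integrableI_nonneg) auto
  show "(\<integral>w. gaussian_kernel \<sigma> (w - x) \<partial>lborel) = 1"
    by (subst integral_eq_nn_integral) (auto simp: nn)
qed

lemma gaussian_kernel_shift_second_moment:
  fixes x :: "'a::euclidean_space"
  assumes \<sigma>: "(\<sigma>::real) > 0"
  shows "integrable lborel (\<lambda>w. (norm (w - x))\<^sup>2 * gaussian_kernel \<sigma> (w - x))"
    "(\<integral>w. (norm (w - x))\<^sup>2 * gaussian_kernel \<sigma> (w - x) \<partial>lborel) = real DIM('a) * \<sigma>\<^sup>2"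
proof -
  have "(\<integral>\<^sup>+w. ennreal ((norm (w - x))\<^sup>2 * gaussian_kernel \<sigma> (w - x)) \<partial>lborel) =
      (\<integral>\<^sup>+z. ennreal ((norm z)\<^sup>2 * gaussian_kernel \<sigma> (z::'a)) \<partial>lborel)"
    by (rule nn_integral_lborel_shift) measurable
  also have "\<dots> = (\<integral>\<^sup>+z. (\<Sum>b\<in>Basis. ennreal ((z \<bullet> b)\<^sup>2 * gaussian_kernel \<sigma> (z::'a))) \<partial>lborel)"
    by (intro nn_integral_cong)
      (simp add: power2_norm_eq_inner euclidean_inner[of z z for z] sum_distrib_right flip: power2_eq_square)
  also have "\<dots> = (\<Sum>b\<in>(Basis::'a set). ennreal (\<sigma>\<^sup>2))"
    by (subst nn_integral_sum) (auto simp: nn_integral_gaussian_kernel_inner_sq[OF \<sigma>])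
  also have "\<dots> = ennreal (real DIM('a) * \<sigma>\<^sup>2)"
    by (simp add: ennreal_mult ennreal_of_nat_eq_real_of_nat)
  finally have nn: "(\<integral>\<^sup>+w. ennreal ((norm (w - x))\<^sup>2 * gaussian_kernel \<sigma> (w - x)) \<partial>lborel) = ennreal (real DIM('a) * \<sigma>\<^sup>2)" .
  then show "integrable lborel (\<lambda>w. (norm (w - x))\<^sup>2 * gaussian_kernel \<sigma> (w - x))"
    by (intro integrableI_nonneg) auto
  show "(\<integral>w. (norm (w - x))\<^sup>2 * gaussian_kernel \<sigma> (w - x) \<partial>lborel) = real DIM('a) * \<sigma>\<^sup>2"
    by (subst integral_eq_nn_integral) (auto simp: nn)
qed

section \<open>Convolution with a Gaussian kernel\<close>

definition smoothed_density :: "real \<Rightarrow> 'a::euclidean_space measure \<Rightarrow> 'a \<Rightarrow> real" where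
  "smoothed_density \<sigma> P w = (\<integral>x. gaussian_kernel \<sigma> (w - x) \<partial>P)"

lemma gaussian_kernel_bounded:
  assumes "(\<sigma>::real) > 0"
  obtains B where "\<And>z :: 'a::euclidean_space. gaussian_kernel \<sigma> z \<le> B"
proof -
  obtain c where c: "\<And>z :: 'a. gaussian_kernel \<sigma> z = c * exp (- (norm ((1 / \<sigma>) *\<^sub>R z))\<^sup>2 / 2)"
    using gaussian_kernel_eq[OF assms] by blast
  have "gaussian_kernel \<sigma> z \<le> \<bar>c\<bar> * 1" for z :: 'a
    unfolding c by (intro mult_mono) auto
  then show thesis by (rule that)
qed

lemma integrable_gaussian_kernel_prob:
  fixes P :: "'a::euclidean_space measure"
  assumes P: "prob_space P" "sets P = sets borel" and "(\<sigma>::real) > 0"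
  shows "integrable P (\<lambda>x. gaussian_kernel \<sigma> (w - x))"
proof -
  interpret prob_space P by fact
  obtain B where B: "\<And>z :: 'a. gaussian_kernel \<sigma> z \<le> B"
    using gaussian_kernel_bounded[OF \<open>\<sigma> > 0\<close>] by blast
  note [measurable_cong] = P(2)
  show ?thesis
    by (rule integrable_const_bound[of _ B]) (auto simp: B)
qed

lemma smoothed_density_nonneg [simp]: "smoothed_density \<sigma> P w \<ge> 0"
  unfolding smoothed_density_def by (intro Bochner_Integration.integral_nonneg) simp

lemma measurable_smoothed_density:
  fixes P :: "'a::euclidean_space measure"
  assumes P: "prob_space P" "sets P = sets borel"
  shows "smoothed_density \<sigma> P \<in> borel_measurable borel"
proof -
  interpret prob_space P by fact
  note [measurable_cong] = P(2)
  show ?thesis unfolding smoothed_density_def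
    by (intro borel_measurable_lebesgue_integral) measurable
qed

lemma nn_integral_smoothed_density:
  fixes P :: "'a::euclidean_space measure"
  assumes P: "prob_space P" "sets P = sets borel" and \<sigma>: "(\<sigma>::real) > 0"
  shows "(\<integral>\<^sup>+w. smoothed_density \<sigma> P w \<partial>lborel) = 1"
proof -
  interpret P: prob_space P by fact
  interpret pair_sigma_finite P lborel ..
  note [measurable_cong] = P(2)
  have "(\<integral>\<^sup>+w. smoothed_density \<sigma> P w \<partial>lborel) = (\<integral>\<^sup>+w. (\<integral>\<^sup>+x. gaussian_kernel \<sigma> (w - x) \<partial>P) \<partial>lborel)"
    unfolding smoothed_density_def
    by (intro nn_integral_cong nn_integral_eq_integral[symmetric] integrable_gaussian_kernel_prob P \<sigma>) auto
  also have "\<dots> = (\<integral>\<^sup>+x. (\<integral>\<^sup>+w. gaussian_kernel \<sigma> (w - x) \<partial>lborel) \<partial>P)"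
    by (rule Fubini') measurable
  also have "\<dots> = (\<integral>\<^sup>+x. 1 \<partial>P)"
    using nn_integral_gaussian_kernel[OF \<sigma>, where 'a='a]
    by (intro nn_integral_cong) (subst nn_integral_lborel_shift[of "\<lambda>z. ennreal (gaussian_kernel \<sigma> z)"], auto)
  also have "\<dots> = 1" by (simp add: P.emeasure_space_1)
  finally show ?thesis .
qed

text \<open>Writing the kernel as a Gaussian average of exponentials and exchanging integrals
  expresses the smoothed density at a point as an average of the characteristic function. The
  integrand is bounded by 1, so dominated convergence applies.\<close>

lemma smoothed_density_tendsto:
  fixes P :: "nat \<Rightarrow> 'a::euclidean_space measure" and Q :: "'a measure"
  assumes P: "\<And>n. prob_space (P n)" "\<And>n. sets (P n) = sets borel"
    and Q: "prob_space Q" "sets Q = sets borel"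
    and cf: "\<And>t. (\<lambda>n. CLINT x|P n. iexp (t \<bullet> x)) \<longlonglongrightarrow> (CLINT x|Q. iexp (t \<bullet> x))"
    and \<sigma>: "(\<sigma>::real) > 0"
  shows "(\<lambda>n. smoothed_density \<sigma> (P n) w) \<longlonglongrightarrow> smoothed_density \<sigma> Q w"
proof -
  let ?\<Gamma> = "gaussian_coords :: ('a \<Rightarrow> real) measure" and ?G = "gaussian_vector :: _ \<Rightarrow> 'a"
  interpret G: prob_space ?\<Gamma> by (rule prob_space_gaussian_coords)
  obtain c where c: "\<And>z :: 'a. complex_of_real (gaussian_kernel \<sigma> z) =
      c * (CLINT g|?\<Gamma>. iexp (?G g \<bullet> ((1 / \<sigma>) *\<^sub>R z)))"
    using gaussian_kernel_cf[OF \<sigma>] by blast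
  have rep: "complex_of_real (smoothed_density \<sigma> R w) =
      c * (CLINT g|?\<Gamma>. iexp (?G g \<bullet> ((1 / \<sigma>) *\<^sub>R w)) * (CLINT x|R. iexp ((- (1 / \<sigma>) *\<^sub>R ?G g) \<bullet> x)))"
    if R: "prob_space R" "sets R = sets borel" for R
  proof -
    interpret R: prob_space R by fact
    note [measurable_cong] = R(2)
    interpret pair_prob_space ?\<Gamma> R ..
    let ?f = "\<lambda>g x. iexp (?G g \<bullet> ((1 / \<sigma>) *\<^sub>R (w - x)))"
    have int: "integrable (?\<Gamma> \<Otimes>\<^sub>M R) (case_prod ?f)"
      by (rule P.integrable_const_bound[of _ 1]) auto
    have "complex_of_real (smoothed_density \<sigma> R w) = (CLINT x|R. complex_of_real (gaussian_kernel \<sigma> (w - x)))"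
      unfolding smoothed_density_def by simp
    also have "\<dots> = c * (CLINT x|R. CLINT g|?\<Gamma>. ?f g x)"
      unfolding c by simp
    also have "(CLINT x|R. CLINT g|?\<Gamma>. ?f g x) = (CLINT g|?\<Gamma>. CLINT x|R. ?f g x)"
      by (rule Fubini_integral[OF int])
    also have "\<dots> = (CLINT g|?\<Gamma>. iexp (?G g \<bullet> ((1 / \<sigma>) *\<^sub>R w)) * (CLINT x|R. iexp ((- (1 / \<sigma>) *\<^sub>R ?G g) \<bullet> x)))"
      by (simp add: inner_diff_right right_diff_distrib exp_add[symmetric] diff_divide_distrib exp_diff exp_minus field_simps flip: integral_mult_right_zero)
    finally show ?thesis .
  qed
  have "(\<lambda>n. complex_of_real (smoothed_density \<sigma> (P n) w)) \<longlonglongrightarrow> complex_of_real (smoothed_density \<sigma> Q w)"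
    unfolding rep[OF P] rep[OF Q]
  proof (intro tendsto_mult_left integral_dominated_convergence[where w = "\<lambda>_. 1"])
    have meas: "(\<lambda>g. iexp (?G g \<bullet> ((1 / \<sigma>) *\<^sub>R w)) * (CLINT x|R. iexp ((- (1 / \<sigma>) *\<^sub>R ?G g) \<bullet> x))) \<in> borel_measurable ?\<Gamma>"
      and bound: "norm (iexp (?G g \<bullet> ((1 / \<sigma>) *\<^sub>R w)) * (CLINT x|R. iexp ((- (1 / \<sigma>) *\<^sub>R ?G g) \<bullet> x))) \<le> 1"
      if R: "prob_space R" "sets R = sets borel" for R g
    proof -
      interpret R: prob_space R by fact
      note [measurable_cong] = R(2)
      show "(\<lambda>g. iexp (?G g \<bullet> ((1 / \<sigma>) *\<^sub>R w)) * (CLINT x|R. iexp ((- (1 / \<sigma>) *\<^sub>R ?G g) \<bullet> x))) \<in> borel_measurable ?\<Gamma>"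
        by (intro borel_measurable_times R.borel_measurable_lebesgue_integral) measurable
      have "norm (CLINT x|R. iexp ((- (1 / \<sigma>) *\<^sub>R ?G g) \<bullet> x)) \<le> (\<integral>x. norm (iexp ((- (1 / \<sigma>) *\<^sub>R ?G g) \<bullet> x)) \<partial>R)"
        by (rule integral_norm_bound)
      also have "\<dots> = 1" by (simp add: R.prob_space)
      finally show "norm (iexp (?G g \<bullet> ((1 / \<sigma>) *\<^sub>R w)) * (CLINT x|R. iexp ((- (1 / \<sigma>) *\<^sub>R ?G g) \<bullet> x))) \<le> 1"
        by (simp add: norm_mult)
    qed
    show "(\<lambda>g. iexp (?G g \<bullet> ((1 / \<sigma>) *\<^sub>R w)) * (CLINT x|Q. iexp ((- (1 / \<sigma>) *\<^sub>R ?G g) \<bullet> x))) \<in> borel_measurable ?\<Gamma>"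
      by (rule meas[OF Q])
    show "(\<lambda>g. iexp (?G g \<bullet> ((1 / \<sigma>) *\<^sub>R w)) * (CLINT x|P n. iexp ((- (1 / \<sigma>) *\<^sub>R ?G g) \<bullet> x))) \<in> borel_measurable ?\<Gamma>" for n
      by (rule meas[OF P])
    show "AE g in ?\<Gamma>. norm (iexp (?G g \<bullet> ((1 / \<sigma>) *\<^sub>R w)) * (CLINT x|P n. iexp ((- (1 / \<sigma>) *\<^sub>R ?G g) \<bullet> x))) \<le> 1" for n
      by (intro AE_I2 bound P)
    show "AE g in ?\<Gamma>. (\<lambda>n. iexp (?G g \<bullet> ((1 / \<sigma>) *\<^sub>R w)) * (CLINT x|P n. iexp ((- (1 / \<sigma>) *\<^sub>R ?G g) \<bullet> x)))
        \<longlonglongrightarrow> iexp (?G g \<bullet> ((1 / \<sigma>) *\<^sub>R w)) * (CLINT x|Q. iexp ((- (1 / \<sigma>) *\<^sub>R ?G g) \<bullet> x))"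
      by (intro AE_I2 tendsto_mult_left cf)
  qed simp
  then show ?thesis by (simp only: tendsto_of_real_iff)
qed

text \<open>Scheffe's lemma: all these densities have total mass 1, so pointwise convergence
  improves to convergence in mean.\<close>

lemma smoothed_density_L1_tendsto:
  fixes P :: "nat \<Rightarrow> 'a::euclidean_space measure" and Q :: "'a measure"
  assumes P: "\<And>n. prob_space (P n)" "\<And>n. sets (P n) = sets borel"
    and Q: "prob_space Q" "sets Q = sets borel"
    and cf: "\<And>t. (\<lambda>n. CLINT x|P n. iexp (t \<bullet> x)) \<longlonglongrightarrow> (CLINT x|Q. iexp (t \<bullet> x))"
    and \<sigma>: "(\<sigma>::real) > 0"
  shows "(\<lambda>n. \<integral>\<^sup>+w. norm (smoothed_density \<sigma> (P n) w - smoothed_density \<sigma> Q w) \<partial>lborel) \<longlonglongrightarrow> 0"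
proof (rule Scheffe_lemma2)
  show "smoothed_density \<sigma> (P n) \<in> borel_measurable lborel" for n
    using measurable_smoothed_density[OF P] by simp
  show "integrable lborel (smoothed_density \<sigma> Q)"
    using measurable_smoothed_density[OF Q] nn_integral_smoothed_density[OF Q \<sigma>]
    by (intro integrableI_nonneg) auto
  show "AE w in lborel. (\<lambda>n. smoothed_density \<sigma> (P n) w) \<longlonglongrightarrow> smoothed_density \<sigma> Q w"
    by (intro AE_I2 smoothed_density_tendsto assms)
  show "(\<integral>\<^sup>+w. norm (smoothed_density \<sigma> (P n) w) \<partial>lborel) \<le> (\<integral>\<^sup>+w. norm (smoothed_density \<sigma> Q w) \<partial>lborel)" for n
    using nn_integral_smoothed_density[OF P \<sigma>] nn_integral_smoothed_density[OF Q \<sigma>] by simp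
qed

lemma smoothed_density_integrable:
  fixes P :: "'a::euclidean_space measure"
  assumes P: "prob_space P" "sets P = sets borel" and \<sigma>: "(\<sigma>::real) > 0"
  shows "integrable lborel (smoothed_density \<sigma> P)"
  using measurable_smoothed_density[OF P] nn_integral_smoothed_density[OF P \<sigma>]
  by (intro integrableI_nonneg) auto

text \<open>By Fubini, smoothing the measure is the same as averaging the test function over the
  kernel centred at \<open>x\<close>. Points within \<open>\<delta>\<close> contribute
  \<open>\<eta>\<close>; farther ones contribute at most 2 times their mass, estimated by
  Chebyshev's inequality.\<close>

lemma smoothing_error:
  fixes P :: "'a::euclidean_space measure"
  assumes P: "prob_space P" "sets P = sets borel" and \<sigma>: "(\<sigma>::real) > 0"
    and g: "g \<in> borel_measurable borel" "\<And>x. \<bar>g x\<bar> \<le> 1"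
    and osc: "\<And>x y. dist x y \<le> \<delta> \<Longrightarrow> \<bar>g x - g y\<bar> \<le> \<eta>" and \<delta>: "\<delta> > 0" and \<eta>: "\<eta> \<ge> 0"
  shows "\<bar>(\<integral>x. g x \<partial>P) - (\<integral>w. g w * smoothed_density \<sigma> P w \<partial>lborel)\<bar> \<le> \<eta> + 2 / \<delta>\<^sup>2 * (real DIM('a) * \<sigma>\<^sup>2)"
proof -
  interpret R: prob_space P by fact
  interpret pair_sigma_finite lborel P ..
  note [measurable_cong] = P(2)
  note [measurable] = g(1)
  let ?K = "\<lambda>w x. gaussian_kernel \<sigma> (w - x)"
  let ?h = "\<lambda>x. \<integral>w. g w * ?K w x \<partial>lborel"
  have intw: "integrable lborel (\<lambda>w. f w * ?K w x)" if "f \<in> borel_measurable borel" "\<And>w. \<bar>f w\<bar> \<le> B" for f :: "'a \<Rightarrow> real" and x B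
  proof (rule Bochner_Integration.integrable_bound)
    show "integrable lborel (\<lambda>w. B * ?K w x)"
      by (intro integrable_mult_right gaussian_kernel_shift \<sigma>)
    show "AE w in lborel. norm (f w * ?K w x) \<le> norm (B * ?K w x)"
      using that(2) by (intro AE_I2) (auto simp: abs_mult intro!: mult_right_mono order_trans[OF _ abs_ge_self])
  qed (use that in measurable)
  have int2: "integrable (lborel \<Otimes>\<^sub>M P) (\<lambda>(w, x). g w * ?K w x)"
  proof (rule integrableI_bounded)
    have "(\<integral>\<^sup>+z. ennreal (norm (case z of (w, x) \<Rightarrow> g w * ?K w x)) \<partial>(lborel \<Otimes>\<^sub>M P)) \<le>
        (\<integral>\<^sup>+z. ennreal (case z of (w, x) \<Rightarrow> ?K w x) \<partial>(lborel \<Otimes>\<^sub>M P))"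
      using g(2) by (intro nn_integral_mono) (auto simp: abs_mult split: prod.split intro!: mult_left_le_one_le)
    also have "\<dots> = (\<integral>\<^sup>+w. (\<integral>\<^sup>+x. ?K w x \<partial>P) \<partial>lborel)"
      using R.nn_integral_fst[of "\<lambda>z. ennreal (gaussian_kernel \<sigma> (fst z - snd z))" lborel]
      by (simp add: split_def)
    also have "\<dots> = (\<integral>\<^sup>+w. smoothed_density \<sigma> P w \<partial>lborel)"
      unfolding smoothed_density_def
      by (intro nn_integral_cong nn_integral_eq_integral integrable_gaussian_kernel_prob P \<sigma>) auto
    also have "\<dots> < \<infinity>" by (simp add: nn_integral_smoothed_density[OF P \<sigma>])
    finally show "(\<integral>\<^sup>+z. ennreal (norm (case z of (w, x) \<Rightarrow> g w * ?K w x)) \<partial>(lborel \<Otimes>\<^sub>M P)) < \<infinity>" .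
  qed measurable
  have "(\<integral>w. g w * smoothed_density \<sigma> P w \<partial>lborel) = (\<integral>w. (\<integral>x. g w * ?K w x \<partial>P) \<partial>lborel)"
    by (simp add: smoothed_density_def)
  also have "\<dots> = (\<integral>x. ?h x \<partial>P)"
    by (rule Fubini_integral[symmetric, OF int2])
  finally have eq: "(\<integral>w. g w * smoothed_density \<sigma> P w \<partial>lborel) = (\<integral>x. ?h x \<partial>P)" .
  have pointwise: "\<bar>g x - ?h x\<bar> \<le> \<eta> + 2 / \<delta>\<^sup>2 * (real DIM('a) * \<sigma>\<^sup>2)" for x
  proof -
    have i1: "integrable lborel (\<lambda>w. (g x - g w) * ?K w x)"
    proof (rule intw[of _ 2])
      show "\<bar>g x - g w\<bar> \<le> 2" for w using g(2)[of x] g(2)[of w] by linarith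
    qed measurable
    have i2: "integrable lborel (\<lambda>w. g x * ?K w x)" "integrable lborel (\<lambda>w. g w * ?K w x)"
      using g(2) by (auto intro!: intw[of _ 1] integrable_mult_right gaussian_kernel_shift \<sigma>)
    have i3: "integrable lborel (\<lambda>w. \<eta> * ?K w x + 2 / \<delta>\<^sup>2 * ((norm (w - x))\<^sup>2 * ?K w x))"
      using \<sigma> by (intro Bochner_Integration.integrable_add integrable_mult_right gaussian_kernel_shift gaussian_kernel_shift_second_moment)
    have "g x - ?h x = (\<integral>w. g x * ?K w x \<partial>lborel) - ?h x"
      using gaussian_kernel_shift[OF \<sigma>, of x] by simp
    also have "\<dots> = (\<integral>w. (g x - g w) * ?K w x \<partial>lborel)"
      by (subst Bochner_Integration.integral_diff[symmetric, OF i2]) (simp add: algebra_simps)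
    finally have "\<bar>g x - ?h x\<bar> \<le> (\<integral>w. \<bar>(g x - g w) * ?K w x\<bar> \<partial>lborel)"
      using integral_abs_bound[of lborel "\<lambda>w. (g x - g w) * ?K w x"] by simp
    also have "\<dots> \<le> (\<integral>w. \<eta> * ?K w x + 2 / \<delta>\<^sup>2 * ((norm (w - x))\<^sup>2 * ?K w x) \<partial>lborel)"
    proof (intro integral_mono integrable_abs i1 i3)
      fix w
      have "\<bar>g x - g w\<bar> \<le> \<eta> + 2 / \<delta>\<^sup>2 * (norm (w - x))\<^sup>2"
      proof (cases "dist x w \<le> \<delta>")
        case True
        then show ?thesis using osc[OF True] by (simp add: add_increasing2)
      next
        case False
        then have "\<delta>\<^sup>2 \<le> (norm (w - x))\<^sup>2"
          using \<delta> by (intro power_mono) (auto simp: dist_norm norm_minus_commute)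
        then have "2 \<le> 2 / \<delta>\<^sup>2 * (norm (w - x))\<^sup>2" using \<delta> by (simp add: field_simps)
        moreover have "\<bar>g x - g w\<bar> \<le> 2" using g(2)[of x] g(2)[of w] by linarith
        ultimately show ?thesis using \<eta> by linarith
      qed
      then have "\<bar>g x - g w\<bar> * ?K w x \<le> (\<eta> + 2 / \<delta>\<^sup>2 * (norm (w - x))\<^sup>2) * ?K w x"
        by (intro mult_right_mono) auto
      then show "\<bar>(g x - g w) * ?K w x\<bar> \<le> \<eta> * ?K w x + 2 / \<delta>\<^sup>2 * ((norm (w - x))\<^sup>2 * ?K w x)"
        by (simp add: abs_mult distrib_right mult.assoc)
    qed
    also have "\<dots> = \<eta> + 2 / \<delta>\<^sup>2 * (real DIM('a) * \<sigma>\<^sup>2)"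
      using gaussian_kernel_shift[OF \<sigma>, of x] gaussian_kernel_shift_second_moment[OF \<sigma>, of x]
      by (subst Bochner_Integration.integral_add) auto
    finally show ?thesis .
  qed
  have ig: "integrable P g" using g by (intro R.integrable_const_bound[of _ 1]) auto
  have ih: "integrable P ?h" using integrable_snd[OF int2] by simp
  have "\<bar>(\<integral>x. g x \<partial>P) - (\<integral>x. ?h x \<partial>P)\<bar> = \<bar>\<integral>x. g x - ?h x \<partial>P\<bar>"
    using ig ih by simp
  also have "\<dots> \<le> (\<integral>x. \<bar>g x - ?h x\<bar> \<partial>P)" by (rule integral_abs_bound)
  also have "\<dots> \<le> (\<integral>x. \<eta> + 2 / \<delta>\<^sup>2 * (real DIM('a) * \<sigma>\<^sup>2) \<partial>P)"
    using ig ih pointwise by (intro integral_mono integrable_abs) auto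
  also have "\<dots> = \<eta> + 2 / \<delta>\<^sup>2 * (real DIM('a) * \<sigma>\<^sup>2)" by (simp add: R.prob_space)
  finally show ?thesis by (simp add: eq)
qed

text \<open>One error bound for a whole class of test functions. This is what makes the notion
  stable under products, where the test function in one coordinate varies with the other
  coordinates.\<close>

definition measures_close :: "real \<Rightarrow> real \<Rightarrow> real \<Rightarrow> 'a::metric_space measure \<Rightarrow> 'a measure \<Rightarrow> bool" where
  "measures_close \<epsilon> \<delta> \<eta> P Q \<longleftrightarrow> (\<forall>g\<in>borel_measurable borel. (\<forall>x. \<bar>g x\<bar> \<le> 1) \<longrightarrow>
     (\<forall>x y. dist x y \<le> \<delta> \<longrightarrow> \<bar>g x - g y\<bar> \<le> \<eta>) \<longrightarrow> \<bar>(\<integral>x. g x \<partial>P) - (\<integral>x. g x \<partial>Q)\<bar> \<le> \<epsilon>)"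

lemma measures_closeD:
  assumes "measures_close \<epsilon> \<delta> \<eta> P Q" "g \<in> borel_measurable borel" "\<And>x. \<bar>g x\<bar> \<le> 1"
    "\<And>x y. dist x y \<le> \<delta> \<Longrightarrow> \<bar>g x - g y\<bar> \<le> \<eta>"
  shows "\<bar>(\<integral>x. g x \<partial>P) - (\<integral>x. g x \<partial>Q)\<bar> \<le> \<epsilon>"
  using assms(1)[unfolded measures_close_def, rule_format, of g] assms(2-4) by simp

text \<open>
  Convergence of characteristic functions gives \<open>L\<^sup>1\<close> convergence of the densities smoothed by a
  Gaussian kernel, hence convergence of integrals that is uniform over all test functions with a
  common bound and modulus of continuity.
\<close>

lemma measures_close_eventually:
  fixes P :: "nat \<Rightarrow> 'a::euclidean_space measure" and Q :: "'a measure"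
  assumes P: "\<And>n. prob_space (P n)" "\<And>n. sets (P n) = sets borel"
    and Q: "prob_space Q" "sets Q = sets borel"
    and cf: "\<And>t. (\<lambda>n. CLINT x|P n. iexp (t \<bullet> x)) \<longlonglongrightarrow> (CLINT x|Q. iexp (t \<bullet> x))"
    and \<delta>: "\<delta> > 0" and \<eta>: "\<eta> > 0"
  shows "eventually (\<lambda>n. measures_close (5 * \<eta>) \<delta> \<eta> (P n) Q) sequentially"
proof -
  \<comment> \<open>Makes the Chebyshev term of \<open>smoothing_error\<close> equal to
    \<open>\<eta>\<close>. Each of the two measures then costs \<open>2 * \<eta>\<close>, and the
    difference of the smoothed densities one more \<open>\<eta>\<close>.\<close>
  define \<sigma> where "\<sigma> = sqrt (\<eta> * \<delta>\<^sup>2 / (2 * DIM('a)))"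
  have \<sigma>: "(\<sigma>::real) > 0" "2 / \<delta>\<^sup>2 * (real DIM('a) * \<sigma>\<^sup>2) = \<eta>"
    using \<delta> \<eta> by (auto simp: \<sigma>_def)
  let ?D = "\<lambda>n w. smoothed_density \<sigma> (P n) w - smoothed_density \<sigma> Q w"
  have D: "integrable lborel (?D n)" for n
    by (intro Bochner_Integration.integrable_diff smoothed_density_integrable P Q \<sigma>)
  have "eventually (\<lambda>n. (\<integral>\<^sup>+w. norm (?D n w) \<partial>lborel) < ennreal \<eta>) sequentially"
    using smoothed_density_L1_tendsto[OF P Q cf \<sigma>(1)] \<eta> by (intro order_tendstoD(2)) auto
  then show ?thesis
  proof eventually_elim
    case (elim n)
    have "(\<integral>\<^sup>+w. norm (?D n w) \<partial>lborel) = ennreal (\<integral>w. norm (?D n w) \<partial>lborel)"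
      using D by (intro nn_integral_eq_integral) auto
    then have L1: "(\<integral>w. norm (?D n w) \<partial>lborel) \<le> \<eta>"
      using elim \<eta> by (simp add: ennreal_less_iff)
    show ?case unfolding measures_close_def
    proof (intro ballI impI)
      fix g :: "'a \<Rightarrow> real" assume g: "g \<in> borel_measurable borel" "\<forall>x. \<bar>g x\<bar> \<le> 1"
        "\<forall>x y. dist x y \<le> \<delta> \<longrightarrow> \<bar>g x - g y\<bar> \<le> \<eta>"
      let ?I = "\<lambda>R. \<integral>w. g w * smoothed_density \<sigma> R w \<partial>lborel"
      have err: "\<bar>(\<integral>x. g x \<partial>R) - ?I R\<bar> \<le> \<eta> + \<eta>" if "prob_space R" "sets R = sets borel" for R
      proof -
        have "\<bar>(\<integral>x. g x \<partial>R) - ?I R\<bar> \<le> \<eta> + 2 / \<delta>\<^sup>2 * (real DIM('a) * \<sigma>\<^sup>2)"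
          using g \<eta> \<delta> by (intro smoothing_error that \<sigma>(1)) auto
        with \<sigma>(2) show ?thesis by simp
      qed
      have int: "integrable lborel (\<lambda>w. g w * f w)" if "integrable lborel f" for f
        by (rule Bochner_Integration.integrable_bound[OF that])
          (use g that in \<open>auto simp: abs_mult intro!: mult_left_le_one_le\<close>)
      have "\<bar>?I (P n) - ?I Q\<bar> = \<bar>\<integral>w. g w * ?D n w \<partial>lborel\<bar>"
        using int[OF smoothed_density_integrable[OF P \<sigma>(1)]] int[OF smoothed_density_integrable[OF Q \<sigma>(1)]]
        by (simp add: right_diff_distrib)
      also have "\<dots> \<le> (\<integral>w. \<bar>g w * ?D n w\<bar> \<partial>lborel)" by (rule integral_abs_bound)
      also have "\<dots> \<le> (\<integral>w. norm (?D n w) \<partial>lborel)"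
        using g(2) by (intro integral_mono integrable_abs int integrable_norm D) (auto simp: abs_mult intro!: mult_left_le_one_le)
      finally show "\<bar>(\<integral>x. g x \<partial>P n) - (\<integral>x. g x \<partial>Q)\<bar> \<le> 5 * \<eta>"
        using L1 err[OF P, of n] err[OF Q] by linarith
    qed
  qed
qed

text \<open>The coordinates are replaced one at a time.\<close>

lemma PiM_measures_close:
  fixes P Q :: "'i \<Rightarrow> 'a::{metric_space, second_countable_topology} measure"
  assumes "finite I"
    and P: "\<And>i. prob_space (P i)" "\<And>i. sets (P i) = sets borel"
    and Q: "\<And>i. prob_space (Q i)" "\<And>i. sets (Q i) = sets borel"
    and close: "\<And>i. i \<in> I \<Longrightarrow> measures_close \<epsilon> \<delta> \<eta> (P i) (Q i)"
    and g: "g \<in> borel_measurable (\<Pi>\<^sub>M i\<in>I. borel)" "\<And>x. \<bar>g x\<bar> \<le> 1"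
      "\<And>x i y z. x \<in> space (\<Pi>\<^sub>M i\<in>I. borel) \<Longrightarrow> i \<in> I \<Longrightarrow> dist y z \<le> \<delta> \<Longrightarrow> \<bar>g (x(i := y)) - g (x(i := z))\<bar> \<le> \<eta>"
  shows "\<bar>(\<integral>x. g x \<partial>PiM I P) - (\<integral>x. g x \<partial>PiM I Q)\<bar> \<le> real (card I) * \<epsilon>"
  using assms(1) close g
proof (induction I arbitrary: g rule: finite_induct)
  case empty
  have "PiM {} P = PiM {} Q" by (simp add: PiM_empty)
  then show ?case by simp
next
  case (insert j I)
  interpret P: product_prob_space P by (intro product_prob_spaceI P)
  interpret Q: product_prob_space Q by (intro product_prob_spaceI Q)
  interpret PI: prob_space "PiM I P" by (intro prob_space_PiM P)
  interpret QI: prob_space "PiM I Q" by (intro prob_space_PiM Q)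
  have sP: "sets (PiM J P) = sets (\<Pi>\<^sub>M i\<in>J. borel)" and sQ: "sets (PiM J Q) = sets (\<Pi>\<^sub>M i\<in>J. borel)" for J
    by (auto intro!: sets_PiM_cong P Q)
  note [measurable_cong] = P(2) Q(2)
  have gP: "integrable (PiM (insert j I) P) g" and gQ: "integrable (PiM (insert j I) Q) g"
  proof -
    interpret PI': prob_space "PiM (insert j I) P" by (intro prob_space_PiM P)
    interpret QI': prob_space "PiM (insert j I) Q" by (intro prob_space_PiM Q)
    show "integrable (PiM (insert j I) P) g"
      using insert.prems(2,3) by (intro PI'.integrable_const_bound[of _ 1]) (auto simp: measurable_cong_sets[OF sP refl])
    show "integrable (PiM (insert j I) Q) g"
      using insert.prems(2,3) by (intro QI'.integrable_const_bound[of _ 1]) (auto simp: measurable_cong_sets[OF sQ refl])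
  qed
  \<comment> \<open>Integrating out coordinate \<open>j\<close> under \<open>Q j\<close> preserves
    the bound 1 and the modulus in the remaining coordinates, so the induction hypothesis applies to
    \<open>G\<close>.\<close>
  define G where "G x = (\<integral>y. g (x(j := y)) \<partial>Q j)" for x
  have add_dim: "(\<lambda>(x, y). x(j := y)) \<in> (\<Pi>\<^sub>M i\<in>I. borel) \<Otimes>\<^sub>M borel \<rightarrow>\<^sub>M (\<Pi>\<^sub>M i\<in>insert j I. borel)"
    by (rule measurable_add_dim)
  have gpair: "(\<lambda>(x, y). g (x(j := y))) \<in> borel_measurable ((\<Pi>\<^sub>M i\<in>I. borel) \<Otimes>\<^sub>M borel)"
    using measurable_compose[OF add_dim insert.prems(2)] by (simp only: split_def)
  have Gm: "G \<in> borel_measurable (\<Pi>\<^sub>M i\<in>I. borel)"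
    unfolding G_def using gpair by (intro sigma_finite_measure.borel_measurable_lebesgue_integral[OF prob_space_imp_sigma_finite[OF Q(1)]]) (simp add: measurable_cong_sets[OF sets_pair_measure_cong[OF refl Q(2)] refl])
  have FPm: "(\<lambda>x. \<integral>y. g (x(j := y)) \<partial>P j) \<in> borel_measurable (\<Pi>\<^sub>M i\<in>I. borel)"
    using gpair by (intro sigma_finite_measure.borel_measurable_lebesgue_integral[OF prob_space_imp_sigma_finite[OF P(1)]]) (simp add: measurable_cong_sets[OF sets_pair_measure_cong[OF refl P(2)] refl])
  have bnd: "\<bar>\<integral>y. f y \<partial>R\<bar> \<le> 1" if "prob_space R" "\<And>y. \<bar>f y\<bar> \<le> 1" for f :: "'a \<Rightarrow> real" and R
  proof -
    interpret R: prob_space R by fact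
    show ?thesis
    \<comment> \<open>For a non-integrable function the integral is 0 by convention and satisfies
      the bound too; thus \<open>G\<close> is bounded at every \<open>x\<close>, also outside the
      space of the product measure.\<close>
    proof (cases "integrable R f")
      case True
      have "\<bar>\<integral>y. f y \<partial>R\<bar> \<le> (\<integral>y. \<bar>f y\<bar> \<partial>R)" by (rule integral_abs_bound)
      also have "\<dots> \<le> (\<integral>y. 1 \<partial>R)" using True that by (intro integral_mono integrable_abs) auto
      finally show ?thesis by (simp add: R.prob_space)
    qed (simp add: not_integrable_integral_eq)
  qed
  have gx: "(\<lambda>y. g (x(j := y))) \<in> borel_measurable borel" if "x \<in> space (\<Pi>\<^sub>M i\<in>I. borel)" for x
    using measurable_compose[OF measurable_Pair1'[OF that] gpair] by simp
  have "(\<integral>x. g x \<partial>PiM (insert j I) P) = (\<integral>x. (\<integral>y. g (x(j := y)) \<partial>P j) \<partial>PiM I P)"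
    by (rule P.product_integral_insert[OF insert.hyps gP])
  moreover have "(\<integral>x. g x \<partial>PiM (insert j I) Q) = (\<integral>x. G x \<partial>PiM I Q)"
    unfolding G_def by (rule Q.product_integral_insert[OF insert.hyps gQ])
  moreover have "\<bar>(\<integral>x. (\<integral>y. g (x(j := y)) \<partial>P j) \<partial>PiM I P) - (\<integral>x. G x \<partial>PiM I P)\<bar> \<le> \<epsilon>"
  proof -
    have i1: "integrable (PiM I P) (\<lambda>x. \<integral>y. g (x(j := y)) \<partial>P j)"
      using FPm bnd[OF P(1)] insert.prems(3) by (intro PI.integrable_const_bound[of _ 1]) (auto simp: measurable_cong_sets[OF sP refl])
    have i2: "integrable (PiM I P) G"
      using Gm bnd[OF Q(1)] insert.prems(3) by (intro PI.integrable_const_bound[of _ 1]) (auto simp: G_def measurable_cong_sets[OF sP refl])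
    have pt: "\<bar>(\<integral>y. g (x(j := y)) \<partial>P j) - G x\<bar> \<le> \<epsilon>" if x: "x \<in> space (PiM I P)" for x
    proof -
      have x: "x \<in> space (\<Pi>\<^sub>M i\<in>I. borel)" using x sets_eq_imp_space_eq[OF sP] by blast
      have "\<bar>g (x(j := y)) - g (x(j := z))\<bar> \<le> \<eta>" if "dist y z \<le> \<delta>" for y z
      proof -
        have "x(j := y) \<in> space (\<Pi>\<^sub>M i\<in>insert j I. borel)"
          using x by (auto simp: space_PiM PiE_iff extensional_def)
        from insert.prems(4)[OF this insertI1 that] show ?thesis by (simp add: fun_upd_def cong: if_cong)
      qed
      then show ?thesis
        unfolding G_def
        by (intro measures_closeD[OF insert.prems(1)[OF insertI1]] gx[OF x] insert.prems(3))
    qed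
    have "\<bar>(\<integral>x. (\<integral>y. g (x(j := y)) \<partial>P j) \<partial>PiM I P) - (\<integral>x. G x \<partial>PiM I P)\<bar> = \<bar>\<integral>x. (\<integral>y. g (x(j := y)) \<partial>P j) - G x \<partial>PiM I P\<bar>"
      using i1 i2 by simp
    also have "\<dots> \<le> (\<integral>x. \<bar>(\<integral>y. g (x(j := y)) \<partial>P j) - G x\<bar> \<partial>PiM I P)" by (rule integral_abs_bound)
    also have "\<dots> \<le> (\<integral>x. \<epsilon> \<partial>PiM I P)"
      using i1 i2 pt by (intro integral_mono integrable_abs) auto
    also have "\<dots> = \<epsilon>" by (simp add: PI.prob_space)
    finally show ?thesis .
  qed
  moreover have "\<bar>(\<integral>x. G x \<partial>PiM I P) - (\<integral>x. G x \<partial>PiM I Q)\<bar> \<le> real (card I) * \<epsilon>"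
  proof (rule insert.IH)
    show "\<bar>G x\<bar> \<le> 1" for x unfolding G_def by (intro bnd Q insert.prems)
    fix x :: "'i \<Rightarrow> 'a" and i and y z :: 'a assume x: "x \<in> space (\<Pi>\<^sub>M i\<in>I. borel)" and i: "i \<in> I" and yz: "dist y z \<le> \<delta>"
    have xi: "x(i := v) \<in> space (\<Pi>\<^sub>M i\<in>I. borel)" for v
      using x i by (auto simp: space_PiM PiE_iff extensional_def)
    have swap: "x(i := v, j := u) = (x(j := u))(i := v)" for u v
      using i insert.hyps by (auto simp: fun_eq_iff)
    have int: "integrable (Q j) (\<lambda>u. g (x(i := v, j := u)))" for v
      using gx[OF xi] insert.prems(3) by (intro finite_measure.integrable_const_bound[OF prob_space.finite_measure[OF Q(1)], where B = 1]) (auto simp: measurable_cong_sets[OF Q(2) refl])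
    have pt: "\<bar>g (x(i := y, j := u)) - g (x(i := z, j := u))\<bar> \<le> \<eta>" for u
      unfolding swap using x i yz
      by (intro insert.prems(4)) (auto simp: space_PiM PiE_iff extensional_def)
    have "\<bar>G (x(i := y)) - G (x(i := z))\<bar> = \<bar>\<integral>u. g (x(i := y, j := u)) - g (x(i := z, j := u)) \<partial>Q j\<bar>"
      unfolding G_def using int by simp
    also have "\<dots> \<le> (\<integral>u. \<bar>g (x(i := y, j := u)) - g (x(i := z, j := u))\<bar> \<partial>Q j)" by (rule integral_abs_bound)
    also have "\<dots> \<le> (\<integral>u. \<eta> \<partial>Q j)"
      using int pt by (intro integral_mono integrable_abs) auto
    also have "\<dots> = \<eta>" by (simp add: prob_space.prob_space[OF Q(1)])
    finally show "\<bar>G (x(i := y)) - G (x(i := z))\<bar> \<le> \<eta>" .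
  qed (use insert.prems Gm in auto)
  ultimately show ?case
    using insert.hyps by (simp add: algebra_simps)
qed

subsection \<open>The central limit theorem for blocks\<close>

lemma abs_exp_minus_le:
  fixes u :: real
  assumes "u \<ge> 0"
  shows "\<bar>exp (- u) - (1 - u)\<bar> \<le> u\<^sup>2"
proof -
  have "exp (- u) \<le> 1 / (1 + u)"
    using exp_ge_add_one_self[of u] assms by (simp add: exp_minus field_simps)
  also have "\<dots> \<le> 1 - u + u\<^sup>2"
  proof -
    have "0 \<le> u ^ 3" using assms by simp
    then show ?thesis using assms by (simp add: field_simps power2_eq_square power3_eq_cube)
  qed
  finally show ?thesis using exp_ge_add_one_self[of "- u"] by (simp add: abs_le_iff)
qed

text \<open>The comparison is with \<open>w n\<close>, whose powers are explicit exponentials. Both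
  numbers have modulus at most 1 and differ by o(1/n), hence their \<open>b n\<close>-th powers
  differ by o(1). Block lengths \<open>b n\<close> asymptotic to \<open>c * n\<close> are thus
  covered without rescaling.\<close>

lemma (in prob_space) char_power_tendsto:
  fixes X :: "'a \<Rightarrow> real" and b :: "nat \<Rightarrow> nat"
  assumes X [measurable]: "X \<in> borel_measurable M" and X2: "integrable M (\<lambda>\<omega>. (X \<omega>)\<^sup>2)"
    and X0: "expectation X = 0" and b: "(\<lambda>n. real (b n) / real n) \<longlonglongrightarrow> c"
  shows "(\<lambda>n. char (distr M borel X) (1 / sqrt (real n)) ^ b n) \<longlonglongrightarrow>
    complex_of_real (exp (- (c * expectation (\<lambda>\<omega>. (X \<omega>)\<^sup>2) / 2)))"
proof -
  define v where "v = expectation (\<lambda>\<omega>. (X \<omega>)\<^sup>2)"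
  have v: "v \<ge> 0" unfolding v_def by (rule Bochner_Integration.integral_nonneg) simp
  let ?\<phi> = "char (distr M borel X)"
  \<comment> \<open>The remainder of the second order expansion of a characteristic function. The
    minimum with the squared variable makes dominated convergence possible with two moments
    only.\<close>
  define e where "e n = expectation (\<lambda>\<omega>. min (6 * (X \<omega>)\<^sup>2) (\<bar>1 / sqrt (real n)\<bar> * \<bar>X \<omega>\<bar> ^ 3))" for n
  interpret D: real_distribution "distr M borel X" by (rule real_distribution_distr) simp
  have X1: "integrable M X" using square_integrable_imp_integrable[OF X X2] .
  have e_lim: "e \<longlonglongrightarrow> 0"
  proof -
    have "e \<longlonglongrightarrow> expectation (\<lambda>\<omega>. 0)"
      unfolding e_def
    proof (rule integral_dominated_convergence[where w = "\<lambda>\<omega>. 6 * (X \<omega>)\<^sup>2"])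
      show "AE \<omega> in M. (\<lambda>n. min (6 * (X \<omega>)\<^sup>2) (\<bar>1 / sqrt (real n)\<bar> * \<bar>X \<omega>\<bar> ^ 3)) \<longlonglongrightarrow> 0"
      proof (rule AE_I2)
        fix \<omega>
        have "(\<lambda>n. \<bar>1 / sqrt (real n)\<bar> * \<bar>X \<omega>\<bar> ^ 3) \<longlonglongrightarrow> 0"
          by real_asymp
        then have "(\<lambda>n. min (6 * (X \<omega>)\<^sup>2) (\<bar>1 / sqrt (real n)\<bar> * \<bar>X \<omega>\<bar> ^ 3)) \<longlonglongrightarrow> min (6 * (X \<omega>)\<^sup>2) 0"
          by (intro tendsto_intros)
        then show "(\<lambda>n. min (6 * (X \<omega>)\<^sup>2) (\<bar>1 / sqrt (real n)\<bar> * \<bar>X \<omega>\<bar> ^ 3)) \<longlonglongrightarrow> 0" by simp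
      qed
      show "AE \<omega> in M. norm (min (6 * (X \<omega>)\<^sup>2) (\<bar>1 / sqrt (real n)\<bar> * \<bar>X \<omega>\<bar> ^ 3)) \<le> 6 * (X \<omega>)\<^sup>2" for n
        by (intro AE_I2) (auto simp: min_def)
    qed (use X2 in auto)
    then show ?thesis by simp
  qed
  define w where "w n = complex_of_real (exp (- (v / (2 * real n))))" for n
  have w_pow: "w n ^ b n = complex_of_real (exp (- (real (b n) / real n * v / 2)))" for n
    unfolding w_def of_real_power[symmetric] exp_of_nat_mult[symmetric] by (simp add: field_simps)
  have w_lim: "(\<lambda>n. w n ^ b n) \<longlonglongrightarrow> complex_of_real (exp (- (c * v / 2)))"
    unfolding w_pow by (intro tendsto_intros b) simp
  have bound: "norm (?\<phi> (1 / sqrt (real n)) - w n) \<le> 1 / real n * (e n / 6 + v\<^sup>2 / (4 * real n))" if n: "n > 0" for n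
  proof -
    have s: "(1 / sqrt (real n))\<^sup>2 = 1 / real n" using n by (simp add: power_divide)
    have "norm (?\<phi> (1 / sqrt (real n)) - complex_of_real (1 - (1 / sqrt (real n))\<^sup>2 * v / 2))
        \<le> (1 / sqrt (real n))\<^sup>2 / 6 * e n"
      unfolding e_def by (rule char_approx3') (use X1 X2 X0 in \<open>auto simp: v_def\<close>)
    then have 1: "norm (?\<phi> (1 / sqrt (real n)) - complex_of_real (1 - v / (2 * real n))) \<le> 1 / real n * (e n / 6)"
      unfolding s by (simp add: mult.commute)
    have "norm (complex_of_real (1 - v / (2 * real n)) - w n) = \<bar>exp (- (v / (2 * real n))) - (1 - v / (2 * real n))\<bar>"
      unfolding w_def of_real_diff[symmetric] norm_of_real by (rule abs_minus_commute)
    also have "\<dots> \<le> (v / (2 * real n))\<^sup>2" using v by (intro abs_exp_minus_le) simp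
    also have "\<dots> = 1 / real n * (v\<^sup>2 / (4 * real n))"
      by (simp add: power2_eq_square field_simps)
    finally have "norm (?\<phi> (1 / sqrt (real n)) - w n) \<le> 1 / real n * (e n / 6) + 1 / real n * (v\<^sup>2 / (4 * real n))"
      using norm_triangle_ineq[of "?\<phi> (1 / sqrt (real n)) - complex_of_real (1 - v / (2 * real n))" "complex_of_real (1 - v / (2 * real n)) - w n"] 1
      by simp
    then show ?thesis by (simp only: distrib_left)
  qed
  have "(\<lambda>n. ?\<phi> (1 / sqrt (real n)) ^ b n - w n ^ b n) \<longlonglongrightarrow> 0"
  proof (rule Lim_null_comparison)
    show "eventually (\<lambda>n. norm (?\<phi> (1 / sqrt (real n)) ^ b n - w n ^ b n) \<le> real (b n) / real n * (e n / 6 + v\<^sup>2 / (4 * real n))) sequentially"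
      using eventually_gt_at_top[of 0]
    proof eventually_elim
      case (elim n)
      have "norm (?\<phi> (1 / sqrt (real n)) ^ b n - w n ^ b n) \<le> real (b n) * norm (?\<phi> (1 / sqrt (real n)) - w n)"
        using v by (intro norm_power_diff D.cmod_char_le_1) (simp add: w_def)
      also have "\<dots> \<le> real (b n) * (1 / real n * (e n / 6 + v\<^sup>2 / (4 * real n)))"
        using bound[OF elim] by (intro mult_left_mono) auto
      finally show ?case by simp
    qed
    have "(\<lambda>n. v\<^sup>2 / (4 * real n)) \<longlonglongrightarrow> 0" by real_asymp
    then have "(\<lambda>n. real (b n) / real n * (e n / 6 + v\<^sup>2 / (4 * real n))) \<longlonglongrightarrow> c * (0 / 6 + 0)"
      by (intro tendsto_intros b e_lim) simp
    then show "(\<lambda>n. real (b n) / real n * (e n / 6 + v\<^sup>2 / (4 * real n))) \<longlonglongrightarrow> 0" by simp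
  qed
  from tendsto_add[OF this w_lim] show ?thesis by (simp add: v_def)
qed

lemma (in prob_space) second_moment_matrix_inner:
  fixes Z :: "'a \<Rightarrow> real^'n"
  assumes Z [measurable]: "Z \<in> borel_measurable M" and Z2: "integrable M (\<lambda>\<omega>. (norm (Z \<omega>))\<^sup>2)"
  shows "u \<bullet> (second_moment_matrix M Z *v u) = expectation (\<lambda>\<omega>. (u \<bullet> Z \<omega>)\<^sup>2)"
proof -
  have Zm [measurable]: "(\<lambda>\<omega>. Z \<omega> $ i) \<in> borel_measurable M" for i
    unfolding cart_eq_inner_axis by measurable
  have int: "integrable M (\<lambda>\<omega>. Z \<omega> $ i * Z \<omega> $ j)" for i j
  proof (rule Bochner_Integration.integrable_bound[OF Z2])
    show "AE \<omega> in M. norm (Z \<omega> $ i * Z \<omega> $ j) \<le> norm ((norm (Z \<omega>))\<^sup>2)"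
      by (intro AE_I2) (auto simp: abs_mult power2_eq_square intro!: mult_mono component_le_norm_cart)
  qed measurable
  have "expectation (\<lambda>\<omega>. (u \<bullet> Z \<omega>)\<^sup>2) = expectation (\<lambda>\<omega>. \<Sum>i\<in>UNIV. \<Sum>j\<in>UNIV. u $ i * u $ j * (Z \<omega> $ i * Z \<omega> $ j))"
    by (intro Bochner_Integration.integral_cong) (auto simp: inner_vec_def power2_eq_square sum_product mult_ac)
  also have "\<dots> = (\<Sum>i\<in>UNIV. \<Sum>j\<in>UNIV. u $ i * u $ j * expectation (\<lambda>\<omega>. Z \<omega> $ i * Z \<omega> $ j))"
    using int by (simp add: Bochner_Integration.integral_sum)
  also have "\<dots> = u \<bullet> (second_moment_matrix M Z *v u)"
    by (simp add: inner_vec_def matrix_vector_mult_def second_moment_matrix_def sum_distrib_left mult_ac)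
  finally show ?thesis by simp
qed

text \<open>\<open>centered_gaussian\<close> does not require \<open>\<Sigma>\<close> to be positive
  semidefinite, hence the assumption on the quadratic form; for a second moment matrix it follows
  from \<open>second_moment_matrix_inner\<close>.\<close>

lemma centered_gaussian_cf:
  fixes Z :: "'a \<Rightarrow> real^'n"
  assumes N: "prob_space N" and Z: "centered_gaussian N \<Sigma> Z" and nonneg: "u \<bullet> (\<Sigma> *v u) \<ge> 0"
  shows "(CLINT \<omega>|N. iexp (u \<bullet> Z \<omega>)) = complex_of_real (exp (- (u \<bullet> (\<Sigma> *v u) / 2)))"
proof -
  have [measurable]: "Z \<in> borel_measurable N" using Z by (simp add: centered_gaussian_def)
  let ?s = "sqrt (u \<bullet> (\<Sigma> *v u))"
  have "(CLINT \<omega>|N. iexp (u \<bullet> Z \<omega>)) = (CLINT x|distr N borel (\<lambda>\<omega>. u \<bullet> Z \<omega>). iexp x)"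
    by (subst integral_distr) auto
  also have "\<dots> = (CLINT x|distr std_normal_distribution borel (\<lambda>x. ?s * x). iexp x)"
    using Z by (simp add: centered_gaussian_def)
  also have "\<dots> = char std_normal_distribution ?s"
    unfolding char_def by (subst integral_distr) auto
  also have "\<dots> = complex_of_real (exp (- (u \<bullet> (\<Sigma> *v u) / 2)))"
    using nonneg by (simp add: char_std_normal_distribution)
  finally show ?thesis .
qed

text \<open>Projecting onto \<open>u\<close> reduces the claim to scalar summands. The start
  \<open>a n\<close> of the block may move with \<open>n\<close>, because the characteristic
  function of a block depends only on its length.\<close>

lemma (in prob_space) block_sum_cf_tendsto:
  fixes Y :: "nat \<Rightarrow> 'a \<Rightarrow> real^'n"
  assumes indep: "indep_vars (\<lambda>_. borel) Y {1..}"
    and distr: "\<And>i. i \<ge> 1 \<Longrightarrow> distr M borel (Y i) = distr M borel (Y 1)"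
    and Y2: "integrable M (\<lambda>\<omega>. (norm (Y 1 \<omega>))\<^sup>2)" and Y0: "expectation (Y 1) = 0"
    and b: "(\<lambda>n. real (b n) / real n) \<longlonglongrightarrow> c"
  shows "(\<lambda>n. CLINT \<omega>|M. iexp (u \<bullet> ((1 / sqrt (real n)) *\<^sub>R (\<Sum>i\<in>{a n<..a n + b n}. Y i \<omega>)))) \<longlonglongrightarrow>
    complex_of_real (exp (- (c * (u \<bullet> (second_moment_matrix M (Y 1) *v u)) / 2)))"
proof -
  have Ym [measurable]: "Y i \<in> borel_measurable M" if "i \<ge> 1" for i
    using indep that by (auto simp: indep_vars_def)
  have [measurable]: "Y 1 \<in> borel_measurable M" "Y (Suc 0) \<in> borel_measurable M" using Ym[of 1] by auto
  define X where "X i \<omega> = u \<bullet> Y i \<omega>" for i \<omega>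
  have X_distr: "distr M borel (X i) = distr M borel (X 1)" if "i \<ge> 1" for i
  proof -
    have "distr M borel (X i) = distr (distr M borel (Y i)) borel (\<lambda>y. u \<bullet> y)"
      using Ym[OF that] by (subst distr_distr) (auto simp: X_def[abs_def] o_def)
    also have "\<dots> = distr (distr M borel (Y 1)) borel (\<lambda>y. u \<bullet> y)" using distr[OF that] by simp
    also have "\<dots> = distr M borel (X 1)"
      by (subst distr_distr) (auto simp: X_def[abs_def] o_def)
    finally show ?thesis .
  qed
  have Y1: "integrable M (Y 1)"
  proof -
    have "integrable M (\<lambda>\<omega>. norm (Y 1 \<omega>))"
      by (rule square_integrable_imp_integrable[OF _ Y2]) measurable
    then show ?thesis by (simp add: integrable_norm_iff)
  qed
  have X2: "integrable M (\<lambda>\<omega>. (X 1 \<omega>)\<^sup>2)"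
  proof (rule Bochner_Integration.integrable_bound)
    show "integrable M (\<lambda>\<omega>. (norm u)\<^sup>2 * (norm (Y 1 \<omega>))\<^sup>2)" using Y2 by simp
    show "AE \<omega> in M. norm ((X 1 \<omega>)\<^sup>2) \<le> norm ((norm u)\<^sup>2 * (norm (Y 1 \<omega>))\<^sup>2)"
    proof (rule AE_I2)
      fix \<omega>
      have "\<bar>X 1 \<omega>\<bar>\<^sup>2 \<le> (norm u * norm (Y 1 \<omega>))\<^sup>2"
        unfolding X_def by (intro power_mono Cauchy_Schwarz_ineq2) auto
      then show "norm ((X 1 \<omega>)\<^sup>2) \<le> norm ((norm u)\<^sup>2 * (norm (Y 1 \<omega>))\<^sup>2)"
        by (simp add: power_mult_distrib)
    qed
  qed (simp add: X_def)
  have X0: "expectation (X 1) = 0"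
    using Y0 Y1 unfolding X_def[abs_def] by simp
  have X_indep: "indep_vars (\<lambda>_. borel) X {1..}"
  proof -
    have "indep_vars (\<lambda>_. borel) (\<lambda>i. (\<lambda>y. u \<bullet> y) \<circ> Y i) {1..}"
      using indep by (rule indep_vars_compose) simp
    then show ?thesis by (simp add: o_def X_def[abs_def])
  qed
  have "(CLINT \<omega>|M. iexp (u \<bullet> ((1 / sqrt (real n)) *\<^sub>R (\<Sum>i\<in>{a n<..a n + b n}. Y i \<omega>)))) =
      char (distr M borel (X 1)) (1 / sqrt (real n)) ^ b n" for n
  proof -
    let ?I = "{a n<..a n + b n}"
    have [measurable]: "X i \<in> borel_measurable M" if "i \<in> ?I" for i using that Ym by (simp add: X_def[abs_def])
    have "(CLINT \<omega>|M. iexp (u \<bullet> ((1 / sqrt (real n)) *\<^sub>R (\<Sum>i\<in>?I. Y i \<omega>)))) =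
        (CLINT \<omega>|M. iexp (1 / sqrt (real n) * (\<Sum>i\<in>?I. X i \<omega>)))"
      by (simp add: inner_sum_right X_def)
    also have "\<dots> = char (distr M borel (\<lambda>\<omega>. \<Sum>i\<in>?I. X i \<omega>)) (1 / sqrt (real n))"
      unfolding char_def by (subst integral_distr) auto
    also have "\<dots> = (\<Prod>i\<in>?I. char (distr M borel (X i)) (1 / sqrt (real n)))"
      by (intro char_distr_sum indep_vars_subset[OF X_indep]) auto
    also have "\<dots> = (\<Prod>i\<in>?I. char (distr M borel (X 1)) (1 / sqrt (real n)))"
      by (intro prod.cong refl arg_cong[where f = "\<lambda>D. char D _"] X_distr) auto
    finally show ?thesis by simp
  qed
  moreover have "(\<lambda>n. char (distr M borel (X 1)) (1 / sqrt (real n)) ^ b n) \<longlonglongrightarrow>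
      complex_of_real (exp (- (c * expectation (\<lambda>\<omega>. (X 1 \<omega>)\<^sup>2) / 2)))"
    by (rule char_power_tendsto[OF _ X2 X0 b]) (simp add: X_def[abs_def])
  ultimately show ?thesis
    using second_moment_matrix_inner[OF _ Y2, of u] by (simp add: X_def)
qed

subsection \<open>Hausdorff continuous functionals\<close>

definition hausdorff_uc :: "('a::metric_space set \<Rightarrow> real) \<Rightarrow> bool" where
  "hausdorff_uc \<Phi> \<longleftrightarrow> (\<forall>\<epsilon>>0. \<exists>\<delta>>0. \<forall>A B. compact A \<longrightarrow> A \<noteq> {} \<longrightarrow> compact B \<longrightarrow> B \<noteq> {} \<longrightarrow>
     hausdorff_close \<delta> A B \<longrightarrow> \<bar>\<Phi> A - \<Phi> B\<bar> \<le> \<epsilon>)"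

text \<open>Uniformity on each ball only: intrinsic volumes of hulls satisfy this, and it suffices
  for measurability and for limits along a fixed path. The global notion \<open>hausdorff_uc\<close>
  is reached after a cutoff and is what the limit theorem works with.\<close>

definition hausdorff_luc :: "('a::real_normed_vector set \<Rightarrow> real) \<Rightarrow> bool" where
  "hausdorff_luc \<Phi> \<longleftrightarrow> (\<forall>R. \<forall>\<epsilon>>0. \<exists>\<delta>>0. \<forall>A B. compact A \<longrightarrow> A \<noteq> {} \<longrightarrow> A \<subseteq> cball 0 R \<longrightarrow>
     compact B \<longrightarrow> B \<noteq> {} \<longrightarrow> B \<subseteq> cball 0 R \<longrightarrow> hausdorff_close \<delta> A B \<longrightarrow> \<bar>\<Phi> A - \<Phi> B\<bar> \<le> \<epsilon>)"

lemma hausdorff_ucD: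
  assumes "hausdorff_uc \<Phi>" "\<epsilon> > 0"
  obtains \<delta> where "\<delta> > 0" "\<And>A B. compact A \<Longrightarrow> A \<noteq> {} \<Longrightarrow> compact B \<Longrightarrow> B \<noteq> {} \<Longrightarrow>
     hausdorff_close \<delta> A B \<Longrightarrow> \<bar>\<Phi> A - \<Phi> B\<bar> \<le> \<epsilon>"
  using assms unfolding hausdorff_uc_def by metis

lemma hausdorff_lucD:
  assumes "hausdorff_luc \<Phi>" "\<epsilon> > 0"
  obtains \<delta> where "\<delta> > 0" "\<And>A B. compact A \<Longrightarrow> A \<noteq> {} \<Longrightarrow> A \<subseteq> cball 0 R \<Longrightarrow>
     compact B \<Longrightarrow> B \<noteq> {} \<Longrightarrow> B \<subseteq> cball 0 R \<Longrightarrow> hausdorff_close \<delta> A B \<Longrightarrow> \<bar>\<Phi> A - \<Phi> B\<bar> \<le> \<epsilon>"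
  using assms unfolding hausdorff_luc_def by metis

lemma hausdorff_uc_imp_luc: "hausdorff_uc \<Phi> \<Longrightarrow> hausdorff_luc \<Phi>"
  unfolding hausdorff_uc_def hausdorff_luc_def by meson

lemma hausdorff_close_images:
  assumes "\<And>i. i \<in> I \<Longrightarrow> dist (x i) (y i) \<le> \<delta>"
  shows "hausdorff_close \<delta> (x ` I) (y ` I)"
  using assms unfolding hausdorff_close_def by blast

text \<open>Nearby tuples of points form Hausdorff close sets within a common ball. This is the
  source of all measurability statements for functionals of random sets.\<close>

lemma continuous_on_hausdorff_luc_image:
  fixes \<Phi> :: "'a::real_normed_vector set \<Rightarrow> real"
  assumes \<Phi>: "hausdorff_luc \<Phi>" and I: "finite I" "I \<noteq> {}"
  shows "continuous_on UNIV (\<lambda>x :: 'i \<Rightarrow> 'a. \<Phi> (x ` I))"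
  unfolding continuous_on_def
proof (rule ballI)
  fix x :: "'i \<Rightarrow> 'a"
  show "((\<lambda>x. \<Phi> (x ` I)) \<longlongrightarrow> \<Phi> (x ` I)) (at x within UNIV)"
  proof (rule tendstoI)
    fix e :: real assume e: "e > 0"
    define R where "R = Max ((\<lambda>i. norm (x i)) ` I) + 1"
    have xR: "norm (x i) + 1 \<le> R" if "i \<in> I" for i
      unfolding R_def using that I by (intro add_right_mono Max_ge) auto
    obtain \<delta> where \<delta>: "\<delta> > 0" "\<And>A B. compact A \<Longrightarrow> A \<noteq> {} \<Longrightarrow> A \<subseteq> cball 0 R \<Longrightarrow>
       compact B \<Longrightarrow> B \<noteq> {} \<Longrightarrow> B \<subseteq> cball 0 R \<Longrightarrow> hausdorff_close \<delta> A B \<Longrightarrow> \<bar>\<Phi> A - \<Phi> B\<bar> \<le> e / 2"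
      using hausdorff_lucD[OF \<Phi>, of "e / 2" R] e by (metis half_gt_zero)
    have "eventually (\<lambda>y. \<forall>i\<in>I. dist (y i) (x i) < min \<delta> 1) (at x)"
    proof (rule eventually_ball_finite[OF I(1)], rule ballI)
      fix i
      have "((\<lambda>y. y i) \<longlongrightarrow> x i) (at x)"
        using continuous_on_product_coordinates[of i] unfolding continuous_on_def by blast
      then show "eventually (\<lambda>y. dist (y i) (x i) < min \<delta> 1) (at x)"
        by (rule tendstoD) (use \<delta> in simp)
    qed
    then show "eventually (\<lambda>y. dist (\<Phi> (y ` I)) (\<Phi> (x ` I)) < e) (at x)"
    proof eventually_elim
      case (elim y)
      have "norm (y i) \<le> R" if i: "i \<in> I" for i
      proof -
        have "norm (y i) \<le> norm (x i) + dist (y i) (x i)"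
          using norm_triangle_sub[of "y i" "x i"] by (simp add: dist_norm)
        then show ?thesis using elim i xR[OF i] by force
      qed
      then have "\<bar>\<Phi> (y ` I) - \<Phi> (x ` I)\<bar> \<le> e / 2"
        using I elim xR by (intro \<delta> hausdorff_close_images) (force simp: finite_imp_compact less_imp_le)+
      then show ?case using e by (simp add: dist_real_def)
    qed
  qed
qed

lemma borel_measurable_hausdorff_luc_image:
  fixes \<Phi> :: "'a::euclidean_space set \<Rightarrow> real" and f :: "nat \<Rightarrow> 'b \<Rightarrow> 'a"
  assumes \<Phi>: "hausdorff_luc \<Phi>" and I: "finite I" "I \<noteq> {}"
    and f: "\<And>i. i \<in> I \<Longrightarrow> f i \<in> borel_measurable M"
  shows "(\<lambda>\<omega>. \<Phi> ((\<lambda>i. f i \<omega>) ` I)) \<in> borel_measurable M"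
proof -
  \<comment> \<open>Padding with 0 outside \<open>I\<close> gives a measurable map into the full
    product space, on which the functional is continuous; the image of \<open>I\<close> is
    unaffected.\<close>
  have "(\<lambda>\<omega> i. if i \<in> I then f i \<omega> else 0) \<in> borel_measurable M"
  proof (rule measurable_coordinatewise_then_product)
    fix i show "(\<lambda>\<omega>. if i \<in> I then f i \<omega> else 0) \<in> borel_measurable M"
      using f[of i] by (cases "i \<in> I") auto
  qed
  moreover have "(\<lambda>x :: nat \<Rightarrow> 'a. \<Phi> (x ` I)) \<in> borel_measurable borel"
    by (intro borel_measurable_continuous_onI continuous_on_hausdorff_luc_image \<Phi> I)
  ultimately have "(\<lambda>\<omega>. \<Phi> ((\<lambda>i. if i \<in> I then f i \<omega> else 0) ` I)) \<in> borel_measurable M"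
    by (rule measurable_compose)
  moreover have "(\<lambda>i. if i \<in> I then f i \<omega> else 0) ` I = (\<lambda>i. f i \<omega>) ` I" for \<omega>
    by (rule image_cong) auto
  ultimately show ?thesis by simp
qed

lemma hausdorff_close_grid:
  fixes x :: "real \<Rightarrow> 'a::metric_space"
  assumes x: "continuous_on {0..1} x" and \<delta>: "\<delta> > 0"
  shows "eventually (\<lambda>K::nat. hausdorff_close \<delta> (x ` {0..1}) ((\<lambda>j. x (real j / real K)) ` {0..K})) sequentially"
proof -
  obtain d where d: "d > 0" "\<And>s t. s \<in> {0..1} \<Longrightarrow> t \<in> {0..1} \<Longrightarrow> dist s t < d \<Longrightarrow> dist (x s) (x t) < \<delta>"
    using compact_uniformly_continuous[OF x] \<delta> unfolding uniformly_continuous_on_def by (metis compact_Icc)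
  obtain K0 :: nat where K0: "real K0 > 1 / d" using reals_Archimedean2 by blast
  show ?thesis
    using eventually_ge_at_top[of "Suc K0"]
  proof eventually_elim
    case (elim K)
    then have "real K > 1 / d" and K: "real K > 0" using K0 by auto
    then have Kd: "1 / real K < d" using d by (simp add: field_simps)
    show ?case unfolding hausdorff_close_def
    proof (intro conjI ballI)
      fix a assume "a \<in> x ` {0..1}"
      then obtain t where t: "0 \<le> t" "t \<le> 1" "a = x t" by auto
      define j where "j = nat \<lfloor>t * real K\<rfloor>"
      have j: "real j \<le> t * real K" "t * real K < real j + 1"
        using t K mult_nonneg_nonneg[of t "real K"] unfolding j_def by linarith+
      then have "real j / real K \<le> t" "t < (real j + 1) / real K"
        using K by (simp_all add: pos_divide_le_eq pos_less_divide_eq)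
      then have "real j / real K \<le> t" "t - real j / real K < 1 / real K"
        by (simp_all add: add_divide_distrib)
      then have "dist t (real j / real K) < d" using Kd by (simp add: dist_real_def)
      moreover have "real j \<le> real K" using j t K mult_right_mono[of t 1 "real K"] by linarith
      then have "j \<le> K" by simp
      ultimately have "dist a (x (real j / real K)) \<le> \<delta>"
        using d(2)[of t "real j / real K"] t K by (simp add: less_imp_le)
      then show "\<exists>b\<in>(\<lambda>j. x (real j / real K)) ` {0..K}. dist a b \<le> \<delta>"
        using \<open>j \<le> K\<close> by (intro bexI[of _ "x (real j / real K)"]) auto
    next
      fix b assume "b \<in> (\<lambda>j. x (real j / real K)) ` {0..K}"
      then obtain j where j: "j \<le> K" "b = x (real j / real K)" by auto
      then have "b \<in> x ` {0..1}" using K by auto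
      then show "\<exists>a\<in>x ` {0..1}. dist a b \<le> \<delta>" using \<delta> by (intro bexI[of _ b]) auto
    qed
  qed
qed

lemma hausdorff_luc_grid_tendsto:
  fixes \<Phi> :: "'a::euclidean_space set \<Rightarrow> real"
  assumes \<Phi>: "hausdorff_luc \<Phi>" and x: "continuous_on {0..1} x"
  shows "(\<lambda>K. \<Phi> ((\<lambda>j. x (real j / real K)) ` {0..K})) \<longlonglongrightarrow> \<Phi> (x ` {0..1})"
proof (rule tendstoI)
  fix e :: real assume e: "e > 0"
  have c: "compact (x ` {0..1})" using x by (intro compact_continuous_image) auto
  then obtain R where R: "x ` {0..1} \<subseteq> cball 0 R"
    using bounded_subset_ballD[OF compact_imp_bounded[OF c], of 0] ball_subset_cball by blast
  obtain \<delta> where \<delta>: "\<delta> > 0" "\<And>A B. compact A \<Longrightarrow> A \<noteq> {} \<Longrightarrow> A \<subseteq> cball 0 R \<Longrightarrow>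
     compact B \<Longrightarrow> B \<noteq> {} \<Longrightarrow> B \<subseteq> cball 0 R \<Longrightarrow> hausdorff_close \<delta> A B \<Longrightarrow> \<bar>\<Phi> A - \<Phi> B\<bar> \<le> e / 2"
    using hausdorff_lucD[OF \<Phi>, of "e / 2" R] e by (metis half_gt_zero)
  show "eventually (\<lambda>K. dist (\<Phi> ((\<lambda>j. x (real j / real K)) ` {0..K})) (\<Phi> (x ` {0..1})) < e) sequentially"
    using hausdorff_close_grid[OF x \<delta>(1)] eventually_gt_at_top[of 0]
  proof eventually_elim
    case (elim K)
    have "(\<lambda>j. x (real j / real K)) ` {0..K} \<subseteq> x ` {0..1}"
      using elim by auto
    then have "\<bar>\<Phi> (x ` {0..1}) - \<Phi> ((\<lambda>j. x (real j / real K)) ` {0..K})\<bar> \<le> e / 2"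
      using R c elim by (intro \<delta>) (auto intro: finite_imp_compact)
    then show ?case using e by (simp add: dist_real_def abs_minus_commute)
  qed
qed

text \<open>Continuity of the paths makes the functional a pointwise limit of functionals of
  finitely many path values.\<close>

lemma borel_measurable_hausdorff_luc_path:
  fixes \<Phi> :: "'a::euclidean_space set \<Rightarrow> real" and X :: "real \<Rightarrow> 'b \<Rightarrow> 'a"
  assumes \<Phi>: "hausdorff_luc \<Phi>" and X: "\<And>t. t \<ge> 0 \<Longrightarrow> X t \<in> borel_measurable N"
    and cont: "\<And>\<omega>. \<omega> \<in> space N \<Longrightarrow> continuous_on {0..1} (\<lambda>t. X t \<omega>)"
  shows "(\<lambda>\<omega>. \<Phi> ((\<lambda>t. X t \<omega>) ` {0..1})) \<in> borel_measurable N"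
proof (rule borel_measurable_LIMSEQ_real)
  show "(\<lambda>K. \<Phi> ((\<lambda>j. X (real j / real K) \<omega>) ` {0..K})) \<longlonglongrightarrow> \<Phi> ((\<lambda>t. X t \<omega>) ` {0..1})" if "\<omega> \<in> space N" for \<omega>
    using hausdorff_luc_grid_tendsto[OF \<Phi> cont[OF that]] by simp
  show "(\<lambda>\<omega>. \<Phi> ((\<lambda>j. X (real j / real K) \<omega>) ` {0..K})) \<in> borel_measurable N" for K
    using X by (intro borel_measurable_hausdorff_luc_image \<Phi>) auto
qed

section \<open>Radius of a set and truncation of functionals\<close>

definition set_radius :: "'a::real_normed_vector set \<Rightarrow> real" where
  "set_radius A = Sup (norm ` A)"

lemma norm_le_set_radius:
  assumes "compact A" "a \<in> A"
  shows "norm a \<le> set_radius A"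
  unfolding set_radius_def using assms
  by (intro cSup_upper imageI bounded_imp_bdd_above compact_imp_bounded compact_continuous_image continuous_intros)

lemma set_radius_le: "A \<noteq> {} \<Longrightarrow> (\<And>a. a \<in> A \<Longrightarrow> norm a \<le> c) \<Longrightarrow> set_radius A \<le> c"
  unfolding set_radius_def by (intro cSup_least) auto

lemma subset_cball_set_radius: "compact A \<Longrightarrow> A \<subseteq> cball 0 (set_radius A)"
  using norm_le_set_radius by fastforce

lemma set_radius_nonneg: "compact A \<Longrightarrow> A \<noteq> {} \<Longrightarrow> set_radius A \<ge> 0"
  by (meson all_not_in_conv norm_ge_zero norm_le_set_radius order_trans)

lemma set_radius_hausdorff_close:
  assumes "compact A" "A \<noteq> {}" "compact B" "B \<noteq> {}" "hausdorff_close \<delta> A B"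
  shows "\<bar>set_radius A - set_radius B\<bar> \<le> \<delta>"
proof -
  have *: "set_radius A \<le> set_radius B + \<delta>" if AB: "compact A" "A \<noteq> {}" "compact B" "B \<noteq> {}" "hausdorff_close \<delta> A B" for A B :: "'a set"
  proof (rule set_radius_le)
    fix a assume "a \<in> A"
    then obtain b where b: "b \<in> B" "dist a b \<le> \<delta>"
      using AB(5) unfolding hausdorff_close_def by blast
    have "norm a \<le> norm b + dist a b" using norm_triangle_sub[of a b] by (simp add: dist_norm)
    then show "norm a \<le> set_radius B + \<delta>" using b norm_le_set_radius[OF AB(3) b(1)] by linarith
  qed (use AB in auto)
  show ?thesis using *[OF assms] *[OF assms(3,4,1,2) hausdorff_close_sym[OF assms(5)]] by linarith
qed

text \<open>The minimum confines the argument to a compact interval, where \<open>f\<close> is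
  uniformly continuous, and the radius is 1-Lipschitz. This supplies the truncated powers of the
  radius as test functionals.\<close>

lemma hausdorff_uc_set_radius_comp:
  fixes f :: "real \<Rightarrow> real"
  assumes f: "continuous_on {0..L} f" and L: "L \<ge> 0"
  shows "hausdorff_uc (\<lambda>A :: 'a::real_normed_vector set. f (min (set_radius A) L))"
  unfolding hausdorff_uc_def
proof (intro allI impI)
  fix \<epsilon> :: real assume "\<epsilon> > 0"
  then obtain d where d: "d > 0" "\<And>s t. s \<in> {0..L} \<Longrightarrow> t \<in> {0..L} \<Longrightarrow> dist s t < d \<Longrightarrow> dist (f s) (f t) < \<epsilon>"
    using compact_uniformly_continuous[OF f] unfolding uniformly_continuous_on_def by (metis compact_Icc)
  show "\<exists>\<delta>>0. \<forall>A B :: 'a set. compact A \<longrightarrow> A \<noteq> {} \<longrightarrow> compact B \<longrightarrow> B \<noteq> {} \<longrightarrow> hausdorff_close \<delta> A B \<longrightarrow>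
      \<bar>f (min (set_radius A) L) - f (min (set_radius B) L)\<bar> \<le> \<epsilon>"
  proof (intro exI conjI allI impI)
    fix A B :: "'a set" assume AB: "compact A" "A \<noteq> {}" "compact B" "B \<noteq> {}" "hausdorff_close (d / 2) A B"
    have "\<bar>set_radius A - set_radius B\<bar> \<le> d / 2" by (rule set_radius_hausdorff_close[OF AB])
    then have "dist (min (set_radius A) L) (min (set_radius B) L) < d"
      using d by (auto simp: dist_real_def min_def)
    then show "\<bar>f (min (set_radius A) L) - f (min (set_radius B) L)\<bar> \<le> \<epsilon>"
      using d(2)[of "min (set_radius A) L" "min (set_radius B) L"] set_radius_nonneg[OF AB(1,2)] set_radius_nonneg[OF AB(3,4)] L
      by (simp add: dist_real_def less_imp_le)
  qed (use d in simp)
qed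

definition cutoff :: "real \<Rightarrow> real \<Rightarrow> real" where
  "cutoff L t = max 0 (min 1 (2 - t / L))"

lemma cutoff_bounds: "0 \<le> cutoff L t" "cutoff L t \<le> 1"
  by (auto simp: cutoff_def)

lemma cutoff_eq_0: "L > 0 \<Longrightarrow> t \<ge> 2 * L \<Longrightarrow> cutoff L t = 0"
  by (simp add: cutoff_def field_simps)

lemma cutoff_eq_1: "L > 0 \<Longrightarrow> t \<le> L \<Longrightarrow> cutoff L t = 1"
  by (simp add: cutoff_def field_simps)

lemma cutoff_lipschitz:
  assumes "L > 0"
  shows "\<bar>cutoff L s - cutoff L t\<bar> \<le> \<bar>s - t\<bar> / L"
proof -
  have "\<bar>cutoff L s - cutoff L t\<bar> \<le> \<bar>s / L - t / L\<bar>" by (auto simp: cutoff_def max_def min_def)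
  also have "\<dots> = \<bar>s - t\<bar> / L" using assms by (simp flip: diff_divide_distrib)
  finally show ?thesis .
qed

text \<open>Only sets in a fixed ball matter, since the cutoff vanishes for large radii; there the
  local modulus of \<open>h\<close>, its bound and the Lipschitz constant of the cutoff combine by
  the product rule.\<close>

lemma hausdorff_uc_cutoff:
  fixes h :: "'a::real_normed_vector set \<Rightarrow> real"
  assumes h: "hausdorff_luc h" and bound: "\<And>A. compact A \<Longrightarrow> A \<noteq> {} \<Longrightarrow> \<bar>h A\<bar> \<le> C * set_radius A powr s"
    and L: "L > 0" and C: "C \<ge> 0" and s: "s \<ge> 0"
  shows "hausdorff_uc (\<lambda>A. h A * cutoff L (set_radius A))"
  unfolding hausdorff_uc_def
proof (intro allI impI)
  fix \<epsilon> :: real assume \<epsilon>: "\<epsilon> > 0"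
  define B0 where "B0 = C * (4 * L) powr s"
  have B0: "B0 \<ge> 0" using C by (simp add: B0_def)
  obtain \<delta> where \<delta>: "\<delta> > 0" "\<And>A B. compact A \<Longrightarrow> A \<noteq> {} \<Longrightarrow> A \<subseteq> cball 0 (4 * L) \<Longrightarrow>
     compact B \<Longrightarrow> B \<noteq> {} \<Longrightarrow> B \<subseteq> cball 0 (4 * L) \<Longrightarrow> hausdorff_close \<delta> A B \<Longrightarrow> \<bar>h A - h B\<bar> \<le> \<epsilon> / 2"
    using hausdorff_lucD[OF h, of "\<epsilon> / 2" "4 * L"] \<epsilon> by (metis half_gt_zero)
  \<comment> \<open>The three constraints serve the modulus of \<open>h\<close>, the case
    distinction on the radius, and the Lipschitz error of the cutoff; adding 1 to \<open>B0\<close>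
    avoids a division by 0.\<close>
  define d where "d = min \<delta> (min L (\<epsilon> * L / (2 * (B0 + 1))))"
  have d: "d > 0" "d \<le> \<delta>" "d \<le> L" "d \<le> \<epsilon> * L / (2 * (B0 + 1))"
    using \<delta> L \<epsilon> B0 by (auto simp: d_def)
  show "\<exists>\<delta>>0. \<forall>A B. compact A \<longrightarrow> A \<noteq> {} \<longrightarrow> compact B \<longrightarrow> B \<noteq> {} \<longrightarrow> hausdorff_close \<delta> A B \<longrightarrow>
      \<bar>h A * cutoff L (set_radius A) - h B * cutoff L (set_radius B)\<bar> \<le> \<epsilon>"
  proof (intro exI conjI allI impI)
    fix A B :: "'a set" assume AB: "compact A" "A \<noteq> {}" "compact B" "B \<noteq> {}" "hausdorff_close d A B"
    have r: "\<bar>set_radius A - set_radius B\<bar> \<le> d" by (rule set_radius_hausdorff_close[OF AB])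
    show "\<bar>h A * cutoff L (set_radius A) - h B * cutoff L (set_radius B)\<bar> \<le> \<epsilon>"
    \<comment> \<open>As \<open>d \<le> L\<close>, a radius of at least \<open>3 * L\<close> for
      \<open>A\<close> leaves at least \<open>2 * L\<close> for \<open>B\<close>, so both cutoffs
      vanish; otherwise both sets lie in the ball of radius \<open>4 * L\<close>.\<close>
    proof (cases "set_radius A \<ge> 3 * L")
      case True
      then have "set_radius B \<ge> 2 * L" "set_radius A \<ge> 2 * L" using r d L by linarith+
      then show ?thesis using L \<epsilon> by (simp add: cutoff_eq_0)
    next
      case False
      then have rA: "set_radius A \<le> 4 * L" and rB: "set_radius B \<le> 4 * L" using r d L by linarith+
      have sub: "A \<subseteq> cball 0 (4 * L)" "B \<subseteq> cball 0 (4 * L)"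
        by (rule order_trans[OF subset_cball_set_radius[OF AB(1)] subset_cball[OF rA]],
            rule order_trans[OF subset_cball_set_radius[OF AB(3)] subset_cball[OF rB]])
      have cl: "hausdorff_close \<delta> A B"
        using AB(5) d(2) unfolding hausdorff_close_def by (meson order_trans)
      have "\<bar>h A * cutoff L (set_radius A) - h B * cutoff L (set_radius B)\<bar> =
          \<bar>(h A - h B) * cutoff L (set_radius A) + h B * (cutoff L (set_radius A) - cutoff L (set_radius B))\<bar>"
        by (simp add: algebra_simps)
      also have "\<dots> \<le> \<bar>h A - h B\<bar> * cutoff L (set_radius A) + \<bar>h B\<bar> * \<bar>cutoff L (set_radius A) - cutoff L (set_radius B)\<bar>"
        by (rule order_trans[OF abs_triangle_ineq]) (simp add: abs_mult cutoff_bounds)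
      also have "\<bar>h A - h B\<bar> * cutoff L (set_radius A) \<le> \<epsilon> / 2 * 1"
        using \<delta>(2)[OF AB(1,2) sub(1) AB(3,4) sub(2) cl] \<epsilon> by (intro mult_mono cutoff_bounds) auto
      also have "\<bar>h B\<bar> * \<bar>cutoff L (set_radius A) - cutoff L (set_radius B)\<bar> \<le> (B0 + 1) * (d / L)"
      proof (rule mult_mono)
        have "\<bar>h B\<bar> \<le> C * set_radius B powr s" by (rule bound[OF AB(3,4)])
        also have "\<dots> \<le> B0" unfolding B0_def using C s rB set_radius_nonneg[OF AB(3,4)]
          by (intro mult_left_mono powr_mono2) auto
        finally show "\<bar>h B\<bar> \<le> B0 + 1" by simp
        show "\<bar>cutoff L (set_radius A) - cutoff L (set_radius B)\<bar> \<le> d / L"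
          using cutoff_lipschitz[OF L, of "set_radius A" "set_radius B"] divide_right_mono[OF r, of L] L by linarith
      qed (use B0 in auto)
      also have "(B0 + 1) * (d / L) \<le> \<epsilon> / 2"
      proof -
        have "0 < 2 * (B0 + 1)" using B0 by simp
        from d(4)[unfolded pos_le_divide_eq[OF this]] have "d * (2 * (B0 + 1)) \<le> \<epsilon> * L" .
        then have "(B0 + 1) * d / L \<le> \<epsilon> * L / 2 / L"
          using L by (intro divide_right_mono) (auto simp: algebra_simps)
        then show ?thesis using L by simp
      qed
      finally show ?thesis by simp
    qed
  qed (use d in simp)
qed

lemma intrinsic_volume_hull_luc:
  assumes "m \<le> CARD('n)"
  shows "hausdorff_luc (\<lambda>A :: (real^'n) set. intrinsic_volume m (convex hull A))"
  unfolding hausdorff_luc_def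
proof (intro allI impI)
  fix R \<epsilon> :: real assume \<epsilon>: "\<epsilon> > 0"
  obtain \<delta> where \<delta>: "\<delta> > 0" "\<And>A B :: (real^'n) set. compact A \<Longrightarrow> A \<noteq> {} \<Longrightarrow> A \<subseteq> cball 0 (max R 0) \<Longrightarrow>
    compact B \<Longrightarrow> B \<noteq> {} \<Longrightarrow> B \<subseteq> cball 0 (max R 0) \<Longrightarrow> hausdorff_close \<delta> A B \<Longrightarrow>
    \<bar>intrinsic_volume m (convex hull A) - intrinsic_volume m (convex hull B)\<bar> \<le> \<epsilon>"
    using intrinsic_volume_hull_uniformly_continuous[OF assms _ \<epsilon>, of "max R 0"] by (metis max.cobounded2)
  have sub: "cball (0 :: real^'n) R \<subseteq> cball 0 (max R 0)" by (intro subset_cball) simp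
  show "\<exists>\<delta>>0. \<forall>A B. compact A \<longrightarrow> A \<noteq> {} \<longrightarrow> (A :: (real^'n) set) \<subseteq> cball 0 R \<longrightarrow>
     compact B \<longrightarrow> B \<noteq> {} \<longrightarrow> B \<subseteq> cball 0 R \<longrightarrow> hausdorff_close \<delta> A B \<longrightarrow>
     \<bar>intrinsic_volume m (convex hull A) - intrinsic_volume m (convex hull B)\<bar> \<le> \<epsilon>"
  proof (intro exI conjI allI impI)
    fix A B :: "(real^'n) set"
    assume AB: "compact A" "A \<noteq> {}" "A \<subseteq> cball 0 R" "compact B" "B \<noteq> {}" "B \<subseteq> cball 0 R" "hausdorff_close \<delta> A B"
    show "\<bar>intrinsic_volume m (convex hull A) - intrinsic_volume m (convex hull B)\<bar> \<le> \<epsilon>"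
      by (rule \<delta>(2)[OF AB(1,2) order_trans[OF AB(3) sub] AB(4,5) order_trans[OF AB(6) sub] AB(7)])
  qed (rule \<delta>(1))
qed

lemma intrinsic_volume_hull_bound:
  assumes m: "1 \<le> m" "m \<le> CARD('n)"
  obtains C where "C \<ge> 0" "\<And>A :: (real^'n) set. compact A \<Longrightarrow> A \<noteq> {} \<Longrightarrow>
    \<bar>intrinsic_volume m (convex hull A)\<bar> \<le> C * set_radius A powr real m"
proof -
  obtain C where C: "C \<ge> 0" "\<And>A R. compact A \<Longrightarrow> convex A \<Longrightarrow> A \<noteq> {} \<Longrightarrow> (A :: (real^'n) set) \<subseteq> cball 0 R \<Longrightarrow> R > 0 \<Longrightarrow>
      \<bar>intrinsic_volume m A\<bar> \<le> C * R ^ m"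
    using intrinsic_volume_bound[OF m(2)] by metis
  have "\<bar>intrinsic_volume m (convex hull A)\<bar> \<le> C * set_radius A powr real m"
    if A: "compact A" "A \<noteq> {}" for A :: "(real^'n) set"
  proof -
    have r0: "set_radius A \<ge> 0" by (rule set_radius_nonneg[OF A])
    \<comment> \<open>The radius may be 0, whereas the bound asks for a positive one, so it is
      approached from above. The final conversion to \<open>powr\<close> uses
      \<open>1 \<le> m\<close> at radius 0.\<close>
    have "\<bar>intrinsic_volume m (convex hull A)\<bar> \<le> C * (set_radius A + inverse (real (Suc k))) ^ m" for k
    proof (rule C)
      show "convex hull A \<subseteq> cball 0 (set_radius A + inverse (real (Suc k)))"
        by (intro hull_minimal convex_cball order_trans[OF subset_cball_set_radius[OF A(1)] subset_cball]) simp
      show "set_radius A + inverse (real (Suc k)) > 0" using r0 by (simp add: add_nonneg_pos)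
    qed (use A in \<open>auto intro: compact_convex_hull\<close>)
    moreover have "(\<lambda>k. C * (set_radius A + inverse (real (Suc k))) ^ m) \<longlonglongrightarrow> C * (set_radius A + 0) ^ m"
      by (intro tendsto_mult tendsto_const tendsto_power tendsto_add LIMSEQ_inverse_real_of_nat)
    ultimately have "\<bar>intrinsic_volume m (convex hull A)\<bar> \<le> C * (set_radius A + 0) ^ m"
      by (intro LIMSEQ_le_const) auto
    also have "(set_radius A + 0) ^ m = set_radius A powr real m"
      using r0 m by (cases "set_radius A = 0") (auto simp: powr_realpow)
    finally show ?thesis .
  qed
  with C(1) show thesis using that by blast
qed

lemma hausdorff_luc_power2:
  fixes h :: "'a::real_normed_vector set \<Rightarrow> real"
  assumes h: "hausdorff_luc h" and bound: "\<And>A. compact A \<Longrightarrow> A \<noteq> {} \<Longrightarrow> \<bar>h A\<bar> \<le> C * set_radius A powr s"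
    and C: "C \<ge> 0" and s: "s \<ge> 0"
  shows "hausdorff_luc (\<lambda>A. (h A)\<^sup>2)"
  unfolding hausdorff_luc_def
proof (intro allI impI)
  fix R \<epsilon> :: real assume \<epsilon>: "\<epsilon> > 0"
  define B0 where "B0 = C * \<bar>R\<bar> powr s + 1"
  have B0: "B0 > 0" using C by (simp add: B0_def add_nonneg_pos)
  obtain \<delta> where \<delta>: "\<delta> > 0" "\<And>A B. compact A \<Longrightarrow> A \<noteq> {} \<Longrightarrow> A \<subseteq> cball 0 R \<Longrightarrow>
     compact B \<Longrightarrow> B \<noteq> {} \<Longrightarrow> B \<subseteq> cball 0 R \<Longrightarrow> hausdorff_close \<delta> A B \<Longrightarrow> \<bar>h A - h B\<bar> \<le> \<epsilon> / (2 * B0)"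
    using hausdorff_lucD[OF h, of "\<epsilon> / (2 * B0)" R] \<epsilon> B0 by (metis divide_pos_pos mult_pos_pos zero_less_numeral)
  have hB: "\<bar>h A\<bar> \<le> B0" if A: "compact A" "A \<noteq> {}" "A \<subseteq> cball 0 R" for A
  proof -
    have "set_radius A \<le> R" using A by (intro set_radius_le) auto
    then have "set_radius A powr s \<le> \<bar>R\<bar> powr s"
      using set_radius_nonneg[OF A(1,2)] s by (intro powr_mono2) auto
    then have "C * set_radius A powr s \<le> C * \<bar>R\<bar> powr s" using C by (rule mult_left_mono)
    with bound[OF A(1,2)] show ?thesis unfolding B0_def by linarith
  qed
  show "\<exists>\<delta>>0. \<forall>A B. compact A \<longrightarrow> A \<noteq> {} \<longrightarrow> A \<subseteq> cball 0 R \<longrightarrow>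
     compact B \<longrightarrow> B \<noteq> {} \<longrightarrow> B \<subseteq> cball 0 R \<longrightarrow> hausdorff_close \<delta> A B \<longrightarrow> \<bar>(h A)\<^sup>2 - (h B)\<^sup>2\<bar> \<le> \<epsilon>"
  proof (intro exI conjI allI impI)
    fix A B :: "'a set" assume AB: "compact A" "A \<noteq> {}" "A \<subseteq> cball 0 R" "compact B" "B \<noteq> {}" "B \<subseteq> cball 0 R" "hausdorff_close \<delta> A B"
    have "\<bar>(h A)\<^sup>2 - (h B)\<^sup>2\<bar> = \<bar>h A - h B\<bar> * \<bar>h A + h B\<bar>"
      unfolding abs_mult[symmetric] by (simp add: power2_eq_square algebra_simps)
    also have "\<dots> \<le> \<epsilon> / (2 * B0) * (2 * B0)"
      using \<delta>(2)[OF AB] hB[OF AB(1-3)] hB[OF AB(4-6)] \<epsilon> B0 by (intro mult_mono) auto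
    also have "\<dots> = \<epsilon>" using B0 by simp
    finally show "\<bar>(h A)\<^sup>2 - (h B)\<^sup>2\<bar> \<le> \<epsilon>" .
  qed (use \<delta> in simp)
qed

subsection \<open>The invariance principle\<close>

text \<open>Rounding down makes the first \<open>K\<close> blocks tile the times 1, ..., n exactly,
  starting at 0 and ending at \<open>n\<close>, also when \<open>K\<close> does not divide
  \<open>n\<close>.\<close>

definition grid_index :: "nat \<Rightarrow> nat \<Rightarrow> nat \<Rightarrow> nat" where
  "grid_index K n j = (j * n) div K"

definition grid_step :: "nat \<Rightarrow> nat \<Rightarrow> nat \<Rightarrow> nat" where
  "grid_step K n j = grid_index K n (Suc j) - grid_index K n j"

definition walk_block :: "(nat \<Rightarrow> 'a \<Rightarrow> 'b::real_vector) \<Rightarrow> nat \<Rightarrow> nat \<Rightarrow> nat \<Rightarrow> 'a \<Rightarrow> 'b" where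
  "walk_block Y K n j \<omega> = (1 / sqrt (real n)) *\<^sub>R
     (\<Sum>i\<in>{grid_index K n j<..grid_index K n j + grid_step K n j}. Y i \<omega>)"

text \<open>The bare points without linear interpolation, which would leave the convex hull
  unchanged; every functional of the walk then depends on finitely many random vectors.\<close>

definition scaled_walk :: "(nat \<Rightarrow> 'a \<Rightarrow> real^'n) \<Rightarrow> nat \<Rightarrow> 'a \<Rightarrow> (real^'n) set" where
  "scaled_walk Y n \<omega> = (\<lambda>k. (1 / sqrt (real n)) *\<^sub>R random_walk Y k \<omega>) ` {0..n}"

lemma grid_index_mono: "i \<le> j \<Longrightarrow> grid_index K n i \<le> grid_index K n j"
  by (auto simp: grid_index_def intro!: div_le_mono)

lemma grid_index_add_step: "grid_index K n j + grid_step K n j = grid_index K n (Suc j)"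
  using grid_index_mono[of j "Suc j" K n] by (simp add: grid_step_def)

lemma grid_index_bounds:
  assumes "K > 0"
  shows "real (grid_index K n j) \<le> real j * real n / real K" "real j * real n / real K - 1 < real (grid_index K n j)"
proof -
  have "real (j * n) / real K - 1 < real ((j * n) div K)" "real ((j * n) div K) \<le> real (j * n) / real K"
  proof -
    have "real ((j * n) div K) = real_of_int \<lfloor>real (j * n) / real K\<rfloor>"
      by (metis floor_divide_of_nat_eq of_int_of_nat_eq)
    then show "real (j * n) / real K - 1 < real ((j * n) div K)" "real ((j * n) div K) \<le> real (j * n) / real K"
      by linarith+
  qed
  then show "real (grid_index K n j) \<le> real j * real n / real K" "real j * real n / real K - 1 < real (grid_index K n j)"
    by (simp_all add: grid_index_def)
qed

lemma grid_step_bound: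
  assumes "K > 0"
  shows "\<bar>real (grid_step K n j) - real n / real K\<bar> \<le> 1"
proof -
  have "real (grid_step K n j) = real (grid_index K n (Suc j)) - real (grid_index K n j)"
    using grid_index_mono[of j "Suc j" K n] by (simp add: grid_step_def)
  moreover have "real (Suc j) * real n / real K = real j * real n / real K + real n / real K"
    by (simp add: distrib_right add_divide_distrib)
  ultimately show ?thesis
    using grid_index_bounds[OF assms, where n = n and j = j] grid_index_bounds[OF assms, where n = n and j = "Suc j"]
    unfolding abs_le_iff by linarith
qed

lemma grid_step_ratio_tendsto:
  assumes "K > 0"
  shows "(\<lambda>n. real (grid_step K n j) / real n) \<longlonglongrightarrow> 1 / real K"
proof (rule LIM_zero_cancel, rule Lim_null_comparison)
  show "eventually (\<lambda>n. norm (real (grid_step K n j) / real n - 1 / real K) \<le> 1 / real n) sequentially"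
    using eventually_gt_at_top[of 0]
  proof eventually_elim
    case (elim n)
    have "real (grid_step K n j) / real n - 1 / real K = (real (grid_step K n j) - real n / real K) / real n"
      using elim assms by (simp add: diff_divide_distrib)
    then show ?case using grid_step_bound[OF assms, of n j] elim by (simp add: divide_right_mono)
  qed
  show "(\<lambda>n. 1 / real n) \<longlonglongrightarrow> 0" by real_asymp
qed

lemma random_walk_add:
  "random_walk Y (a + l) \<omega> = random_walk Y a \<omega> + (\<Sum>i\<in>{a<..a + l}. Y i \<omega>)"
proof -
  have "{1..a + l} = {1..a} \<union> {a<..a + l}" by auto
  then show ?thesis unfolding random_walk_def by (simp only:) (subst sum.union_disjoint, auto)
qed

lemma sum_walk_block:
  assumes "K > 0"
  shows "(\<Sum>i<j. walk_block Y K n i \<omega>) = (1 / sqrt (real n)) *\<^sub>R random_walk Y (grid_index K n j) \<omega>"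
proof (induction j)
  case 0
  then show ?case by (simp add: grid_index_def random_walk_def)
next
  case (Suc j)
  then show ?case
    using random_walk_add[of Y "grid_index K n j" "grid_step K n j" \<omega>]
    by (simp add: walk_block_def grid_index_add_step scaleR_add_right)
qed

text \<open>Every position of the walk differs from the position at the start of its block by at
  most the maximum over that block, and every grid position is itself a position of the
  walk.\<close>

lemma walk_grid_close:
  fixes Y :: "nat \<Rightarrow> 'a \<Rightarrow> real^'n"
  assumes K: "K > 0" and n: "n > 0"
    and D: "\<And>j. j < K \<Longrightarrow> max_norm_sum Y (grid_index K n j) (grid_step K n j) \<omega> \<le> \<delta> * sqrt (real n)" and \<delta>: "\<delta> \<ge> 0"
  shows "hausdorff_close \<delta> (scaled_walk Y n \<omega>) ((\<lambda>j. \<Sum>i<j. walk_block Y K n i \<omega>) ` {0..K})"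
  unfolding hausdorff_close_def
proof (intro conjI ballI)
  let ?c = "1 / sqrt (real n)"
  fix a assume "a \<in> scaled_walk Y n \<omega>"
  then obtain k where k: "k \<le> n" "a = ?c *\<^sub>R random_walk Y k \<omega>" by (auto simp: scaled_walk_def)
  \<comment> \<open>The least block whose end reaches \<open>k\<close>. Minimality places
    \<open>k\<close> after the start of the block even if some blocks are empty, which happens for
    \<open>n < K\<close>.\<close>
  define j where "j = (LEAST j. k \<le> grid_index K n (Suc j))"
  have ex: "k \<le> grid_index K n (Suc (K - 1))" using K k by (simp add: grid_index_def)
  have jk: "k \<le> grid_index K n (Suc j)" unfolding j_def by (rule LeastI, rule ex)
  have "j \<le> K - 1" unfolding j_def by (rule Least_le, rule ex)
  then have jK: "j < K" using K by simp
  have kj: "grid_index K n j \<le> k"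
  proof (cases j)
    case 0
    then show ?thesis by (simp add: grid_index_def)
  next
    case (Suc i)
    then have "\<not> k \<le> grid_index K n (Suc i)" using not_less_Least[of i "\<lambda>j. k \<le> grid_index K n (Suc j)"] by (simp add: j_def)
    then show ?thesis using Suc by simp
  qed
  define l where "l = k - grid_index K n j"
  have l: "k = grid_index K n j + l" "l \<le> grid_step K n j" using kj jk by (auto simp: l_def grid_step_def)
  let ?b = "\<Sum>i<j. walk_block Y K n i \<omega>"
  have "a - ?b = ?c *\<^sub>R (\<Sum>i\<in>{grid_index K n j<..grid_index K n j + l}. Y i \<omega>)"
    unfolding sum_walk_block[OF K] k(2) l(1) random_walk_add by (simp add: scaleR_add_right)
  then have "dist a ?b = ?c * norm (\<Sum>i\<in>{grid_index K n j<..grid_index K n j + l}. Y i \<omega>)"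
    by (simp add: dist_norm)
  also have "\<dots> \<le> ?c * (\<delta> * sqrt (real n))"
    using order_trans[OF max_norm_sum_ge[OF l(2)] D[OF jK]] by (intro mult_left_mono) auto
  also have "\<dots> = \<delta>" using n by simp
  finally show "\<exists>b\<in>(\<lambda>j. \<Sum>i<j. walk_block Y K n i \<omega>) ` {0..K}. dist a b \<le> \<delta>"
    using jK by (intro bexI[of _ ?b]) auto
next
  let ?c = "1 / sqrt (real n)"
  fix b assume "b \<in> (\<lambda>j. \<Sum>i<j. walk_block Y K n i \<omega>) ` {0..K}"
  then obtain j where j: "j \<le> K" "b = ?c *\<^sub>R random_walk Y (grid_index K n j) \<omega>"
    by (auto simp: sum_walk_block[OF K])
  have "grid_index K n j \<le> n" using grid_index_mono[OF j(1), of K n] K by (simp add: grid_index_def)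
  then have "b \<in> scaled_walk Y n \<omega>" using j by (auto simp: scaled_walk_def)
  then show "\<exists>a\<in>scaled_walk Y n \<omega>. dist a b \<le> \<delta>" using \<delta> by (intro bexI[of _ b]) auto
qed

lemma compact_scaled_walk: "compact (scaled_walk Y n \<omega>)" "scaled_walk Y n \<omega> \<noteq> {}"
  by (auto simp: scaled_walk_def intro!: finite_imp_compact)

text \<open>The walk and the Brownian motion may live on different probability spaces, since only
  laws are compared. The exponent \<open>q\<close> is kept abstract and will be
  \<open>real m * p\<close>.\<close>

locale walk_and_limit =
  fixes M :: "'a measure" and N :: "'b measure"
    and Y :: "nat \<Rightarrow> 'a \<Rightarrow> real^'n" and X :: "real \<Rightarrow> 'b \<Rightarrow> real^'n" and q :: real
  assumes prob: "prob_space M"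
    and indep: "prob_space.indep_vars M (\<lambda>_. borel) Y {1..}"
    and distr: "\<And>i. i \<ge> 1 \<Longrightarrow> distr M borel (Y i) = distr M borel (Y 1)"
    and q: "q > 2"
    and moment: "integrable M (\<lambda>\<omega>. norm (Y 1 \<omega>) powr q)"
    and mean: "(\<integral>\<omega>. Y 1 \<omega> \<partial>M) = 0"
    and brownian: "brownian_motion N (second_moment_matrix M (Y 1)) X"
begin

sublocale M: prob_space M by (rule prob)

sublocale N: prob_space N using brownian by (simp add: brownian_motion_def)

lemma measurable_Y: "i \<ge> 1 \<Longrightarrow> Y i \<in> borel_measurable M"
  using indep by (auto simp: M.indep_vars_def)

lemma measurable_X: "t \<ge> 0 \<Longrightarrow> X t \<in> borel_measurable N"
  using brownian by (simp add: brownian_motion_def)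

lemma continuous_X: "\<omega> \<in> space N \<Longrightarrow> continuous_on {0..1} (\<lambda>t. X t \<omega>)"
  using brownian by (auto simp: brownian_motion_def intro: continuous_on_subset)

lemma measurable_random_walk: "random_walk Y k \<in> borel_measurable M"
  unfolding random_walk_def[abs_def] using measurable_Y by (intro borel_measurable_sum) auto

lemma measurable_walk_block: "walk_block Y K n j \<in> borel_measurable M"
  unfolding walk_block_def[abs_def] using measurable_Y
  by (intro borel_measurable_scaleR borel_measurable_const borel_measurable_sum) auto

lemma measurable_scaled_walk_functional:
  "hausdorff_luc \<Phi> \<Longrightarrow> (\<lambda>\<omega>. \<Phi> (scaled_walk Y n \<omega>)) \<in> borel_measurable M"
  unfolding scaled_walk_def using measurable_random_walk
  by (intro borel_measurable_hausdorff_luc_image borel_measurable_scaleR borel_measurable_const) auto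

lemma measurable_path_functional:
  "hausdorff_luc \<Phi> \<Longrightarrow> (\<lambda>\<omega>. \<Phi> ((\<lambda>t. X t \<omega>) ` {0..1})) \<in> borel_measurable N"
  by (intro borel_measurable_hausdorff_luc_path measurable_X continuous_X)

lemma moment_Y:
  assumes "i \<ge> 1"
  shows "integrable M (\<lambda>\<omega>. norm (Y i \<omega>) powr q)"
    "(\<integral>\<omega>. norm (Y i \<omega>) powr q \<partial>M) = (\<integral>\<omega>. norm (Y 1 \<omega>) powr q \<partial>M)"
    "(\<integral>\<omega>. Y i \<omega> \<partial>M) = 0"
proof -
  note m = measurable_Y[OF assms] and m1 = measurable_Y[OF order_refl]
  have "integrable (distr M borel (Y 1)) (\<lambda>y. norm y powr q)"
    using moment m1 by (subst integrable_distr_eq) auto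
  then show "integrable M (\<lambda>\<omega>. norm (Y i \<omega>) powr q)"
    unfolding distr[OF assms, symmetric] using m by (subst (asm) integrable_distr_eq) auto
  have "(\<integral>\<omega>. norm (Y i \<omega>) powr q \<partial>M) = (\<integral>y. norm y powr q \<partial>distr M borel (Y i))"
    using m by (subst integral_distr) auto
  also have "\<dots> = (\<integral>\<omega>. norm (Y 1 \<omega>) powr q \<partial>M)"
    unfolding distr[OF assms] using m1 by (subst integral_distr) auto
  finally show "(\<integral>\<omega>. norm (Y i \<omega>) powr q \<partial>M) = (\<integral>\<omega>. norm (Y 1 \<omega>) powr q \<partial>M)" .
  have "(\<integral>\<omega>. Y i \<omega> \<partial>M) = (\<integral>y. y \<partial>distr M borel (Y i))"
    using m by (subst integral_distr) auto
  also have "\<dots> = (\<integral>\<omega>. Y 1 \<omega> \<partial>M)"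
    unfolding distr[OF assms] using m1 by (subst integral_distr) auto
  finally show "(\<integral>\<omega>. Y i \<omega> \<partial>M) = 0" by (simp only: mean)
qed

lemma max_moment:
  obtains D where "D \<ge> 0" "\<And>a n. max_norm_sum Y a n \<in> borel_measurable M"
    "\<And>a n. integrable M (\<lambda>\<omega>. max_norm_sum Y a n \<omega> powr q)"
    "\<And>a n. (\<integral>\<omega>. max_norm_sum Y a n \<omega> powr q \<partial>M) \<le> D * real n powr (q / 2)"
  using M.max_norm_sum_moment_bound[OF q indep moment_Y(1) eq_refl[OF moment_Y(2)] moment_Y(3)] by blast

lemma second_moment: "integrable M (\<lambda>\<omega>. (norm (Y 1 \<omega>))\<^sup>2)"
proof (rule Bochner_Integration.integrable_bound)
  show "integrable M (\<lambda>\<omega>. 1 + norm (Y 1 \<omega>) powr q)" using moment by simp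
  have "(norm (Y 1 \<omega>))\<^sup>2 \<le> 1 + norm (Y 1 \<omega>) powr q" for \<omega>
    using powr_le_1_plus[of "norm (Y 1 \<omega>)" 2 q] q by (cases "Y 1 \<omega> = 0") (auto simp: powr_numeral)
  then show "AE \<omega> in M. norm ((norm (Y 1 \<omega>))\<^sup>2) \<le> norm (1 + norm (Y 1 \<omega>) powr q)"
    by (auto intro!: AE_I2 order_trans[OF _ abs_ge_self])
qed (use measurable_Y[of 1] in measurable)

lemma block_cf:
  assumes K: "K > 0"
  shows "(\<lambda>n. CLINT x|distr M borel (walk_block Y K n j). iexp (u \<bullet> x)) \<longlonglongrightarrow>
    (CLINT x|distr N borel (\<lambda>\<omega>. X (real (Suc j) / real K) \<omega> - X (real j / real K) \<omega>). iexp (u \<bullet> x))"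
proof -
  let ?\<Sigma> = "second_moment_matrix M (Y 1)"
  let ?s = "real j / real K" and ?t = "real (Suc j) / real K"
  have ts: "?t - ?s = 1 / real K" by (simp add: diff_divide_distrib[symmetric])
  have st: "0 \<le> ?s" "?s < ?t" using K by (auto simp: divide_strict_right_mono)
  have g: "centered_gaussian N ((1 / real K) *\<^sub>R ?\<Sigma>) (\<lambda>\<omega>. X ?t \<omega> - X ?s \<omega>)"
    using brownian st ts unfolding brownian_motion_def by metis
  have lin: "u \<bullet> (((1 / real K) *\<^sub>R ?\<Sigma>) *v u) = 1 / real K * (u \<bullet> (?\<Sigma> *v u))"
    by (simp add: scaleR_matrix_vector_assoc[symmetric])
  have "u \<bullet> (?\<Sigma> *v u) \<ge> 0"
    unfolding M.second_moment_matrix_inner[OF measurable_Y[OF order_refl] second_moment]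
    by (rule Bochner_Integration.integral_nonneg) simp
  then have "u \<bullet> (((1 / real K) *\<^sub>R ?\<Sigma>) *v u) \<ge> 0" unfolding lin by simp
  then have "(CLINT \<omega>|N. iexp (u \<bullet> (X ?t \<omega> - X ?s \<omega>))) = complex_of_real (exp (- (1 / real K * (u \<bullet> (?\<Sigma> *v u)) / 2)))"
    using centered_gaussian_cf[OF N.prob_space_axioms g, of u] unfolding lin by simp
  moreover have "(\<lambda>n. CLINT \<omega>|M. iexp (u \<bullet> walk_block Y K n j \<omega>)) \<longlonglongrightarrow>
      complex_of_real (exp (- (1 / real K * (u \<bullet> (?\<Sigma> *v u)) / 2)))"
    unfolding walk_block_def
    by (rule M.block_sum_cf_tendsto[OF indep distr second_moment mean grid_step_ratio_tendsto[OF K]])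
  moreover have "(CLINT x|distr M borel (walk_block Y K n j). iexp (u \<bullet> x)) = (CLINT \<omega>|M. iexp (u \<bullet> walk_block Y K n j \<omega>))" for n
    using measurable_walk_block by (subst integral_distr) auto
  moreover have "(CLINT x|distr N borel (\<lambda>\<omega>. X ?t \<omega> - X ?s \<omega>). iexp (u \<bullet> x)) = (CLINT \<omega>|N. iexp (u \<bullet> (X ?t \<omega> - X ?s \<omega>)))"
    using measurable_X[of ?t] measurable_X[of ?s] by (subst integral_distr) auto
  ultimately show ?thesis by simp
qed

lemma indep_walk_blocks: "M.indep_vars (\<lambda>_. borel) (walk_block Y K n) {..<K}"
proof -
  let ?I = "\<lambda>j. {grid_index K n j<..grid_index K n j + grid_step K n j}"
  have "disjoint_family_on ?I {..<K}"
    unfolding disjoint_family_on_def grid_index_add_step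
  proof (intro ballI impI)
    fix i j :: nat assume "i \<noteq> j"
    then consider "Suc i \<le> j" | "Suc j \<le> i" by linarith
    then show "{grid_index K n i<..grid_index K n (Suc i)} \<inter> {grid_index K n j<..grid_index K n (Suc j)} = {}"
    proof cases
      case 1
      from grid_index_mono[OF 1, of K n] show ?thesis by auto
    next
      case 2
      from grid_index_mono[OF 2, of K n] show ?thesis by auto
    qed
  qed
  then have "M.indep_vars (\<lambda>j. Pi\<^sub>M (?I j) (\<lambda>_. borel)) (\<lambda>j \<omega>. \<lambda>i\<in>?I j. Y i \<omega>) {..<K}"
    by (intro M.indep_vars_restrict[OF indep]) auto
  then have "M.indep_vars (\<lambda>_. borel) (\<lambda>j \<omega>. (1 / sqrt (real n)) *\<^sub>R (\<Sum>i\<in>?I j. (\<lambda>i\<in>?I j. Y i \<omega>) i)) {..<K}"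
    by (rule M.indep_vars_compose2) measurable
  then show ?thesis unfolding walk_block_def[abs_def] by simp
qed

lemma indep_increments: "N.indep_vars (\<lambda>_. borel) (\<lambda>j \<omega>. X (real (Suc j) / real K) \<omega> - X (real j / real K) \<omega>) {..<K}"
proof -
  have "mono (\<lambda>j. real j / real K)" by (intro monoI divide_right_mono) auto
  then have \<tau>: "0 \<le> real 0 / real K \<and> mono (\<lambda>j. real j / real K)" by simp
  have "\<forall>(k::nat) \<tau>. 0 \<le> \<tau> 0 \<and> mono \<tau> \<longrightarrow>
      N.indep_vars (\<lambda>_. borel) (\<lambda>i \<omega>. X (\<tau> (Suc i)) \<omega> - X (\<tau> i) \<omega>) {..<k}"
    using brownian unfolding brownian_motion_def by (elim conjE)
  from this[rule_format, OF \<tau>] show ?thesis .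
qed

text \<open>Expresses the functional through increments rather than positions: increments are
  independent on both sides, so their joint laws are product measures.\<close>

definition partial_sums_functional :: "((real^'n) set \<Rightarrow> real) \<Rightarrow> nat \<Rightarrow> (nat \<Rightarrow> real^'n) \<Rightarrow> real" where
  "partial_sums_functional \<Phi> K x = \<Phi> ((\<lambda>j. \<Sum>i<j. x i) ` {0..K})"

lemma integral_partial_sums_functional:
  fixes \<xi> :: "nat \<Rightarrow> 'c \<Rightarrow> real^'n"
  assumes R: "prob_space R" and K: "K > 0" and \<xi>: "\<And>j. \<xi> j \<in> borel_measurable R"
    and ind: "prob_space.indep_vars R (\<lambda>_. borel) \<xi> {..<K}"
    and m: "partial_sums_functional \<Phi> K \<in> borel_measurable (\<Pi>\<^sub>M i\<in>{..<K}. borel)"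
  shows "(\<integral>\<omega>. partial_sums_functional \<Phi> K (\<lambda>j. \<xi> j \<omega>) \<partial>R) =
    (\<integral>x. partial_sums_functional \<Phi> K x \<partial>PiM {..<K} (\<lambda>j. distr R borel (\<xi> j)))"
proof -
  interpret R: prob_space R by fact
  have "{..<K} \<noteq> {}" using K by auto
  then have eq: "distr R (\<Pi>\<^sub>M i\<in>{..<K}. borel) (\<lambda>\<omega>. \<lambda>i\<in>{..<K}. \<xi> i \<omega>) = PiM {..<K} (\<lambda>j. distr R borel (\<xi> j))"
    using R.indep_vars_iff_distr_eq_PiM[of "{..<K}" \<xi> "\<lambda>_. borel"] \<xi> ind by simp
  have meas: "(\<lambda>\<omega>. \<lambda>i\<in>{..<K}. \<xi> i \<omega>) \<in> R \<rightarrow>\<^sub>M (\<Pi>\<^sub>M i\<in>{..<K}. borel)"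
    using \<xi> by (intro measurable_restrict)
  have "(\<integral>x. partial_sums_functional \<Phi> K x \<partial>PiM {..<K} (\<lambda>j. distr R borel (\<xi> j))) =
      (\<integral>\<omega>. partial_sums_functional \<Phi> K (\<lambda>i\<in>{..<K}. \<xi> i \<omega>) \<partial>R)"
    unfolding eq[symmetric] by (rule integral_distr[OF meas m])
  also have "\<dots> = (\<integral>\<omega>. partial_sums_functional \<Phi> K (\<lambda>j. \<xi> j \<omega>) \<partial>R)"
    unfolding partial_sums_functional_def
    by (intro Bochner_Integration.integral_cong refl arg_cong[where f = \<Phi>] image_cong sum.cong) auto
  finally show ?thesis by simp
qed

lemma measurable_partial_sums_functional:
  assumes "hausdorff_luc \<Phi>"
  shows "partial_sums_functional \<Phi> K \<in> borel_measurable (\<Pi>\<^sub>M i\<in>{..<K}. borel)"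
  unfolding partial_sums_functional_def[abs_def]
proof (rule borel_measurable_hausdorff_luc_image[OF assms])
  fix j assume "j \<in> {0..K}"
  then show "(\<lambda>x :: nat \<Rightarrow> real^'n. \<Sum>i<j. x i) \<in> borel_measurable (\<Pi>\<^sub>M i\<in>{..<K}. borel)"
    by (intro borel_measurable_sum measurable_component_singleton) auto
qed auto

text \<open>Changing one increment shifts each partial sum either by \<open>y - z\<close> or not at
  all, so the Hausdorff modulus becomes a modulus in each coordinate that depends neither on
  \<open>K\<close> nor on the other increments.\<close>

lemma partial_sums_functional_close:
  fixes \<Phi> :: "(real^'n) set \<Rightarrow> real"
  assumes \<Phi>: "\<And>A B. compact A \<Longrightarrow> A \<noteq> {} \<Longrightarrow> compact B \<Longrightarrow> B \<noteq> {} \<Longrightarrow> hausdorff_close \<delta> A B \<Longrightarrow> \<bar>\<Phi> A - \<Phi> B\<bar> \<le> \<epsilon>"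
    and "\<delta> \<ge> 0" "dist y z \<le> \<delta>"
  shows "\<bar>partial_sums_functional \<Phi> K (x(i := y)) - partial_sums_functional \<Phi> K (x(i := z))\<bar> \<le> \<epsilon>"
  unfolding partial_sums_functional_def
proof (intro \<Phi> hausdorff_close_images)
  fix j
  have "(\<Sum>k<j. (x(i := y)) k) - (\<Sum>k<j. (x(i := z)) k) = (\<Sum>k<j. if k = i then y - z else 0)"
    unfolding sum_subtractf[symmetric] by (intro sum.cong) auto
  then have "dist (\<Sum>k<j. (x(i := y)) k) (\<Sum>k<j. (x(i := z)) k) = norm (if i < j then y - z else 0)"
    by (simp add: dist_norm)
  then show "dist (\<Sum>k<j. (x(i := y)) k) (\<Sum>k<j. (x(i := z)) k) \<le> \<delta>"
    using assms(2,3) by (simp add: dist_norm)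
qed (auto intro!: finite_imp_compact)

text \<open>For a fixed grid both sides integrate the same function over products of
  \<open>K\<close> laws, which are eventually close coordinate by coordinate by the central limit
  theorem for blocks.\<close>

lemma grid_functional_tendsto:
  fixes \<Phi> :: "(real^'n) set \<Rightarrow> real"
  assumes \<Phi>: "hausdorff_uc \<Phi>" and bound: "\<And>A. compact A \<Longrightarrow> A \<noteq> {} \<Longrightarrow> \<bar>\<Phi> A\<bar> \<le> 1" and K: "K > 0"
  shows "(\<lambda>n. \<integral>\<omega>. \<Phi> ((\<lambda>j. \<Sum>i<j. walk_block Y K n i \<omega>) ` {0..K}) \<partial>M) \<longlonglongrightarrow>
    (\<integral>\<omega>. \<Phi> ((\<lambda>j. X (real j / real K) \<omega>) ` {0..K}) \<partial>N)"
proof -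
  let ?\<zeta> = "\<lambda>j \<omega>. X (real (Suc j) / real K) \<omega> - X (real j / real K) \<omega>"
  let ?g = "partial_sums_functional \<Phi> K"
  let ?P = "\<lambda>n j. distr M borel (walk_block Y K n j)" and ?Q = "\<lambda>j. distr N borel (?\<zeta> j)"
  note luc = hausdorff_uc_imp_luc[OF \<Phi>]
  note gm = measurable_partial_sums_functional[OF luc, of K]
  have \<zeta>m: "?\<zeta> j \<in> borel_measurable N" for j
    using measurable_X[of "real (Suc j) / real K"] measurable_X[of "real j / real K"] by auto
  have walk: "(\<integral>\<omega>. \<Phi> ((\<lambda>j. \<Sum>i<j. walk_block Y K n i \<omega>) ` {0..K}) \<partial>M) = (\<integral>x. ?g x \<partial>PiM {..<K} (?P n))" for n
    using integral_partial_sums_functional[OF prob K measurable_walk_block indep_walk_blocks gm, of n]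
    by (simp add: partial_sums_functional_def)
  have path: "(\<integral>\<omega>. \<Phi> ((\<lambda>j. X (real j / real K) \<omega>) ` {0..K}) \<partial>N) = (\<integral>x. ?g x \<partial>PiM {..<K} ?Q)"
  proof -
    have "(\<integral>\<omega>. \<Phi> ((\<lambda>j. X (real j / real K) \<omega>) ` {0..K}) \<partial>N) = (\<integral>\<omega>. ?g (\<lambda>j. ?\<zeta> j \<omega>) \<partial>N)"
    proof (rule integral_cong_AE)
      show "(\<lambda>\<omega>. \<Phi> ((\<lambda>j. X (real j / real K) \<omega>) ` {0..K})) \<in> borel_measurable N"
        using measurable_X by (intro borel_measurable_hausdorff_luc_image luc) auto
      show "(\<lambda>\<omega>. ?g (\<lambda>j. ?\<zeta> j \<omega>)) \<in> borel_measurable N"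
        unfolding partial_sums_functional_def using \<zeta>m
        by (intro borel_measurable_hausdorff_luc_image luc borel_measurable_sum) auto
      \<comment> \<open>The path starts at the origin only almost surely, so the increments
        telescope to the path values only almost surely.\<close>
      have "AE \<omega> in N. X 0 \<omega> = 0" using brownian by (simp add: brownian_motion_def)
      then show "AE \<omega> in N. \<Phi> ((\<lambda>j. X (real j / real K) \<omega>) ` {0..K}) = ?g (\<lambda>j. ?\<zeta> j \<omega>)"
      proof eventually_elim
        case (elim \<omega>)
        have "(\<Sum>i<j. ?\<zeta> i \<omega>) = X (real j / real K) \<omega>" for j
          using sum_lessThan_telescope[of "\<lambda>j. X (real j / real K) \<omega>" j] elim by simp
        then show ?case by (simp add: partial_sums_functional_def)
      qed
    qed
    also have "\<dots> = (\<integral>x. ?g x \<partial>PiM {..<K} ?Q)"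
      by (rule integral_partial_sums_functional[OF N.prob_space_axioms K \<zeta>m indep_increments gm])
    finally show ?thesis .
  qed
  have gb: "\<bar>?g x\<bar> \<le> 1" for x
    unfolding partial_sums_functional_def by (intro bound finite_imp_compact) auto
  show ?thesis unfolding walk path
  proof (rule tendstoI)
    fix e :: real assume e: "e > 0"
    \<comment> \<open>Each of the \<open>K\<close> replacements costs \<open>5 * \<eta>\<close>, a
      total of \<open>e / 2\<close>.\<close>
    define \<eta> where "\<eta> = e / (10 * real K)"
    have \<eta>: "\<eta> > 0" "real K * (5 * \<eta>) < e" using e K by (auto simp: \<eta>_def field_simps)
    obtain \<delta> where \<delta>: "\<delta> > 0" "\<And>A B. compact A \<Longrightarrow> A \<noteq> {} \<Longrightarrow> compact B \<Longrightarrow> B \<noteq> {} \<Longrightarrow>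
       hausdorff_close \<delta> A B \<Longrightarrow> \<bar>\<Phi> A - \<Phi> B\<bar> \<le> \<eta>"
      using hausdorff_ucD[OF \<Phi> \<eta>(1)] by metis
    have "eventually (\<lambda>n. \<forall>j\<in>{..<K}. measures_close (5 * \<eta>) \<delta> \<eta> (?P n j) (?Q j)) sequentially"
    proof (intro eventually_ball_finite ballI measures_close_eventually block_cf K \<delta>(1) \<eta>(1))
      show "prob_space (?P n j)" for n j by (intro M.prob_space_distr measurable_walk_block)
      show "prob_space (?Q j)" for j by (intro N.prob_space_distr \<zeta>m)
    qed auto
    then show "eventually (\<lambda>n. dist (\<integral>x. ?g x \<partial>PiM {..<K} (?P n)) (\<integral>x. ?g x \<partial>PiM {..<K} ?Q) < e) sequentially"
    proof eventually_elim
      case (elim n)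
      have "\<bar>(\<integral>x. ?g x \<partial>PiM {..<K} (?P n)) - (\<integral>x. ?g x \<partial>PiM {..<K} ?Q)\<bar> \<le> real (card {..<K}) * (5 * \<eta>)"
      proof (rule PiM_measures_close[where \<delta> = \<delta> and \<eta> = \<eta>])
        show "prob_space (?P n j)" for j by (intro M.prob_space_distr measurable_walk_block)
        show "prob_space (?Q j)" for j by (intro N.prob_space_distr \<zeta>m)
        show "\<bar>?g (x(i := y)) - ?g (x(i := z))\<bar> \<le> \<eta>" if "dist y z \<le> \<delta>" for x i y z
          using \<delta> that by (intro partial_sums_functional_close[where \<delta> = \<delta>]) auto
      qed (use elim gm gb in auto)
      then show ?case using \<eta> by (simp add: dist_real_def)
    qed
  qed
qed

text \<open>
  An invariance principle: compare the walk with its values at \<open>K\<close> equidistant times, uniformly in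
  \<open>n\<close>, and pass to the limit \<open>n \<longlonglongrightarrow> \<infinity>\<close> for fixed \<open>K\<close>. The comparison uses that \<open>q > 2\<close>.
\<close>

lemma functional_tendsto:
  fixes \<Phi> :: "(real^'n) set \<Rightarrow> real"
  assumes \<Phi>: "hausdorff_uc \<Phi>" and bound: "\<And>A. compact A \<Longrightarrow> A \<noteq> {} \<Longrightarrow> \<bar>\<Phi> A\<bar> \<le> 1"
  shows "(\<lambda>n. \<integral>\<omega>. \<Phi> (scaled_walk Y n \<omega>) \<partial>M) \<longlonglongrightarrow> (\<integral>\<omega>. \<Phi> ((\<lambda>t. X t \<omega>) ` {0..1}) \<partial>N)"
proof (rule tendstoI)
  fix e :: real assume e: "e > 0"
  note luc = hausdorff_uc_imp_luc[OF \<Phi>]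
  obtain D where D: "D \<ge> 0" "\<And>a n. max_norm_sum Y a n \<in> borel_measurable M"
    "\<And>a n. integrable M (\<lambda>\<omega>. max_norm_sum Y a n \<omega> powr q)"
    "\<And>a n. (\<integral>\<omega>. max_norm_sum Y a n \<omega> powr q \<partial>M) \<le> D * real n powr (q / 2)"
    using max_moment by metis
  \<comment> \<open>Four errors: two from comparing the walk with its grid (small block maxima,
    large block maxima), one for the limit in \<open>n\<close>, one for refining the grid of the
    path.\<close>
  define \<epsilon> where "\<epsilon> = e / 4"
  have \<epsilon>: "\<epsilon> > 0" using e by (simp add: \<epsilon>_def)
  obtain \<delta> where \<delta>: "\<delta> > 0" "\<And>A B. compact A \<Longrightarrow> A \<noteq> {} \<Longrightarrow> compact B \<Longrightarrow> B \<noteq> {} \<Longrightarrow>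
     hausdorff_close \<delta> A B \<Longrightarrow> \<bar>\<Phi> A - \<Phi> B\<bar> \<le> \<epsilon>"
    using hausdorff_ucD[OF \<Phi> \<epsilon>] by metis
  let ?\<alpha> = "\<lambda>K. \<integral>\<omega>. \<Phi> ((\<lambda>j. X (real j / real K) \<omega>) ` {0..K}) \<partial>N"
  let ?lim = "\<integral>\<omega>. \<Phi> ((\<lambda>t. X t \<omega>) ` {0..1}) \<partial>N"
  let ?a = "\<lambda>n. \<integral>\<omega>. \<Phi> (scaled_walk Y n \<omega>) \<partial>M"
  let ?G = "\<lambda>K n \<omega>. (\<lambda>j. \<Sum>i<j. walk_block Y K n i \<omega>) ` {0..K}"
  have lim\<alpha>: "?\<alpha> \<longlonglongrightarrow> ?lim"
  proof (rule integral_dominated_convergence[where w = "\<lambda>_. 1"])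
    show "(\<lambda>\<omega>. \<Phi> ((\<lambda>t. X t \<omega>) ` {0..1})) \<in> borel_measurable N" by (rule measurable_path_functional[OF luc])
    show "(\<lambda>\<omega>. \<Phi> ((\<lambda>j. X (real j / real K) \<omega>) ` {0..K})) \<in> borel_measurable N" for K
      using measurable_X by (intro borel_measurable_hausdorff_luc_image luc) auto
    show "AE \<omega> in N. (\<lambda>K. \<Phi> ((\<lambda>j. X (real j / real K) \<omega>) ` {0..K})) \<longlonglongrightarrow> \<Phi> ((\<lambda>t. X t \<omega>) ` {0..1})"
      using hausdorff_luc_grid_tendsto[OF luc continuous_X] by (intro AE_I2) simp
    show "AE \<omega> in N. norm (\<Phi> ((\<lambda>j. X (real j / real K) \<omega>) ` {0..K})) \<le> 1" for K
      by (intro AE_I2) (simp add: bound finite_imp_compact)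
  qed simp
  \<comment> \<open>Collects the Markov bound over \<open>K\<close> blocks: oscillation 2 of the
    functional, moment \<open>D * (2 * n / K) powr (q / 2)\<close> per block, threshold
    \<open>\<delta> * sqrt n\<close>. The powers of \<open>n\<close> cancel and
    \<open>K powr (1 - q / 2)\<close> remains.\<close>
  define c where "c = 2 * D * 2 powr (q / 2) / \<delta> powr q"
  have "(\<lambda>K. c * real K powr (1 - q / 2)) \<longlonglongrightarrow> c * 0"
    using q by (intro tendsto_mult tendsto_const tendsto_neg_powr filterlim_real_sequentially) auto
  then have "eventually (\<lambda>K. c * real K powr (1 - q / 2) < \<epsilon>) sequentially"
    using \<epsilon> by (intro order_tendstoD(2)) auto
  moreover have "eventually (\<lambda>K. dist (?\<alpha> K) ?lim < \<epsilon>) sequentially"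
    using lim\<alpha> \<epsilon> by (rule tendstoD)
  ultimately have "eventually (\<lambda>K. c * real K powr (1 - q / 2) < \<epsilon> \<and> dist (?\<alpha> K) ?lim < \<epsilon> \<and> K > 0) sequentially"
    using eventually_gt_at_top[of 0] by eventually_elim simp
  then obtain K where K: "c * real K powr (1 - q / 2) < \<epsilon>" "dist (?\<alpha> K) ?lim < \<epsilon>" "K > 0"
    by (metis (mono_tags, lifting) eventually_sequentially order_refl)
  have comp: "\<bar>?a n - (\<integral>\<omega>. \<Phi> (?G K n \<omega>) \<partial>M)\<bar> \<le> \<epsilon> + c * real K powr (1 - q / 2)" if n: "n \<ge> K" for n
  proof -
    have n0: "n > 0" using n K by simp
    let ?D = "\<lambda>j \<omega>. max_norm_sum Y (grid_index K n j) (grid_step K n j) \<omega>"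
    let ?s = "(\<delta> * sqrt (real n)) powr q"
    have s: "?s > 0" "?s = \<delta> powr q * real n powr (q / 2)"
      using \<delta> n0 by (auto simp: powr_mult powr_half_sqrt[symmetric] powr_powr)
    have fin: "compact (?G K n \<omega>)" "?G K n \<omega> \<noteq> {}" for \<omega> by (auto intro: finite_imp_compact)
    \<comment> \<open>Markov's inequality in pointwise form: if some block maximum exceeds the
      threshold, the second summand alone is at least 2.\<close>
    have pt: "\<bar>\<Phi> (scaled_walk Y n \<omega>) - \<Phi> (?G K n \<omega>)\<bar> \<le> \<epsilon> + 2 / ?s * (\<Sum>j<K. ?D j \<omega> powr q)" for \<omega>
    proof (cases "\<forall>j<K. ?D j \<omega> \<le> \<delta> * sqrt (real n)")
      case True
      then have "\<bar>\<Phi> (scaled_walk Y n \<omega>) - \<Phi> (?G K n \<omega>)\<bar> \<le> \<epsilon>"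
        using \<delta> K n0 by (intro \<delta>(2) compact_scaled_walk fin walk_grid_close) auto
      moreover have "0 \<le> 2 / ?s * (\<Sum>j<K. ?D j \<omega> powr q)"
        by (intro mult_nonneg_nonneg sum_nonneg) auto
      ultimately show ?thesis by linarith
    next
      case False
      then obtain j where j: "j < K" "?D j \<omega> > \<delta> * sqrt (real n)" by force
      have "?s \<le> ?D j \<omega> powr q" using j q \<delta> by (intro powr_mono2) auto
      also have "\<dots> \<le> (\<Sum>j<K. ?D j \<omega> powr q)" using j by (intro member_le_sum) auto
      finally have "2 \<le> 2 / ?s * (\<Sum>j<K. ?D j \<omega> powr q)" using s(1) by (simp add: field_simps)
      moreover have "\<bar>\<Phi> (scaled_walk Y n \<omega>) - \<Phi> (?G K n \<omega>)\<bar> \<le> 2"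
        using bound[OF compact_scaled_walk, of Y n \<omega>] bound[OF fin, of \<omega>] by linarith
      ultimately show ?thesis using \<epsilon> by linarith
    qed
    have i1: "integrable M (\<lambda>\<omega>. \<Phi> (scaled_walk Y n \<omega>))"
      by (intro M.integrable_const_bound[of _ 1] AE_I2 measurable_scaled_walk_functional luc)
        (simp only: real_norm_def bound[OF compact_scaled_walk])
    have i2: "integrable M (\<lambda>\<omega>. \<Phi> (?G K n \<omega>))"
      using bound[OF fin] measurable_walk_block
      by (intro M.integrable_const_bound[of _ 1] borel_measurable_hausdorff_luc_image luc borel_measurable_sum) auto
    have i3: "integrable M (\<lambda>\<omega>. \<epsilon> + 2 / ?s * (\<Sum>j<K. ?D j \<omega> powr q))"
      by (intro Bochner_Integration.integrable_add integrable_mult_right Bochner_Integration.integrable_sum D(3)) simp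
    have step: "(\<integral>\<omega>. ?D j \<omega> powr q \<partial>M) \<le> D * (2 * real n / real K) powr (q / 2)" for j
    proof -
      \<comment> \<open>For \<open>n \<ge> K\<close> the rounding error of at most 1 is absorbed by
        \<open>n / K\<close>.\<close>
      have "real (grid_step K n j) \<le> 2 * real n / real K"
      proof -
        have "1 \<le> real n / real K" using n K by (simp add: field_simps)
        then show ?thesis using grid_step_bound[OF K(3), of n j] by simp
      qed
      then have "D * real (grid_step K n j) powr (q / 2) \<le> D * (2 * real n / real K) powr (q / 2)"
        using D q by (intro mult_left_mono powr_mono2) auto
      then show ?thesis using D(4)[of "grid_index K n j" "grid_step K n j"] by linarith
    qed
    have "\<bar>?a n - (\<integral>\<omega>. \<Phi> (?G K n \<omega>) \<partial>M)\<bar> = \<bar>\<integral>\<omega>. \<Phi> (scaled_walk Y n \<omega>) - \<Phi> (?G K n \<omega>) \<partial>M\<bar>"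
      using i1 i2 by simp
    also have "\<dots> \<le> (\<integral>\<omega>. \<bar>\<Phi> (scaled_walk Y n \<omega>) - \<Phi> (?G K n \<omega>)\<bar> \<partial>M)" by (rule integral_abs_bound)
    also have "\<dots> \<le> (\<integral>\<omega>. \<epsilon> + 2 / ?s * (\<Sum>j<K. ?D j \<omega> powr q) \<partial>M)"
      using i1 i2 i3 pt by (intro integral_mono integrable_abs) auto
    also have "\<dots> = \<epsilon> + 2 / ?s * (\<Sum>j<K. (\<integral>\<omega>. ?D j \<omega> powr q \<partial>M))"
      using D(3) by (simp add: M.prob_space Bochner_Integration.integral_sum)
    also have "\<dots> \<le> \<epsilon> + 2 / ?s * (\<Sum>j<K. D * (2 * real n / real K) powr (q / 2))"
      using step by (intro add_left_mono mult_left_mono sum_mono) auto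
    also have "2 / ?s * (\<Sum>j<K. D * (2 * real n / real K) powr (q / 2)) = c * real K powr (1 - q / 2)"
    proof -
      have "(2 * real n / real K) powr (q / 2) = 2 powr (q / 2) * real n powr (q / 2) / real K powr (q / 2)"
        by (simp add: powr_divide powr_mult)
      moreover have "real K powr (1 - q / 2) = real K / real K powr (q / 2)"
        using K by (simp add: powr_diff)
      ultimately show ?thesis using n0 \<delta> unfolding s(2) c_def by (simp add: field_simps)
    qed
    finally show ?thesis .
  qed
  have "eventually (\<lambda>n. dist (\<integral>\<omega>. \<Phi> (?G K n \<omega>) \<partial>M) (?\<alpha> K) < \<epsilon>) sequentially"
    by (rule tendstoD[OF grid_functional_tendsto[OF \<Phi> bound K(3)] \<epsilon>])
  then show "eventually (\<lambda>n. dist (?a n) ?lim < e) sequentially"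
    using eventually_ge_at_top[of K]
  proof eventually_elim
    case (elim n)
    have "\<bar>?a n - ?lim\<bar> < 4 * \<epsilon>"
      using comp[OF elim(2)] elim(1) K(1,2) unfolding dist_real_def by linarith
    then show ?case by (simp add: dist_real_def \<epsilon>_def)
  qed
qed

end

section \<open>Moments of the radius and unbounded functionals\<close>

context walk_and_limit
begin

definition path_set :: "'b \<Rightarrow> (real^'n) set" where
  "path_set \<omega> = (\<lambda>t. X t \<omega>) ` {0..1}"

lemma compact_path_set: "\<omega> \<in> space N \<Longrightarrow> compact (path_set \<omega>)" and path_set_nonempty: "path_set \<omega> \<noteq> {}"
  unfolding path_set_def by (auto intro!: compact_continuous_image continuous_X)

lemma measurable_path_set_functional:
  "hausdorff_luc \<Phi> \<Longrightarrow> (\<lambda>\<omega>. \<Phi> (path_set \<omega>)) \<in> borel_measurable N"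
  unfolding path_set_def by (rule measurable_path_functional)

lemma hausdorff_luc_set_radius: "hausdorff_luc (set_radius :: (real^'n) set \<Rightarrow> real)"
  unfolding hausdorff_luc_def using set_radius_hausdorff_close by blast

lemma set_radius_scaled_walk_le: "set_radius (scaled_walk Y n \<omega>) \<le> max_norm_sum Y 0 n \<omega> / sqrt (real n)"
proof (rule set_radius_le)
  fix a assume "a \<in> scaled_walk Y n \<omega>"
  then obtain k where k: "k \<le> n" "a = (1 / sqrt (real n)) *\<^sub>R random_walk Y k \<omega>" by (auto simp: scaled_walk_def)
  have "random_walk Y k \<omega> = (\<Sum>i\<in>{0<..0 + k}. Y i \<omega>)"
    unfolding random_walk_def by (intro sum.cong) auto
  then have "norm (random_walk Y k \<omega>) \<le> max_norm_sum Y 0 n \<omega>"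
    using max_norm_sum_ge[OF k(1), where Y = Y and a = 0 and \<omega> = \<omega>] by simp
  then show "norm a \<le> max_norm_sum Y 0 n \<omega> / sqrt (real n)"
    unfolding k(2) by (simp add: divide_right_mono)
qed (rule compact_scaled_walk)

lemma radius_moment_walk:
  obtains D where "D \<ge> 0" "\<And>n. integrable M (\<lambda>\<omega>. set_radius (scaled_walk Y n \<omega>) powr q)"
    "\<And>n. (\<integral>\<omega>. set_radius (scaled_walk Y n \<omega>) powr q \<partial>M) \<le> D"
proof -
  obtain D where D: "D \<ge> 0" "\<And>a n. max_norm_sum Y a n \<in> borel_measurable M"
    "\<And>a n. integrable M (\<lambda>\<omega>. max_norm_sum Y a n \<omega> powr q)"
    "\<And>a n. (\<integral>\<omega>. max_norm_sum Y a n \<omega> powr q \<partial>M) \<le> D * real n powr (q / 2)"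
    using max_moment by metis
  let ?c = "\<lambda>n. 1 / sqrt (real n) powr q"
  have le: "set_radius (scaled_walk Y n \<omega>) powr q \<le> ?c n * max_norm_sum Y 0 n \<omega> powr q" for n \<omega>
  proof -
    have "set_radius (scaled_walk Y n \<omega>) powr q \<le> (max_norm_sum Y 0 n \<omega> / sqrt (real n)) powr q"
      using q by (intro powr_mono2 set_radius_scaled_walk_le set_radius_nonneg compact_scaled_walk) auto
    also have "\<dots> = ?c n * max_norm_sum Y 0 n \<omega> powr q"
      by (simp add: powr_divide)
    finally show ?thesis .
  qed
  have int: "integrable M (\<lambda>\<omega>. set_radius (scaled_walk Y n \<omega>) powr q)" for n
  proof (rule Bochner_Integration.integrable_bound)
    show "integrable M (\<lambda>\<omega>. ?c n * max_norm_sum Y 0 n \<omega> powr q)" by (intro integrable_mult_right D)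
    show "AE \<omega> in M. norm (set_radius (scaled_walk Y n \<omega>) powr q) \<le> norm (?c n * max_norm_sum Y 0 n \<omega> powr q)"
      using le by (intro AE_I2) (auto intro: order_trans[OF _ abs_ge_self])
    show "(\<lambda>\<omega>. set_radius (scaled_walk Y n \<omega>) powr q) \<in> borel_measurable M"
      using measurable_scaled_walk_functional[OF hausdorff_luc_set_radius] by measurable
  qed
  have "(\<integral>\<omega>. set_radius (scaled_walk Y n \<omega>) powr q \<partial>M) \<le> D" for n
  proof -
    have "(\<integral>\<omega>. set_radius (scaled_walk Y n \<omega>) powr q \<partial>M) \<le> (\<integral>\<omega>. ?c n * max_norm_sum Y 0 n \<omega> powr q \<partial>M)"
      by (intro integral_mono int le integrable_mult_right D)
    also have "\<dots> = ?c n * (\<integral>\<omega>. max_norm_sum Y 0 n \<omega> powr q \<partial>M)" by simp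
    also have "\<dots> \<le> ?c n * (D * real n powr (q / 2))" by (intro mult_left_mono D) auto
    \<comment> \<open>The normalisation cancels \<open>n powr (q / 2)\<close>; for
      \<open>n = 0\<close> the prefactor is 0 by the convention for division.\<close>
    also have "\<dots> \<le> D"
      using D(1) by (cases "n = 0") (auto simp: powr_half_sqrt[symmetric] powr_powr)
    finally show ?thesis .
  qed
  with D(1) int show thesis using that by blast
qed

text \<open>The moment bound is transferred from the walk as in Fatou's lemma: truncated powers of
  the radius are admissible test functionals, their means converge and stay below \<open>D\<close>,
  and monotone convergence removes the truncation.\<close>

lemma radius_moment_path:
  assumes D: "D \<ge> 0" "\<And>n. integrable M (\<lambda>\<omega>. set_radius (scaled_walk Y n \<omega>) powr q)"
    "\<And>n. (\<integral>\<omega>. set_radius (scaled_walk Y n \<omega>) powr q \<partial>M) \<le> D"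
  shows "integrable N (\<lambda>\<omega>. set_radius (path_set \<omega>) powr q)" "(\<integral>\<omega>. set_radius (path_set \<omega>) powr q \<partial>N) \<le> D"
proof -
  note rm = measurable_path_set_functional[OF hausdorff_luc_set_radius]
  define r where "r \<omega> = set_radius (path_set \<omega>)" for \<omega>
  have r0: "r \<omega> \<ge> 0" if "\<omega> \<in> space N" for \<omega>
    unfolding r_def using that by (intro set_radius_nonneg compact_path_set path_set_nonempty)
  have [measurable]: "r \<in> borel_measurable N" unfolding r_def[abs_def] by (rule rm)
  have trunc: "(\<integral>\<^sup>+\<omega>. ennreal (min (r \<omega>) (real (Suc k)) powr q) \<partial>N) \<le> ennreal D" for k
  proof -
    define L where "L = real (Suc k)"
    have L: "L > 0" by (simp add: L_def)
    \<comment> \<open>Dividing by \<open>L\<close> gives a functional bounded by 1, as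
      \<open>functional_tendsto\<close> requires.\<close>
    let ?\<Phi> = "\<lambda>A :: (real^'n) set. (min (set_radius A) L / L) powr q"
    have uc: "hausdorff_uc ?\<Phi>"
      using L q by (intro hausdorff_uc_set_radius_comp continuous_on_powr' continuous_intros) auto
    have b: "\<bar>?\<Phi> A\<bar> \<le> 1" if "compact A" "A \<noteq> {}" for A
    proof -
      have "min (set_radius A) L / L \<ge> 0" "min (set_radius A) L / L \<le> 1"
        using set_radius_nonneg[OF that] L by auto
      then show ?thesis using q powr_le1[of q "min (set_radius A) L / L"] by simp
    qed
    have scale: "?\<Phi> A = (1 / L powr q) * min (set_radius A) L powr q" for A
      by (simp add: powr_divide)
    have bn: "(\<integral>\<omega>. ?\<Phi> (scaled_walk Y n \<omega>) \<partial>M) \<le> D / L powr q" for n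
    proof -
      have "(\<integral>\<omega>. ?\<Phi> (scaled_walk Y n \<omega>) \<partial>M) \<le> (\<integral>\<omega>. (1 / L powr q) * set_radius (scaled_walk Y n \<omega>) powr q \<partial>M)"
      proof (intro integral_mono integrable_mult_right D)
        show "integrable M (\<lambda>\<omega>. ?\<Phi> (scaled_walk Y n \<omega>))"
          by (intro M.integrable_const_bound[of _ 1] AE_I2 measurable_scaled_walk_functional hausdorff_uc_imp_luc uc)
            (simp only: real_norm_def b[OF compact_scaled_walk])
        show "?\<Phi> (scaled_walk Y n \<omega>) \<le> (1 / L powr q) * set_radius (scaled_walk Y n \<omega>) powr q" for \<omega>
          unfolding scale using set_radius_nonneg[OF compact_scaled_walk, of Y n \<omega>] q L
          by (intro mult_left_mono powr_mono2) auto
      qed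
      also have "\<dots> = (1 / L powr q) * (\<integral>\<omega>. set_radius (scaled_walk Y n \<omega>) powr q \<partial>M)" by simp
      also have "\<dots> \<le> (1 / L powr q) * D" by (intro mult_left_mono D) auto
      finally show ?thesis by simp
    qed
    have "(\<integral>\<omega>. ?\<Phi> (path_set \<omega>) \<partial>N) \<le> D / L powr q"
      using functional_tendsto[OF uc b] bn unfolding path_set_def by (intro LIMSEQ_le_const2) auto
    moreover have "(\<integral>\<omega>. ?\<Phi> (path_set \<omega>) \<partial>N) = (1 / L powr q) * (\<integral>\<omega>. min (r \<omega>) L powr q \<partial>N)"
      unfolding scale r_def by simp
    ultimately have "(\<integral>\<omega>. min (r \<omega>) L powr q \<partial>N) \<le> D"
      using L by (simp add: divide_le_cancel)
    moreover have "integrable N (\<lambda>\<omega>. min (r \<omega>) L powr q)"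
    proof (rule N.integrable_const_bound[of _ "L powr q"])
      show "AE \<omega> in N. norm (min (r \<omega>) L powr q) \<le> L powr q"
        using r0 L q by (intro AE_I2) (auto intro!: powr_mono2)
    qed measurable
    ultimately have "(\<integral>\<^sup>+\<omega>. ennreal (min (r \<omega>) L powr q) \<partial>N) \<le> ennreal D"
      by (subst nn_integral_eq_integral) (auto intro: ennreal_leI)
    then show ?thesis by (simp only: L_def)
  qed
  have "(\<integral>\<^sup>+\<omega>. ennreal (r \<omega> powr q) \<partial>N) = (\<integral>\<^sup>+\<omega>. (SUP k. ennreal (min (r \<omega>) (real (Suc k)) powr q)) \<partial>N)"
  proof (rule nn_integral_cong)
    fix \<omega> assume \<omega>: "\<omega> \<in> space N"
    show "ennreal (r \<omega> powr q) = (SUP k. ennreal (min (r \<omega>) (real (Suc k)) powr q))"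
    proof (rule antisym)
      obtain k :: nat where "r \<omega> \<le> real k" using real_arch_simple by blast
      then have "min (r \<omega>) (real (Suc k)) = r \<omega>" by simp
      then show "ennreal (r \<omega> powr q) \<le> (SUP k. ennreal (min (r \<omega>) (real (Suc k)) powr q))"
        by (intro SUP_upper2[of k]) auto
      show "(SUP k. ennreal (min (r \<omega>) (real (Suc k)) powr q)) \<le> ennreal (r \<omega> powr q)"
        using r0[OF \<omega>] q by (intro SUP_least ennreal_leI powr_mono2) auto
    qed
  qed
  also have "\<dots> \<le> ennreal D"
  proof -
    have "(\<integral>\<^sup>+\<omega>. (SUP k. ennreal (min (r \<omega>) (real (Suc k)) powr q)) \<partial>N) = (SUP k. (\<integral>\<^sup>+\<omega>. ennreal (min (r \<omega>) (real (Suc k)) powr q) \<partial>N))"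
    proof (rule nn_integral_monotone_convergence_SUP_AE)
      show "AE \<omega> in N. ennreal (min (r \<omega>) (real (Suc k)) powr q) \<le> ennreal (min (r \<omega>) (real (Suc (Suc k))) powr q)" for k
        using r0 q by (intro AE_I2 ennreal_leI powr_mono2) auto
    qed measurable
    then show ?thesis using trunc by (simp add: SUP_least)
  qed
  finally have fin: "(\<integral>\<^sup>+\<omega>. ennreal (r \<omega> powr q) \<partial>N) \<le> ennreal D" .
  show int: "integrable N (\<lambda>\<omega>. set_radius (path_set \<omega>) powr q)"
    unfolding r_def[symmetric] using fin by (intro integrableI_bounded) (auto simp: le_less_trans)
  show "(\<integral>\<omega>. set_radius (path_set \<omega>) powr q \<partial>N) \<le> D"
    using fin D(1) nn_integral_eq_integral[OF int] by (simp add: r_def)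
qed

lemma integrable_functional:
  assumes f: "f \<in> borel_measurable R" and r: "integrable R (\<lambda>\<omega>. r \<omega> powr q)" and R: "prob_space R"
    and bound: "\<And>\<omega>. \<omega> \<in> space R \<Longrightarrow> 0 \<le> r \<omega> \<and> \<bar>f \<omega>\<bar> \<le> C * r \<omega> powr s"
    and s: "0 \<le> s" "s \<le> q" and C: "C \<ge> 0"
  shows "integrable R (f :: 'c \<Rightarrow> real)"
proof -
  interpret R: prob_space R by fact
  show ?thesis
  proof (rule Bochner_Integration.integrable_bound)
    show "integrable R (\<lambda>\<omega>. C * (1 + r \<omega> powr q))" using r by simp
    show "AE \<omega> in R. norm (f \<omega>) \<le> norm (C * (1 + r \<omega> powr q))"
    proof (rule AE_I2)
      fix \<omega> assume \<omega>: "\<omega> \<in> space R"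
      have "\<bar>f \<omega>\<bar> \<le> C * r \<omega> powr s" using bound[OF \<omega>] by simp
      also have "\<dots> \<le> C * (1 + r \<omega> powr q)"
        using bound[OF \<omega>] s C by (intro mult_left_mono powr_le_1_plus) auto
      finally show "norm (f \<omega>) \<le> norm (C * (1 + r \<omega> powr q))" by simp
    qed
  qed fact
qed

text \<open>The error depends on the probability space only through the moment bound
  \<open>D\<close>, so it is the same for all \<open>n\<close> and for the limit.\<close>

lemma truncation_error:
  assumes R: "prob_space R" and f: "f \<in> borel_measurable R" and g: "integrable R g" and r: "integrable R (\<lambda>\<omega>. r \<omega> powr q)" "(\<integral>\<omega>. r \<omega> powr q \<partial>R) \<le> D"
    and bound: "\<And>\<omega>. \<omega> \<in> space R \<Longrightarrow> 0 \<le> r \<omega> \<and> \<bar>f \<omega>\<bar> \<le> C * r \<omega> powr s"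
    and g_eq: "\<And>\<omega>. \<omega> \<in> space R \<Longrightarrow> g \<omega> = f \<omega> * cutoff L (r \<omega>)"
    and s: "0 \<le> s" "s \<le> q" and C: "C \<ge> 0" and L: "L > 0"
  shows "\<bar>(\<integral>\<omega>. f \<omega> \<partial>R) - (\<integral>\<omega>. g \<omega> \<partial>R)\<bar> \<le> C * D * L powr (s - q)"
proof -
  have fi: "integrable R (f :: 'c \<Rightarrow> real)" by (rule integrable_functional[OF f r(1) R bound s C])
  have pt: "\<bar>f \<omega> - g \<omega>\<bar> \<le> C * L powr (s - q) * r \<omega> powr q" if \<omega>: "\<omega> \<in> space R" for \<omega>
  proof (cases "r \<omega> \<le> L")
    case True
    then show ?thesis using C g_eq[OF \<omega>] L by (simp add: cutoff_eq_1)
  next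
    case False
    then have rL: "r \<omega> \<ge> L" "r \<omega> > 0" using L by auto
    have "\<bar>f \<omega> - g \<omega>\<bar> = \<bar>f \<omega>\<bar> * \<bar>1 - cutoff L (r \<omega>)\<bar>"
      unfolding g_eq[OF \<omega>] abs_mult[symmetric] by (simp add: algebra_simps)
    also have "\<dots> \<le> \<bar>f \<omega>\<bar> * 1" using cutoff_bounds[of L "r \<omega>"] by (intro mult_left_mono) auto
    also have "\<dots> \<le> C * r \<omega> powr s" using bound[OF \<omega>] by simp
    \<comment> \<open>Beyond the level \<open>L\<close> the missing power \<open>s - q\<close> is
      negative and can be evaluated at \<open>L\<close>; the full \<open>q\<close>-th power is left
      for the moment bound.\<close>
    also have "r \<omega> powr s = r \<omega> powr (s - q) * r \<omega> powr q" by (simp flip: powr_add)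
    also have "r \<omega> powr (s - q) \<le> L powr (s - q)" using rL L s by (intro powr_mono2') auto
    finally show ?thesis using C by (simp add: mult_left_mono mult_right_mono mult.assoc)
  qed
  have "\<bar>(\<integral>\<omega>. f \<omega> \<partial>R) - (\<integral>\<omega>. g \<omega> \<partial>R)\<bar> = \<bar>\<integral>\<omega>. f \<omega> - g \<omega> \<partial>R\<bar>" using fi g by simp
  also have "\<dots> \<le> (\<integral>\<omega>. \<bar>f \<omega> - g \<omega>\<bar> \<partial>R)" by (rule integral_abs_bound)
  also have "\<dots> \<le> (\<integral>\<omega>. C * L powr (s - q) * r \<omega> powr q \<partial>R)"
    using fi g r(1) pt by (intro integral_mono integrable_abs) auto
  also have "\<dots> = C * L powr (s - q) * (\<integral>\<omega>. r \<omega> powr q \<partial>R)" by simp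
  also have "\<dots> \<le> C * L powr (s - q) * D" using C r(2) by (intro mult_left_mono) auto
  finally show ?thesis by (simp add: mult_ac)
qed

text \<open>Growth of order \<open>s < q\<close> makes the functional uniformly integrable: the
  truncation error is of order \<open>L powr (s - q)\<close>, uniformly in \<open>n\<close>, and the
  truncated functional is covered by the bounded case.\<close>

lemma unbounded_functional_tendsto:
  fixes h :: "(real^'n) set \<Rightarrow> real"
  assumes h: "hausdorff_luc h" and bound: "\<And>A. compact A \<Longrightarrow> A \<noteq> {} \<Longrightarrow> \<bar>h A\<bar> \<le> C * set_radius A powr s"
    and C: "C \<ge> 0" and s: "0 \<le> s" "s < q"
  shows "integrable N (\<lambda>\<omega>. h (path_set \<omega>))" "\<And>n. integrable M (\<lambda>\<omega>. h (scaled_walk Y n \<omega>))"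
    "(\<lambda>n. \<integral>\<omega>. h (scaled_walk Y n \<omega>) \<partial>M) \<longlonglongrightarrow> (\<integral>\<omega>. h (path_set \<omega>) \<partial>N)"
proof -
  obtain D where D: "D \<ge> 0" "\<And>n. integrable M (\<lambda>\<omega>. set_radius (scaled_walk Y n \<omega>) powr q)"
    "\<And>n. (\<integral>\<omega>. set_radius (scaled_walk Y n \<omega>) powr q \<partial>M) \<le> D"
    using radius_moment_walk by metis
  note DN = radius_moment_path[OF D]
  have bM: "0 \<le> set_radius (scaled_walk Y n \<omega>) \<and> \<bar>h (scaled_walk Y n \<omega>)\<bar> \<le> C * set_radius (scaled_walk Y n \<omega>) powr s" for n \<omega>
    by (intro conjI set_radius_nonneg bound compact_scaled_walk)
  have bN: "0 \<le> set_radius (path_set \<omega>) \<and> \<bar>h (path_set \<omega>)\<bar> \<le> C * set_radius (path_set \<omega>) powr s" if "\<omega> \<in> space N" for \<omega>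
    using that by (intro conjI set_radius_nonneg bound compact_path_set path_set_nonempty)
  have sq: "s \<le> q" using s by simp
  note hM = measurable_scaled_walk_functional[OF h] and hN = measurable_path_set_functional[OF h]
  show "integrable N (\<lambda>\<omega>. h (path_set \<omega>))"
    by (rule integrable_functional[OF hN DN(1) N.prob_space_axioms bN s(1) sq C])
  show "integrable M (\<lambda>\<omega>. h (scaled_walk Y n \<omega>))" for n
    by (rule integrable_functional[OF hM D(2) prob bM s(1) sq C])
  show "(\<lambda>n. \<integral>\<omega>. h (scaled_walk Y n \<omega>) \<partial>M) \<longlonglongrightarrow> (\<integral>\<omega>. h (path_set \<omega>) \<partial>N)"
  proof (rule tendstoI)
    fix e :: real assume e: "e > 0"
    have "((\<lambda>L. C * D * L powr (s - q)) \<longlongrightarrow> C * D * 0) at_top"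
      using s by (intro tendsto_mult tendsto_const tendsto_neg_powr filterlim_ident) auto
    then have "eventually (\<lambda>L. C * D * L powr (s - q) < e / 3) at_top"
      using e by (intro order_tendstoD(2)) auto
    then have "eventually (\<lambda>L. C * D * L powr (s - q) < e / 3 \<and> L > 0) at_top"
      using eventually_gt_at_top[of 0] by eventually_elim simp
    then obtain L where L: "C * D * L powr (s - q) < e / 3" "L > 0"
      by (metis (mono_tags, lifting) eventually_at_top_linorder order_refl)
    \<comment> \<open>Bounds the truncated functional, which vanishes beyond radius
      \<open>2 * L\<close>; the summand 1 makes it positive, so that dividing by it normalises to
      the bound 1.\<close>
    define B where "B = C * (2 * L) powr s + 1"
    have B: "B > 0" using C by (simp add: B_def add_nonneg_pos)
    let ?g = "\<lambda>A. h A * cutoff L (set_radius A)"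
    have gb: "\<bar>?g A\<bar> \<le> B" if A: "compact A" "A \<noteq> {}" for A
    proof (cases "set_radius A \<ge> 2 * L")
      case True
      then show ?thesis using L B by (simp add: cutoff_eq_0)
    next
      case False
      have "\<bar>?g A\<bar> \<le> \<bar>h A\<bar> * 1" unfolding abs_mult
        using cutoff_bounds[of L "set_radius A"] by (intro mult_left_mono) auto
      also have "\<dots> \<le> C * set_radius A powr s" using bound[OF A] by simp
      also have "\<dots> \<le> C * (2 * L) powr s"
        using False C s set_radius_nonneg[OF A] by (intro mult_left_mono powr_mono2) auto
      finally show ?thesis by (simp add: B_def)
    qed
    have uc: "hausdorff_uc ?g" by (rule hausdorff_uc_cutoff[OF h bound L(2) C s(1)])
    have uc': "hausdorff_uc (\<lambda>A. ?g A / B)"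
      unfolding hausdorff_uc_def
    proof (intro allI impI)
      fix \<epsilon> :: real assume "\<epsilon> > 0"
      then have "\<epsilon> * B > 0" using B by simp
      then obtain \<delta> where \<delta>: "\<delta> > 0" "\<And>A A'. compact A \<Longrightarrow> A \<noteq> {} \<Longrightarrow> compact A' \<Longrightarrow> A' \<noteq> {} \<Longrightarrow>
          hausdorff_close \<delta> A A' \<Longrightarrow> \<bar>?g A - ?g A'\<bar> \<le> \<epsilon> * B"
        using hausdorff_ucD[OF uc] by metis
      have "\<bar>?g A / B - ?g A' / B\<bar> \<le> \<epsilon>"
        if "compact A" "A \<noteq> {}" "compact A'" "A' \<noteq> {}" "hausdorff_close \<delta> A A'" for A A'
        using \<delta>(2)[OF that] B by (simp add: diff_divide_distrib[symmetric] pos_divide_le_eq)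
      with \<delta>(1) show "\<exists>\<delta>>0. \<forall>A A'. compact A \<longrightarrow> A \<noteq> {} \<longrightarrow> compact A' \<longrightarrow> A' \<noteq> {} \<longrightarrow>
          hausdorff_close \<delta> A A' \<longrightarrow> \<bar>?g A / B - ?g A' / B\<bar> \<le> \<epsilon>" by blast
    qed
    have "(\<lambda>n. B * (\<integral>\<omega>. ?g (scaled_walk Y n \<omega>) / B \<partial>M)) \<longlonglongrightarrow> B * (\<integral>\<omega>. ?g (path_set \<omega>) / B \<partial>N)"
      unfolding path_set_def using gb B by (intro tendsto_mult_left functional_tendsto uc') simp
    then have lim: "(\<lambda>n. \<integral>\<omega>. ?g (scaled_walk Y n \<omega>) \<partial>M) \<longlonglongrightarrow> (\<integral>\<omega>. ?g (path_set \<omega>) \<partial>N)"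
      using B by simp
    note gm = hausdorff_uc_imp_luc[OF uc]
    have errM: "\<bar>(\<integral>\<omega>. h (scaled_walk Y n \<omega>) \<partial>M) - (\<integral>\<omega>. ?g (scaled_walk Y n \<omega>) \<partial>M)\<bar> \<le> C * D * L powr (s - q)" for n
    proof (rule truncation_error[OF prob hM _ D(2,3) bM refl s(1) sq C L(2)])
      show "integrable M (\<lambda>\<omega>. ?g (scaled_walk Y n \<omega>))"
        by (intro M.integrable_const_bound[of _ B] AE_I2 measurable_scaled_walk_functional gm)
          (simp only: real_norm_def gb[OF compact_scaled_walk])
    qed
    have errN: "\<bar>(\<integral>\<omega>. h (path_set \<omega>) \<partial>N) - (\<integral>\<omega>. ?g (path_set \<omega>) \<partial>N)\<bar> \<le> C * D * L powr (s - q)"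
    proof (rule truncation_error[OF N.prob_space_axioms hN _ DN bN refl s(1) sq C L(2)])
      show "integrable N (\<lambda>\<omega>. ?g (path_set \<omega>))"
        by (intro N.integrable_const_bound[of _ B] AE_I2 measurable_path_set_functional gm)
          (simp only: real_norm_def gb[OF compact_path_set path_set_nonempty])
    qed
    have "eventually (\<lambda>n. dist (\<integral>\<omega>. ?g (scaled_walk Y n \<omega>) \<partial>M) (\<integral>\<omega>. ?g (path_set \<omega>) \<partial>N) < e / 3) sequentially"
      using lim e by (intro tendstoD) auto
    then show "eventually (\<lambda>n. dist (\<integral>\<omega>. h (scaled_walk Y n \<omega>) \<partial>M) (\<integral>\<omega>. h (path_set \<omega>) \<partial>N) < e) sequentially"
    proof eventually_elim
      case (elim n)
      then show ?case using errM[of n] errN L(1) unfolding dist_real_def by linarith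
    qed
  qed
qed

end

section \<open>Scaling back to the walk, and the variances\<close>

lemma walk_hull_eq_scaled:
  assumes "n > 0"
  shows "walk_hull Y n \<omega> = (*\<^sub>R) (sqrt (real n)) ` (convex hull (scaled_walk Y n \<omega>))"
proof -
  have "(\<lambda>k. random_walk Y k \<omega>) ` {0..n} = (*\<^sub>R) (sqrt (real n)) ` scaled_walk Y n \<omega>"
    using assms by (simp add: scaled_walk_def image_image)
  then show ?thesis by (simp add: walk_hull_def convex_hull_scaling)
qed

lemma finite_variance_cmult:
  assumes "finite_variance R f"
  shows "finite_variance R (\<lambda>\<omega>. c * f \<omega>)"
proof -
  have "(c * f \<omega> - (\<integral>\<omega>. c * f \<omega> \<partial>R))\<^sup>2 = c\<^sup>2 * (f \<omega> - (\<integral>\<omega>. f \<omega> \<partial>R))\<^sup>2" for \<omega>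
    by (simp add: power_mult_distrib[symmetric] right_diff_distrib)
  then show ?thesis using assms by (simp add: finite_variance_def)
qed

lemma (in prob_space) finite_varianceI:
  assumes "integrable M f" "integrable M (\<lambda>\<omega>. (f \<omega>)\<^sup>2)"
  shows "finite_variance M (f :: 'a \<Rightarrow> real)"
  using assms unfolding finite_variance_def by (simp add: power2_diff)

text \<open>Finiteness is asserted for every walk hull as well, so that each variance in the limit
  is a genuine variance and not a default value of the integral.\<close>

theorem proposition4p1:
  fixes M :: "'a measure" and N :: "'b measure"
    and Y :: "nat \<Rightarrow> 'a \<Rightarrow> real^'n" and X :: "real \<Rightarrow> 'b \<Rightarrow> real^'n"
    and m :: nat and p :: real
  assumes "1 \<le> m" "m \<le> CARD('n)"
    and "prob_space M"
    and "prob_space.indep_vars M (\<lambda>_. borel) Y {1..}"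
    and "\<And>i. i \<ge> 1 \<Longrightarrow> distr M borel (Y i) = distr M borel (Y 1)"
    and "p > 2"
    and "integrable M (\<lambda>\<omega>. norm (Y 1 \<omega>) powr (real m * p))"
    and "(\<integral>\<omega>. Y 1 \<omega> \<partial>M) = 0"
    and "\<And>a b. a \<noteq> 0 \<Longrightarrow> measure M {\<omega> \<in> space M. Y 1 \<omega> \<in> {x. a \<bullet> x = b}} = 0"
    and "brownian_motion N (second_moment_matrix M (Y 1)) X"
  shows "finite_variance N (\<lambda>\<omega>. intrinsic_volume m (path_hull X \<omega>)) \<and>
    (\<forall>n. finite_variance M (\<lambda>\<omega>. intrinsic_volume m (walk_hull Y n \<omega>))) \<and>
    (\<lambda>n. prob_space.variance M (\<lambda>\<omega>. intrinsic_volume m (walk_hull Y n \<omega>)) / real n ^ m)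
      \<longlonglongrightarrow> prob_space.variance N (\<lambda>\<omega>. intrinsic_volume m (path_hull X \<omega>))"
proof -
  have m: "real m \<ge> 1" using assms(1) by simp
  have mp: "2 * real m < real m * p" "real m * p > 2"
  proof -
    show 1: "2 * real m < real m * p" using m \<open>p > 2\<close> by simp
    then show "real m * p > 2" using m by linarith
  qed
  interpret walk_and_limit M N Y X "real m * p"
    by (rule walk_and_limit.intro[OF assms(3,4,5) mp(2) assms(7,8,10)])
  define V where "V A = intrinsic_volume m (convex hull A)" for A :: "(real^'n) set"
  obtain C where C: "C \<ge> 0" "\<And>A. compact A \<Longrightarrow> A \<noteq> {} \<Longrightarrow> \<bar>V A\<bar> \<le> C * set_radius A powr real m"
    using intrinsic_volume_hull_bound[OF assms(1,2)] unfolding V_def by metis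
  have V: "hausdorff_luc V" unfolding V_def[abs_def] by (rule intrinsic_volume_hull_luc[OF assms(2)])
  have V2: "hausdorff_luc (\<lambda>A. (V A)\<^sup>2)"
    by (rule hausdorff_luc_power2[OF V C(2,1)]) simp_all
  have V2b: "\<bar>(V A)\<^sup>2\<bar> \<le> C\<^sup>2 * set_radius A powr (2 * real m)" if A: "compact A" "A \<noteq> {}" for A
  proof -
    have "\<bar>V A\<bar>\<^sup>2 \<le> (C * set_radius A powr real m)\<^sup>2" by (intro power_mono C A) simp
    also have "\<dots> = C\<^sup>2 * (set_radius A powr real m)\<^sup>2" by (rule power_mult_distrib)
    also have "(set_radius A powr real m)\<^sup>2 = set_radius A powr (2 * real m)"
      unfolding power2_eq_square powr_add[symmetric] by (simp only: mult_2)
    finally show ?thesis by simp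
  qed
  have s1: "0 \<le> real m" "real m < real m * p" using mp m by linarith+
  have s2: "0 \<le> C\<^sup>2" "0 \<le> 2 * real m" "2 * real m < real m * p" using mp(1) by simp_all
  have L1: "integrable N (\<lambda>\<omega>. V (path_set \<omega>))" "integrable M (\<lambda>\<omega>. V (scaled_walk Y n \<omega>))"
      "(\<lambda>n. M.expectation (\<lambda>\<omega>. V (scaled_walk Y n \<omega>))) \<longlonglongrightarrow> N.expectation (\<lambda>\<omega>. V (path_set \<omega>))" for n
    by (rule unbounded_functional_tendsto[OF V _ C(1) s1], rule C(2), assumption+)+
  have L2: "integrable N (\<lambda>\<omega>. (V (path_set \<omega>))\<^sup>2)" "integrable M (\<lambda>\<omega>. (V (scaled_walk Y n \<omega>))\<^sup>2)"
      "(\<lambda>n. M.expectation (\<lambda>\<omega>. (V (scaled_walk Y n \<omega>))\<^sup>2)) \<longlonglongrightarrow> N.expectation (\<lambda>\<omega>. (V (path_set \<omega>))\<^sup>2)" for n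
    by (rule unbounded_functional_tendsto[OF V2 _ s2], rule V2b, assumption+)+
  \<comment> \<open>The image of the unit interval under a continuous path is compact, so taking the
    closure in \<open>path_hull\<close> changes nothing.\<close>
  have path: "intrinsic_volume m (path_hull X \<omega>) = V (path_set \<omega>)" if "\<omega> \<in> space N" for \<omega>
    using compact_imp_closed[OF compact_path_set[OF that]]
    by (simp add: V_def path_hull_def path_set_def closure_closed)
  have walk: "intrinsic_volume m (walk_hull Y n \<omega>) = sqrt (real n) ^ m * V (scaled_walk Y n \<omega>)" if "n > 0" for n \<omega>
    unfolding walk_hull_eq_scaled[OF that] V_def using that
    by (intro intrinsic_volume_scaleR compact_convex_hull compact_scaled_walk) (auto simp: compact_scaled_walk)
  have varN: "N.variance (\<lambda>\<omega>. V (path_set \<omega>)) = N.expectation (\<lambda>\<omega>. (V (path_set \<omega>))\<^sup>2) - (N.expectation (\<lambda>\<omega>. V (path_set \<omega>)))\<^sup>2"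
    by (rule N.variance_eq[OF L1(1) L2(1)])
  have varM: "M.variance (\<lambda>\<omega>. V (scaled_walk Y n \<omega>)) = M.expectation (\<lambda>\<omega>. (V (scaled_walk Y n \<omega>))\<^sup>2) - (M.expectation (\<lambda>\<omega>. V (scaled_walk Y n \<omega>)))\<^sup>2" for n
    by (rule M.variance_eq[OF L1(2) L2(2)])
  have fN: "finite_variance N (\<lambda>\<omega>. V (path_set \<omega>))"
    by (rule N.finite_varianceI[OF L1(1) L2(1)])
  have "finite_variance N (\<lambda>\<omega>. intrinsic_volume m (path_hull X \<omega>))"
    using fN path unfolding finite_variance_def by (simp cong: Bochner_Integration.integral_cong Bochner_Integration.integrable_cong)
  moreover have "finite_variance M (\<lambda>\<omega>. intrinsic_volume m (walk_hull Y n \<omega>))" for n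
  \<comment> \<open>The scaling identity divides by \<open>sqrt n\<close>; for \<open>n = 0\<close>
    the hull is the single point 0 and its intrinsic volume is a constant.\<close>
  proof (cases "n = 0")
    case True
    then have "(\<lambda>\<omega>. intrinsic_volume m (walk_hull Y n \<omega>)) = (\<lambda>_. intrinsic_volume m {0 :: real^'n})"
      by (simp add: walk_hull_def random_walk_def)
    then show ?thesis by (simp add: finite_variance_def)
  next
    case False
    then show ?thesis
      using finite_variance_cmult[OF M.finite_varianceI[OF L1(2) L2(2)], of "sqrt (real n) ^ m"]
      by (simp add: walk)
  qed
  moreover have "(\<lambda>n. M.variance (\<lambda>\<omega>. intrinsic_volume m (walk_hull Y n \<omega>)) / real n ^ m)
      \<longlonglongrightarrow> N.variance (\<lambda>\<omega>. intrinsic_volume m (path_hull X \<omega>))"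
  proof -
    have "(\<lambda>n. M.variance (\<lambda>\<omega>. V (scaled_walk Y n \<omega>))) \<longlonglongrightarrow> N.variance (\<lambda>\<omega>. V (path_set \<omega>))"
      unfolding varM varN by (intro tendsto_diff tendsto_power L1(3) L2(3))
    moreover have "eventually (\<lambda>n. M.variance (\<lambda>\<omega>. V (scaled_walk Y n \<omega>)) =
        M.variance (\<lambda>\<omega>. intrinsic_volume m (walk_hull Y n \<omega>)) / real n ^ m) sequentially"
      using eventually_gt_at_top[of 0]
    proof eventually_elim
      case (elim n)
      let ?c = "sqrt (real n) ^ m"
      \<comment> \<open>Homogeneity of degree \<open>m\<close> pulls out \<open>sqrt n ^ m\<close>;
        its square is precisely the normalisation \<open>n ^ m\<close> of the variance.\<close>
      have c: "?c\<^sup>2 = real n ^ m" by (simp add: power_mult[symmetric] mult.commute[of m 2]) (simp add: power_mult)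
      have "(?c * V (scaled_walk Y n \<omega>) - M.expectation (\<lambda>\<omega>. ?c * V (scaled_walk Y n \<omega>)))\<^sup>2 =
          ?c\<^sup>2 * (V (scaled_walk Y n \<omega>) - M.expectation (\<lambda>\<omega>. V (scaled_walk Y n \<omega>)))\<^sup>2" for \<omega>
        by (simp add: power_mult_distrib[symmetric] right_diff_distrib)
      then have "M.variance (\<lambda>\<omega>. intrinsic_volume m (walk_hull Y n \<omega>)) = real n ^ m * M.variance (\<lambda>\<omega>. V (scaled_walk Y n \<omega>))"
        unfolding walk[OF elim] by (simp add: c)
      then show ?case using elim by simp
    qed
    ultimately have "(\<lambda>n. M.variance (\<lambda>\<omega>. intrinsic_volume m (walk_hull Y n \<omega>)) / real n ^ m) \<longlonglongrightarrow> N.variance (\<lambda>\<omega>. V (path_set \<omega>))"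
      by (rule Lim_transform_eventually)
    moreover have "N.variance (\<lambda>\<omega>. intrinsic_volume m (path_hull X \<omega>)) = N.variance (\<lambda>\<omega>. V (path_set \<omega>))"
      using path by (simp cong: Bochner_Integration.integral_cong)
    ultimately show ?thesis by simp
  qed
  ultimately show ?thesis by blast
qed

end
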